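(* For $c>0$ let $\phi_c(z)=\frac{1}{(1-z)^c}$, $z\in\mathbb{D}$, and let $b=b_c:\mathbb{D}\to\mathbb{D}$ be the analytic function, non-extreme in the unit ball of $\mathcal{H}^\infty$, determined by $\phi_c=b/a$, where $a$ is the Pythagorean mate of $b$. Let $$\theta(z)=\exp\Big(-\frac12\cdot\frac{1+z}{1-z}\Big),\quad z\in\mathbb{D}.$$ (i) If $c<1$, then $\mathcal{H}(\theta b)$ contains the Dirichlet space $\mathcal{D}$, and the embedding $\mathcal{D}\hookrightarrow\mathcal{H}(\theta b)$ is compact. (ii) If $c=1$, then $\mathcal{H}(\theta b)$ contains $\mathcal{D}$, and the embedding is not compact. (iii) If $c>1$, then $\mathcal{H}(\theta b)$ does not contain $\mathcal{D}$.
   Context: $\mathbb{D}$ is the open unit disk, $\mathbb{T}$ the unit circle, $A$ area measure on $\mathbb{D}$ normalized by $A(\mathbb{D})=1$, $\mathcal{H}^2$ the classical Hardy space with norm $\|\cdot\|_2$, $\mathcal{H}^\infty$ the algebra of bounded analytic functions on $\mathbb{D}$. The power $(1-z)^c$ uses the principal branch. The Dirichlet space $\mathcal{D}$ consists of analytic $f$ on $\mathbb{D}$ with $\|f\|_{\mathcal{D}}^2:=\|f\|_2^2+\int_{\mathbb{D}}|f'|^2dA<\infty$. For analytic $B:\mathbb{D}\to\mathbb{D}$, the de Branges-Rovnyak space $\mathcal{H}(B)$ is the Hilbert space of analytic functions on $\mathbb{D}$ with reproducing kernel $k_B(\lambda,z)=\frac{1-\overline{B(\lambda)}B(z)}{1-\overline{\lambda}z}$.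 If $B$ is a non-extreme point of the unit ball of $\mathcal{H}^\infty$ (equivalently $\log(1-|B|)$ is integrable on $\mathbb{T}$), its Pythagorean mate is the unique outer function $a$ on $\mathbb{D}$ with $a(0)>0$ and $|a|^2+|B|^2=1$ a.e. on $\mathbb{T}$. The map $B\mapsto B/a$ is a bijection from the non-extreme points of the unit ball of $\mathcal{H}^\infty$ onto the Smirnov class $\mathcal{N}^+$ (quotients of bounded analytic functions with outer denominator), so each $\phi_c\in\mathcal{N}^+$ determines $b_c$; $b_c$ is outer, and $a$ is also the Pythagorean mate of $\theta b_c$. *)

theory Defs
  imports "HOL-Analysis.Analysis"
begin

abbreviation unit_disk :: "complex set" where
  "unit_disk \<equiv> ball 0 1"

text \<open>
  Elements of spaces of functions on the disk are represented by total functions that vanish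
  outside the disk, so that equality of analytic functions is HOL equality.
  For the individual functions \<open>B\<close>, \<open>a\<close>, \<open>b\<close>, \<open>\<theta>\<close>, \<open>\<phi>\<close> only the values on the disk are used.
\<close>

definition disk_analytic :: "(complex \<Rightarrow> complex) set" where
  "disk_analytic = {f. f holomorphic_on unit_disk \<and> (\<forall>z. z \<notin> unit_disk \<longrightarrow> f z = 0)}"

definition disk_area :: "complex measure" where
  "disk_area = uniform_measure lborel unit_disk"

definition circle_measure :: "complex measure" where
  "circle_measure = distr (uniform_measure lborel {0..2 * pi}) borel cis"

definition hardy2_norm_sq :: "(complex \<Rightarrow> complex) \<Rightarrow> ennreal" where
  "hardy2_norm_sq f =
     (SUP r\<in>{0..<1::real}. \<integral>\<^sup>+\<zeta>. ennreal ((cmod (f (of_real r * \<zeta>)))\<^sup>2) \<partial>circle_measure)"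

definition dirichlet_norm_sq :: "(complex \<Rightarrow> complex) \<Rightarrow> ennreal" where
  "dirichlet_norm_sq f =
     hardy2_norm_sq f + (\<integral>\<^sup>+z. ennreal ((cmod (deriv f z))\<^sup>2) \<partial>disk_area)"

definition dirichlet_space :: "(complex \<Rightarrow> complex) set" where
  "dirichlet_space = {f \<in> disk_analytic. dirichlet_norm_sq f < \<infinity>}"

definition dirichlet_norm :: "(complex \<Rightarrow> complex) \<Rightarrow> real" where
  "dirichlet_norm f = sqrt (enn2real (dirichlet_norm_sq f))"

definition ip_norm :: "((complex \<Rightarrow> complex) \<Rightarrow> (complex \<Rightarrow> complex) \<Rightarrow> complex) \<Rightarrow>
    (complex \<Rightarrow> complex) \<Rightarrow> real" where
  "ip_norm ip f = sqrt (Re (ip f f))"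

text \<open>
  The values of \<open>ip\<close> outside \<open>H\<close> are arbitrary, while the locale \<open>Metric_space\<close> wants nonnegativity
  and symmetry on the whole type; hence the distance is set to 0 outside \<open>H\<close>.
\<close>

definition ip_dist :: "(complex \<Rightarrow> complex) set \<Rightarrow>
    ((complex \<Rightarrow> complex) \<Rightarrow> (complex \<Rightarrow> complex) \<Rightarrow> complex) \<Rightarrow>
    (complex \<Rightarrow> complex) \<Rightarrow> (complex \<Rightarrow> complex) \<Rightarrow> real" where
  "ip_dist H ip f g = (if f \<in> H \<and> g \<in> H then ip_norm ip (\<lambda>z. f z - g z) else 0)"

locale analytic_inner_product_space =
  fixes H :: "(complex \<Rightarrow> complex) set"
    and ip :: "(complex \<Rightarrow> complex) \<Rightarrow> (complex \<Rightarrow> complex) \<Rightarrow> complex"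
  assumes analytic: "H \<subseteq> disk_analytic"
    and zero_mem: "(\<lambda>_. 0) \<in> H"
    and add_mem: "f \<in> H \<Longrightarrow> g \<in> H \<Longrightarrow> (\<lambda>z. f z + g z) \<in> H"
    and scale_mem: "f \<in> H \<Longrightarrow> (\<lambda>z. \<alpha> * f z) \<in> H"
    and ip_add: "f \<in> H \<Longrightarrow> g \<in> H \<Longrightarrow> h \<in> H \<Longrightarrow> ip (\<lambda>z. f z + g z) h = ip f h + ip g h"
    and ip_scale: "f \<in> H \<Longrightarrow> h \<in> H \<Longrightarrow> ip (\<lambda>z. \<alpha> * f z) h = \<alpha> * ip f h"
    and ip_cnj: "f \<in> H \<Longrightarrow> g \<in> H \<Longrightarrow> ip g f = cnj (ip f g)"
    and ip_nonneg: "f \<in> H \<Longrightarrow> 0 \<le> Re (ip f f)"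
    and ip_definite: "f \<in> H \<Longrightarrow> ip f f = 0 \<Longrightarrow> f = (\<lambda>_. 0)"

begin

lemma diff_mem: "f \<in> H \<Longrightarrow> g \<in> H \<Longrightarrow> (\<lambda>z. f z - g z) \<in> H"
  using add_mem[of f "\<lambda>z. (-1) * g z"] scale_mem[of g "-1"] by simp

lemma ip_quadratic:
  assumes f: "f \<in> H" and g: "g \<in> H"
  shows "Re (ip (\<lambda>z. f z + of_real t * g z) (\<lambda>z. f z + of_real t * g z)) =
         Re (ip f f) + 2 * t * Re (ip f g) + t\<^sup>2 * Re (ip g g)"
proof -
  let ?g = "\<lambda>z. of_real t * g z" let ?h = "\<lambda>z. f z + ?g z"
  have m: "?g \<in> H" "?h \<in> H" using f g add_mem scale_mem by auto
  have r: "Re (ip u v) = Re (ip v u)" if "u \<in> H" "v \<in> H" for u v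
    using ip_cnj[OF that] by simp
  have a: "Re (ip ?h v) = Re (ip f v) + t * Re (ip g v)" if "v \<in> H" for v
    using ip_add[OF f m(1) that] ip_scale[OF g that, of "of_real t"] by simp
  have "Re (ip ?h ?h) = Re (ip ?h f) + t * Re (ip ?h g)"
    using a[OF m(2)] r[OF f m(2)] r[OF g m(2)] by simp
  also have "\<dots> = Re (ip f f) + 2 * t * Re (ip f g) + t\<^sup>2 * Re (ip g g)"
    using a[OF f] a[OF g] r[OF f g] by (simp add: algebra_simps power2_eq_square)
  finally show ?thesis .
qed

lemma ip_norm_triangle:
  assumes f: "f \<in> H" and g: "g \<in> H"
  shows "ip_norm ip (\<lambda>z. f z + g z) \<le> ip_norm ip f + ip_norm ip g"
proof -
  let ?a = "Re (ip f f)" and ?b = "Re (ip f g)" and ?c = "Re (ip g g)"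
  have pos: "0 \<le> ?a" "0 \<le> ?c" using ip_nonneg f g by auto
  have q: "0 \<le> ?a + 2 * t * ?b + t\<^sup>2 * ?c" for t
    using ip_quadratic[OF f g, of t] ip_nonneg[OF add_mem[OF f scale_mem[OF g, of "of_real t"]]]
    by simp
  have cs: "?b\<^sup>2 \<le> ?a * ?c"
  proof (cases "?c = 0")
    case True
    have "?b = 0"
    proof (rule ccontr)
      assume "?b \<noteq> 0"
      then show False using q[of "- (?a + 1) / (2 * ?b)"] True by (simp add: field_simps)
    qed
    then show ?thesis using True by simp
  next
    case False
    then have c: "?c > 0" using pos by simp
    have "0 \<le> ?c * (?a + 2 * (- ?b / ?c) * ?b + (- ?b / ?c)\<^sup>2 * ?c)"
      using q[of "- ?b / ?c"] c by (intro mult_nonneg_nonneg) auto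
    also have "\<dots> = ?a * ?c - ?b\<^sup>2"
      using c by (simp add: field_simps power2_eq_square)
    finally show ?thesis by simp
  qed
  have "?b \<le> sqrt ?a * sqrt ?c"
    using real_le_rsqrt[OF cs] by (simp add: real_sqrt_mult)
  then have "?a + 2 * ?b + ?c \<le> (sqrt ?a + sqrt ?c)\<^sup>2"
    using pos by (simp add: power2_sum)
  then show ?thesis
    unfolding ip_norm_def using ip_quadratic[OF f g, of 1] pos
    by (intro real_le_lsqrt) auto
qed

lemma metric: "Metric_space H (ip_dist H ip)"
proof
  fix f g h
  show "0 \<le> ip_dist H ip f g"
    using ip_nonneg diff_mem by (auto simp: ip_dist_def ip_norm_def)
  show "ip_dist H ip f g = ip_dist H ip g f"
  proof (cases "f \<in> H \<and> g \<in> H")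
    case True
    let ?d = "\<lambda>z. g z - f z"
    have z: "(\<lambda>z. 0) \<in> H" and d: "?d \<in> H" using True diff_mem zero_mem by auto
    have "ip (\<lambda>z. 0) (\<lambda>z. 0) = 0" and "ip (\<lambda>z. 0) ?d = 0"
      using ip_scale[OF z z, of 0] ip_scale[OF z d, of 0] by simp_all
    then show ?thesis
      using ip_quadratic[OF z d, of "-1"] True by (simp add: ip_dist_def ip_norm_def)
  qed (auto simp: ip_dist_def)
  show "ip_dist H ip f g = 0 \<longleftrightarrow> f = g" if fg: "f \<in> H" "g \<in> H"
  proof
    let ?d = "\<lambda>z. f z - g z"
    have d: "?d \<in> H" using fg diff_mem by auto
    assume "ip_dist H ip f g = 0"
    then have "Re (ip ?d ?d) = 0" using fg by (simp add: ip_dist_def ip_norm_def)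
    moreover have "Im (ip ?d ?d) = 0"
      using arg_cong[OF ip_cnj[OF d d], of Im] by simp
    ultimately have "?d = (\<lambda>_. 0)" using ip_definite[OF d] by (simp add: complex_eq_iff)
    then show "f = g" by (metis eq_iff_diff_eq_0 ext)
  next
    assume "f = g"
    moreover have "ip (\<lambda>_. 0) (\<lambda>_. 0) = 0"
      using ip_scale[OF zero_mem zero_mem, of 0] by simp
    ultimately show "ip_dist H ip f g = 0" by (simp add: ip_dist_def ip_norm_def)
  qed
  show "ip_dist H ip f h \<le> ip_dist H ip f g + ip_dist H ip g h"
    if "f \<in> H" "g \<in> H" "h \<in> H"
    using ip_norm_triangle[OF diff_mem[OF that(1,2)] diff_mem[OF that(2,3)]] that
    by (simp add: ip_dist_def)
qed

end

locale analytic_hilbert_space = analytic_inner_product_space +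
  assumes complete: "Metric_space.mcomplete H (ip_dist H ip)"

definition dbr_kernel :: "(complex \<Rightarrow> complex) \<Rightarrow> complex \<Rightarrow> complex \<Rightarrow> complex" where
  "dbr_kernel B w z =
     (if z \<in> unit_disk then (1 - cnj (B w) * B z) / (1 - cnj w * z) else 0)"

text \<open>
  By the Moore-Aronszajn theorem the set \<open>H\<close>, and \<open>ip\<close> on \<open>H\<close>, are uniquely determined by \<open>B\<close>;
  they exist for every analytic self-map \<open>B\<close> of the disk.
\<close>

locale de_branges_rovnyak = analytic_hilbert_space H ip
  for B :: "complex \<Rightarrow> complex"
    and H :: "(complex \<Rightarrow> complex) set"
    and ip :: "(complex \<Rightarrow> complex) \<Rightarrow> (complex \<Rightarrow> complex) \<Rightarrow> complex" +
  assumes kernel_mem: "w \<in> unit_disk \<Longrightarrow> dbr_kernel B w \<in> H"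
    and reproducing: "w \<in> unit_disk \<Longrightarrow> f \<in> H \<Longrightarrow> ip f (dbr_kernel B w) = f w"

text \<open>Compactness of the inclusion of a normed space \<open>(X, n)\<close> in \<open>(H, ip)\<close>, meant for \<open>X \<subseteq> H\<close>.\<close>

definition compact_inclusion :: "(complex \<Rightarrow> complex) set \<Rightarrow> ((complex \<Rightarrow> complex) \<Rightarrow> real) \<Rightarrow>
    (complex \<Rightarrow> complex) set \<Rightarrow>
    ((complex \<Rightarrow> complex) \<Rightarrow> (complex \<Rightarrow> complex) \<Rightarrow> complex) \<Rightarrow> bool" where
  "compact_inclusion X n H ip \<longleftrightarrow>
     compactin (Metric_space.mtopology H (ip_dist H ip))
       (Metric_space.mtopology H (ip_dist H ip) closure_of {f \<in> X. n f \<le> 1})"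

text \<open>\<open>k\<close> is the logarithm of the modulus of the boundary function of \<open>f\<close>.\<close>

definition outer_function :: "(complex \<Rightarrow> complex) \<Rightarrow> bool" where
  "outer_function f \<longleftrightarrow>
     (\<exists>\<alpha> (k :: complex \<Rightarrow> real). cmod \<alpha> = 1 \<and> integrable circle_measure k \<and>
        (\<forall>z\<in>unit_disk.
           f z = \<alpha> * exp (\<integral>\<zeta>. (\<zeta> + z) / (\<zeta> - z) * of_real (k \<zeta>) \<partial>circle_measure)))"

definition hinf_unit_ball :: "(complex \<Rightarrow> complex) set" where
  "hinf_unit_ball = {f. f holomorphic_on unit_disk \<and> (\<forall>z\<in>unit_disk. cmod (f z) \<le> 1)}"

text \<open>
  Negation of the library's \<open>extreme_point_of\<close>, which cannot be used directly because the type
  of functions is not an instance of \<open>real_vector\<close>.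
\<close>

definition hinf_nonextreme :: "(complex \<Rightarrow> complex) \<Rightarrow> bool" where
  "hinf_nonextreme B \<longleftrightarrow>
     B \<in> hinf_unit_ball \<and>
     (\<exists>f\<in>hinf_unit_ball. \<exists>g\<in>hinf_unit_ball. (\<exists>z\<in>unit_disk. f z \<noteq> g z) \<and>
        (\<exists>t::real. 0 < t \<and> t < 1 \<and>
           (\<forall>z\<in>unit_disk. B z = (1 - of_real t) * f z + of_real t * g z)))"

definition has_radial_limit :: "(complex \<Rightarrow> complex) \<Rightarrow> complex \<Rightarrow> complex \<Rightarrow> bool" where
  "has_radial_limit f l \<zeta> \<longleftrightarrow> ((\<lambda>r::real. f (of_real r * \<zeta>)) \<longlongrightarrow> l) (at_left 1)"

definition pythagorean_mate :: "(complex \<Rightarrow> complex) \<Rightarrow> (complex \<Rightarrow> complex) \<Rightarrow> bool" where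
  "pythagorean_mate B a \<longleftrightarrow>
     outer_function a \<and> Im (a 0) = 0 \<and> Re (a 0) > 0 \<and>
     (AE \<zeta> in circle_measure. \<exists>u v. has_radial_limit a u \<zeta> \<and> has_radial_limit B v \<zeta> \<and>
        (cmod u)\<^sup>2 + (cmod v)\<^sup>2 = 1)"

definition phi :: "real \<Rightarrow> complex \<Rightarrow> complex" where
  "phi c z = 1 / (1 - z) powr of_real c"

definition theta :: "complex \<Rightarrow> complex" where
  "theta z = exp (- (1 / 2) * ((1 + z) / (1 - z)))"

end

theory Submission
  imports Defs "HOL-Complex_Analysis.Complex_Analysis"
begin

text \<open>
  Put \<open>\<Phi> = theta * phi c\<close> and \<open>B = theta * b\<close>, so that \<open>B = \<Phi> * a\<close>. An analytic function \<open>f\<close> belongs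
  to the de Branges-Rovnyak space of \<open>B\<close> exactly if it lies in the domain of the adjoint \<open>T\<close> of
  multiplication by \<open>\<Phi>\<close> on the Hardy space, and then its squared norm is \<open>\<parallel>f\<parallel>\<^sup>2 + \<parallel>T f\<parallel>\<^sup>2\<close>. The
  question is therefore whether \<open>T\<close> maps the Dirichlet space into the Hardy space, and whether
  it does so compactly. Dually, this asks whether \<open>|\<Phi>|\<^sup>2\<close> times area measure is a (vanishing)
  Carleson measure. The only delicate point is \<open>1\<close>, where \<open>phi c\<close> blows up while \<open>theta\<close> is of size
  one only outside a horodisk; at distance \<open>t\<close> from \<open>1\<close> that region has thickness about \<open>t\<^sup>2\<close>. This
  makes \<open>c = 1\<close> the threshold.

  The link between \<open>T\<close> and an abstract space with the given kernel is a criterion for membership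
  (lemma \<open>represented\<close>): \<open>f\<close> is in the space if prescribing the values of \<open>f\<close> at the kernels defines
  a bounded functional on their span. The boundary identity for \<open>a\<close> and \<open>B\<close> turns the kernel at \<open>w\<close>
  into the pair \<open>(K, cnj (B w) * a * k)\<close> of Hardy functions, with \<open>K\<close> the kernel itself and \<open>k\<close> the
  Szego kernel, and this map is isometric. Hence every pair of Hardy functions represents an
  element of the space (\<open>pair_represents\<close>). Polynomials \<open>p\<close> are represented by \<open>(p, T p)\<close>, and
  functionals \<open>\<langle>f, B h\<rangle>\<close> by \<open>(0, a h)\<close>.

  Upper bounds. On polynomials of bounded degree \<open>T\<close> is multiplication of reversed coefficient
  sequences by the power series \<open>\<Phi>\<close>. For \<open>c = 1\<close> the bound \<open>\<parallel>T p\<parallel> \<le> \<parallel>p\<parallel>\<close> with the Dirichlet norm on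
  the right comes from the semigroup \<open>exp (- (x / 2) * (1 + z) / (1 - z))\<close>, which equals \<open>theta\<close>
  at \<open>x = 1\<close>: along it the squared Dirichlet norm decreases, at a rate that is itself decreasing
  and equals \<open>\<parallel>T p\<parallel>\<^sup>2\<close> at \<open>x = 1\<close> (\<open>tnorm_sq_derivative\<close>, \<open>singular_fps_bound\<close>). For \<open>c < 1\<close> the extra
  factor \<open>(1 - z) powr (1 - c)\<close> has absolutely summable coefficients with sum zero, which
  improves the bound to \<open>C \<parallel>p\<parallel> + e \<parallel>p\<parallel>\<close> with the Hardy norm first, the Dirichlet norm second,
  and \<open>e\<close> as small as desired (\<open>interpolation\<close>); compactness follows.

  Lower bounds. Szego kernels are eigenvectors of \<open>T\<close> with eigenvalue \<open>cnj (\<Phi> w)\<close>. On the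
  horocycle \<open>1 - |w|\<^sup>2 = |1 - w|\<^sup>2\<close> the modulus of \<open>theta\<close> is constant, and kernels normalised in
  the Dirichlet space have norm at least a constant times \<open>(1 - |w|\<^sup>2) powr ((1 - c) / 2)\<close> in
  the space (\<open>lower_functional\<close>). This estimate needs \<open>a\<close> to be outer. For \<open>c = 1\<close> it exhibits a
  bounded sequence that tends to zero pointwise but not in norm; for \<open>c > 1\<close> a gliding hump
  along the horocycle gives a function of the Dirichlet space outside the space.
\<close>

section \<open>Reproducing kernel spaces\<close>

context analytic_inner_product_space
begin

lemma ip_add_right:
  assumes "f \<in> H" "g \<in> H" "h \<in> H"
  shows "ip h (\<lambda>z. f z + g z) = ip h f + ip h g"
  using ip_cnj[OF add_mem[OF assms(1,2)] assms(3)] ip_add[OF assms] ip_cnj[OF assms(1,3)] ip_cnj[OF assms(2,3)]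
  by simp

lemma ip_scale_right:
  assumes "f \<in> H" "h \<in> H"
  shows "ip h (\<lambda>z. \<alpha> * f z) = cnj \<alpha> * ip h f"
  using ip_cnj[OF scale_mem[OF assms(1)] assms(2), of \<alpha>] ip_scale[OF assms] ip_cnj[OF assms]
  by simp

lemma ip_diff_left:
  assumes "f \<in> H" "g \<in> H" "h \<in> H"
  shows "ip (\<lambda>z. f z - g z) h = ip f h - ip g h"
  using ip_add[OF assms(1) scale_mem[OF assms(2), of "-1"] assms(3)] ip_scale[OF assms(2,3), of "-1"]
  by simp

lemma ip_zero_left: "h \<in> H \<Longrightarrow> ip (\<lambda>_. 0) h = 0"
  using ip_scale[OF zero_mem, of h 0] by simp

lemma ip_zero_right: "h \<in> H \<Longrightarrow> ip h (\<lambda>_. 0) = 0"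
  using ip_scale_right[OF zero_mem, of h 0] by simp

lemma ip_self: "f \<in> H \<Longrightarrow> ip f f = of_real ((ip_norm ip f)\<^sup>2)"
  using ip_nonneg[of f] arg_cong[OF ip_cnj[of f f], of Im]
  by (simp add: ip_norm_def complex_eq_iff)

lemma ip_norm_nonneg: "f \<in> H \<Longrightarrow> 0 \<le> ip_norm ip f"
  by (simp add: ip_norm_def ip_nonneg)

lemma ip_norm_sq: "f \<in> H \<Longrightarrow> (ip_norm ip f)\<^sup>2 = Re (ip f f)"
  by (simp add: ip_norm_def ip_nonneg)

lemma ip_norm_scale: "f \<in> H \<Longrightarrow> ip_norm ip (\<lambda>z. \<alpha> * f z) = cmod \<alpha> * ip_norm ip f"
proof -
  assume f: "f \<in> H"
  have "ip (\<lambda>z. \<alpha> * f z) (\<lambda>z. \<alpha> * f z) = (\<alpha> * cnj \<alpha>) * ip f f"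
    by (simp add: ip_scale ip_scale_right f scale_mem)
  also have "\<alpha> * cnj \<alpha> = of_real ((cmod \<alpha>)\<^sup>2)" by (simp add: complex_norm_square[symmetric])
  finally show ?thesis
    by (simp add: ip_norm_def real_sqrt_mult)
qed

lemma Cauchy_Schwarz:
  assumes f: "f \<in> H" and g: "g \<in> H"
  shows "cmod (ip f g) \<le> ip_norm ip f * ip_norm ip g"
proof -
  have re: "Re (ip u v) \<le> ip_norm ip u * ip_norm ip v" if u: "u \<in> H" and v: "v \<in> H" for u v
  proof -
    have "(ip_norm ip (\<lambda>z. u z + v z))\<^sup>2 \<le> (ip_norm ip u + ip_norm ip v)\<^sup>2"
      using ip_norm_triangle[OF u v] ip_norm_nonneg[OF add_mem[OF u v]] by (intro power_mono) auto
    moreover have "(ip_norm ip (\<lambda>z. u z + v z))\<^sup>2 = (ip_norm ip u)\<^sup>2 + 2 * Re (ip u v) + (ip_norm ip v)\<^sup>2"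
      using ip_quadratic[OF u v, of 1] u v by (simp add: ip_norm_sq add_mem)
    ultimately show ?thesis by (simp add: power2_sum)
  qed
  show ?thesis
  proof (cases "ip f g = 0")
    case True
    then show ?thesis by (simp add: ip_norm_nonneg f g)
  next
    case False
    define s where "s = cnj (ip f g) / cmod (ip f g)"
    have s: "cmod s = 1" using False by (simp add: s_def norm_divide)
    have "s * ip f g = of_real (cmod (ip f g))"
      using False complex_norm_square[of "ip f g"]
      by (simp add: s_def field_simps power2_eq_square)
    then have "cmod (ip f g) = Re (ip (\<lambda>z. s * f z) g)" by (simp add: ip_scale f g)
    also have "\<dots> \<le> ip_norm ip (\<lambda>z. s * f z) * ip_norm ip g" by (rule re[OF scale_mem[OF f] g])
    finally show ?thesis by (simp add: ip_norm_scale[OF f] s)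
  qed
qed

lemma parallelogram:
  assumes f: "f \<in> H" and g: "g \<in> H"
  shows "(ip_norm ip (\<lambda>z. f z - g z))\<^sup>2 + (ip_norm ip (\<lambda>z. f z + g z))\<^sup>2 =
     2 * (ip_norm ip f)\<^sup>2 + 2 * (ip_norm ip g)\<^sup>2"
  using ip_quadratic[OF f g, of 1] ip_quadratic[OF f g, of "-1"] f g
  by (simp add: ip_norm_sq add_mem diff_mem)

lemma MCauchyI:
  assumes "\<And>n. F n \<in> H"
    and "\<And>e. e > 0 \<Longrightarrow> \<exists>N. \<forall>m\<ge>N. \<forall>n\<ge>N. ip_norm ip (\<lambda>z. F m z - F n z) < e"
  shows "Metric_space.MCauchy H (ip_dist H ip) F"
  unfolding Metric_space.MCauchy_def[OF metric]
  using assms by (auto simp: ip_dist_def)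

lemma limitin_iff:
  assumes "\<And>n. F n \<in> H"
  shows "limitin (Metric_space.mtopology H (ip_dist H ip)) F f sequentially \<longleftrightarrow>
     f \<in> H \<and> (\<lambda>n. ip_norm ip (\<lambda>z. F n z - f z)) \<longlonglongrightarrow> 0"
proof -
  interpret M: Metric_space H "ip_dist H ip" by (rule metric)
  have "0 \<le> ip_norm ip (\<lambda>z. F n z - f z)" if "f \<in> H" for n
    by (rule ip_norm_nonneg[OF diff_mem[OF assms that]])
  then show ?thesis
    unfolding M.limitin_metric using assms
    by (auto simp: ip_dist_def tendsto_iff)
qed

end

context analytic_hilbert_space
begin

lemma Cauchy_limit:
  assumes F: "\<And>n. F n \<in> H"
    and "\<And>e. e > 0 \<Longrightarrow> \<exists>N. \<forall>m\<ge>N. \<forall>n\<ge>N. ip_norm ip (\<lambda>z. F m z - F n z) < e"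
  obtains f where "f \<in> H" "(\<lambda>n. ip_norm ip (\<lambda>z. F n z - f z)) \<longlonglongrightarrow> 0"
proof -
  have "Metric_space.MCauchy H (ip_dist H ip) F" by (rule MCauchyI) (use assms in auto)
  then obtain f where "limitin (Metric_space.mtopology H (ip_dist H ip)) F f sequentially"
    using complete Metric_space.mcomplete_def[OF metric] by auto
  then show ?thesis using that unfolding limitin_iff[OF F] by auto
qed

end

context de_branges_rovnyak
begin

text \<open>
  Finite combinations of kernels are given by lists of coefficients and nodes, so that
  addition is concatenation and no two lists have to be brought to a common set of nodes.
\<close>

definition kernel_comb :: "(complex \<times> complex) list \<Rightarrow> complex \<Rightarrow> complex" where
  "kernel_comb xs z = (\<Sum>(c, w)\<leftarrow>xs. c * dbr_kernel B w z)"

abbreviation nodes :: "(complex \<times> complex) list \<Rightarrow> bool" where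
  "nodes xs \<equiv> snd ` set xs \<subseteq> unit_disk"

lemma kernel_comb_Nil: "kernel_comb [] = (\<lambda>_. 0)"
  by (simp add: kernel_comb_def fun_eq_iff)

lemma kernel_comb_Cons: "kernel_comb ((c, w) # xs) = (\<lambda>z. c * dbr_kernel B w z + kernel_comb xs z)"
  by (simp add: kernel_comb_def fun_eq_iff)

lemma kernel_comb_append: "kernel_comb (xs @ ys) = (\<lambda>z. kernel_comb xs z + kernel_comb ys z)"
  by (simp add: kernel_comb_def fun_eq_iff)

lemma kernel_comb_scale: "kernel_comb (map (\<lambda>(c, w). (\<alpha> * c, w)) xs) = (\<lambda>z. \<alpha> * kernel_comb xs z)"
  by (induction xs) (auto simp: kernel_comb_Nil kernel_comb_Cons fun_eq_iff algebra_simps)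

lemma kernel_comb_mem: "nodes xs \<Longrightarrow> kernel_comb xs \<in> H"
  by (induction xs)
    (auto simp: kernel_comb_Nil kernel_comb_Cons zero_mem intro!: add_mem scale_mem kernel_mem)

lemma ip_kernel_comb_right:
  "nodes xs \<Longrightarrow> f \<in> H \<Longrightarrow> ip f (kernel_comb xs) = (\<Sum>(c, w)\<leftarrow>xs. cnj c * f w)"
proof (induction xs)
  case (Cons x xs)
  obtain c w where x: "x = (c, w)" by force
  have w: "w \<in> unit_disk" and n: "nodes xs" using Cons.prems x by auto
  show ?case
    unfolding x kernel_comb_Cons
    using Cons.IH[OF n Cons.prems(2)]
    by (simp add: ip_add_right scale_mem kernel_mem[OF w] kernel_comb_mem[OF n] Cons.prems
        ip_scale_right reproducing[OF w])
qed (simp add: kernel_comb_Nil ip_zero_right)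

lemma kernel_diag: "w \<in> unit_disk \<Longrightarrow> (ip_norm ip (dbr_kernel B w))\<^sup>2 = Re (dbr_kernel B w w)"
  by (simp add: ip_norm_sq kernel_mem reproducing)

lemma eval_bound:
  "w \<in> unit_disk \<Longrightarrow> f \<in> H \<Longrightarrow> cmod (f w) \<le> ip_norm ip f * ip_norm ip (dbr_kernel B w)"
  using Cauchy_Schwarz[of f "dbr_kernel B w"] by (simp add: kernel_mem reproducing)

text \<open>
  Evaluations are bounded functionals, so norm limits are pointwise limits.
\<close>

lemma norm_limit_pointwise:
  assumes "\<And>n. F n \<in> H" "f \<in> H" "(\<lambda>n. ip_norm ip (\<lambda>z. F n z - f z)) \<longlonglongrightarrow> 0"
    and w: "w \<in> unit_disk"
  shows "(\<lambda>n. F n w) \<longlonglongrightarrow> f w"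
proof -
  have lim: "(\<lambda>n. ip_norm ip (\<lambda>z. F n z - f z) * ip_norm ip (dbr_kernel B w)) \<longlonglongrightarrow> 0"
    using tendsto_mult_right[OF assms(3), of "ip_norm ip (dbr_kernel B w)"] by simp
  have "\<forall>\<^sub>F n in sequentially.
      cmod (F n w - f w) \<le> ip_norm ip (\<lambda>z. F n z - f z) * ip_norm ip (dbr_kernel B w)"
    using eval_bound[OF w diff_mem[OF assms(1) assms(2)]] by simp
  then have "(\<lambda>n. F n w - f w) \<longlonglongrightarrow> 0"
    by (rule Lim_null_comparison[OF _ lim])
  then show ?thesis by (simp add: LIM_zero_iff)
qed

text \<open>
  This is the Riesz representation theorem for the functional \<open>kernel_comb xs \<mapsto> \<Sum> c * cnj (f w)\<close>
  on the span of the kernels, proved by minimising \<open>\<parallel>g\<parallel>\<^sup>2 - 2 Re l(g)\<close>. Working with lists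
  avoids having to show that the functional is well defined. Applied to an element of the
  space it also says that the kernels span a dense subspace.
\<close>

lemma represented:
  assumes f0: "\<And>z. z \<notin> unit_disk \<Longrightarrow> f z = 0" and M: "0 \<le> M"
    and bd: "\<And>xs. nodes xs \<Longrightarrow>
      cmod (\<Sum>(c, w)\<leftarrow>xs. cnj c * f w) \<le> M * ip_norm ip (kernel_comb xs)"
  shows "f \<in> H"
    and "\<exists>xs. (\<forall>n::nat. nodes (xs n)) \<and> (\<lambda>n. ip_norm ip (\<lambda>z. kernel_comb (xs n) z - f z)) \<longlonglongrightarrow> 0"
    and "ip_norm ip f \<le> M"
proof -
  define l where "l xs = (\<Sum>(c, w)\<leftarrow>xs. cnj c * f w)" for xs
  define Q where "Q xs = (ip_norm ip (kernel_comb xs))\<^sup>2 - 2 * Re (l xs)" for xs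
  define I where "I = (INF xs\<in>{xs. nodes xs}. Q xs)"
  have l_append: "l (xs @ ys) = l xs + l ys" for xs ys by (simp add: l_def)
  have l_scale: "l (map (\<lambda>(c, w). (\<alpha> * c, w)) xs) = cnj \<alpha> * l xs" for \<alpha> xs
    by (induction xs) (auto simp: l_def algebra_simps)
  have nodes_scale: "nodes (map (\<lambda>(c, w). (\<alpha> * c, w)) xs)" if "nodes xs" for \<alpha> xs
    using that by (auto simp: image_subset_iff split_beta)
  have Qge: "- (M\<^sup>2) \<le> Q xs" if "nodes xs" for xs
  proof -
    have "Re (l xs) \<le> M * ip_norm ip (kernel_comb xs)"
      using bd[OF that] complex_Re_le_cmod[of "l xs"] by (simp add: l_def)
    moreover have "0 \<le> (ip_norm ip (kernel_comb xs) - M)\<^sup>2" by simp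
    ultimately show ?thesis unfolding Q_def power2_diff by (simp add: algebra_simps)
  qed
  have bdd: "bdd_below (Q ` {xs. nodes xs})" using Qge by (intro bdd_belowI) auto
  have I_le: "I \<le> Q xs" if "nodes xs" for xs
    unfolding I_def by (rule cINF_lower[OF bdd]) (use that in auto)
  have ne: "{xs. nodes xs} \<noteq> {}" by (auto intro!: exI[of _ "[]"])
  have "\<exists>xs. nodes xs \<and> Q xs < I + 1 / real (Suc n)" for n
  proof -
    have "I < I + 1 / real (Suc n)" by simp
    then show ?thesis
      unfolding I_def by (subst (asm) cINF_less_iff[OF ne bdd]) auto
  qed
  then have "\<exists>xs. \<forall>n. nodes (xs n) \<and> Q (xs n) < I + 1 / real (Suc n)"
    by (intro choice) blast
  then obtain xs where xs: "\<And>n. nodes (xs n)" and Qxs: "\<And>n. Q (xs n) < I + 1 / real (Suc n)"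
    by blast
  define G where "G n = kernel_comb (xs n)" for n
  have G: "G n \<in> H" for n by (simp add: G_def kernel_comb_mem xs)
  \<comment> \<open>The parallelogram law turns a minimising sequence of the quadratic functional into a Cauchy
    sequence.\<close>
  have cau: "(ip_norm ip (\<lambda>z. G m z - G n z))\<^sup>2 \<le> 2 / real (Suc m) + 2 / real (Suc n)" for m n
  proof -
    define ys where "ys = map (\<lambda>(c, w). ((1/2) * c, w)) (xs m @ xs n)"
    have ys: "nodes ys" unfolding ys_def by (rule nodes_scale) (use xs in auto)
    have ky: "kernel_comb ys = (\<lambda>z. (1/2) * (G m z + G n z))"
      unfolding ys_def kernel_comb_scale kernel_comb_append G_def ..
    have ny: "ip_norm ip (kernel_comb ys) = (1/2) * ip_norm ip (\<lambda>z. G m z + G n z)"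
      unfolding ky using ip_norm_scale[OF add_mem[OF G[of m] G[of n]], of "1/2"] by simp
    have ly: "l ys = (1/2) * (l (xs m) + l (xs n))"
      unfolding ys_def l_scale l_append by simp
    have "4 * I \<le> 4 * Q ys" using I_le[OF ys] by simp
    also have "\<dots> = (ip_norm ip (\<lambda>z. G m z + G n z))\<^sup>2 - 4 * (Re (l (xs m)) + Re (l (xs n)))"
      unfolding Q_def ny ly by (simp add: power2_eq_square field_simps)
    also have "\<dots> = 2 * Q (xs m) + 2 * Q (xs n) - (ip_norm ip (\<lambda>z. G m z - G n z))\<^sup>2"
      using parallelogram[OF G[of m] G[of n]] unfolding Q_def G_def[symmetric] by argo
    finally show ?thesis using Qxs[of m] Qxs[of n] by simp
  qed
  obtain g where g: "g \<in> H" and lim: "(\<lambda>n. ip_norm ip (\<lambda>z. G n z - g z)) \<longlonglongrightarrow> 0"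
  proof (rule Cauchy_limit[of G, OF G])
    fix e :: real assume e: "e > 0"
    obtain N where N: "4 / e\<^sup>2 < real N" using reals_Archimedean2 by blast
    have Npos: "0 < real N" using N e by (intro le_less_trans[OF _ N]) simp
    have "ip_norm ip (\<lambda>z. G m z - G n z) < e" if "m \<ge> N" "n \<ge> N" for m n
    proof -
      have "(ip_norm ip (\<lambda>z. G m z - G n z))\<^sup>2 \<le> 2 / real (Suc m) + 2 / real (Suc n)" by (rule cau)
      also have "\<dots> \<le> 2 / real N + 2 / real N"
        using that Npos by (intro add_mono divide_left_mono) auto
      also have "\<dots> < e\<^sup>2" using N e Npos by (simp add: field_simps)
      finally show ?thesis by (rule power2_less_imp_less) (use e in simp)
    qed
    then show "\<exists>N. \<forall>m\<ge>N. \<forall>n\<ge>N. ip_norm ip (\<lambda>z. G m z - G n z) < e" by blast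
  qed
  \<comment> \<open>First variation in the direction of a kernel: the limit has the prescribed values.\<close>
  have vals: "g w = f w" if w: "w \<in> unit_disk" for w
  proof -
    define k where "k = dbr_kernel B w"
    define K where "K = (ip_norm ip k)\<^sup>2 + 1"
    have kH: "k \<in> H" unfolding k_def by (rule kernel_mem[OF w])
    have K: "K > 0" by (simp add: K_def add_nonneg_pos)
    have tdirichlet_sq: "(cmod (G n w - f w))\<^sup>2 \<le> K / real (Suc n)" for n
    proof -
      define d where "d = G n w - f w"
      define t where "t = - d / of_real K"
      have ct: "cmod t = cmod d / K" using K by (simp add: t_def norm_divide)
      have tk: "(\<lambda>z. t * k z) \<in> H" by (rule scale_mem[OF kH])
      have nd: "nodes ((t, w) # xs n)" using xs[of n] w by auto
      have "ip_norm ip (kernel_comb ((t, w) # xs n)) = ip_norm ip (\<lambda>z. G n z + of_real 1 * (t * k z))"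
        unfolding kernel_comb_Cons G_def k_def by (simp add: add.commute)
      then have "(ip_norm ip (kernel_comb ((t, w) # xs n)))\<^sup>2
        = (ip_norm ip (G n))\<^sup>2 + 2 * Re (ip (G n) (\<lambda>z. t * k z)) + (ip_norm ip (\<lambda>z. t * k z))\<^sup>2"
        using ip_quadratic[OF G[of n] tk, of 1] ip_norm_sq[OF add_mem[OF G[of n] tk]]
        by (simp add: ip_norm_sq tk G)
      also have "ip (G n) (\<lambda>z. t * k z) = cnj t * G n w"
        using reproducing[OF w G[of n]] by (simp add: ip_scale_right kH G k_def[symmetric])
      finally have "Q ((t, w) # xs n) = Q (xs n) + 2 * Re (cnj t * d) + (cmod t)\<^sup>2 * (ip_norm ip k)\<^sup>2"
        unfolding Q_def by (simp add: l_def G_def d_def ip_norm_scale kH power_mult_distrib algebra_simps)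
      then have "Q ((t, w) # xs n) \<le> Q (xs n) + 2 * Re (cnj t * d) + (cmod t)\<^sup>2 * K"
        unfolding K_def by (simp add: algebra_simps)
      also have "cnj t * d = - of_real ((cmod d)\<^sup>2 / K)"
        using complex_norm_square[of d] by (simp add: t_def mult.commute)
      also have "(cmod t)\<^sup>2 * K = (cmod d)\<^sup>2 / K"
        using K ct by (simp add: power2_eq_square)
      finally have "I \<le> Q (xs n) - (cmod d)\<^sup>2 / K" using I_le[OF nd] by simp
      then have "(cmod d)\<^sup>2 / K \<le> 1 / real (Suc n)" using Qxs[of n] by simp
      then show ?thesis using K by (simp add: d_def field_simps)
    qed
    have "(\<lambda>n. (cmod (G n w - f w))\<^sup>2) \<longlonglongrightarrow> 0"
    proof (rule Lim_null_comparison)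
      show "\<forall>\<^sub>F n in sequentially. norm ((cmod (G n w - f w))\<^sup>2) \<le> K * (1 / real (Suc n))"
        using tdirichlet_sq by simp
      show "(\<lambda>n. K * (1 / real (Suc n))) \<longlonglongrightarrow> 0"
        using tendsto_mult_right_zero[OF LIMSEQ_Suc[OF lim_1_over_n]] by simp
    qed
    then have "(\<lambda>n. G n w) \<longlonglongrightarrow> f w"
      by (simp add: LIM_zero_iff tendsto_norm_zero_iff)
    then show ?thesis
      using norm_limit_pointwise[OF G g lim w] LIMSEQ_unique by blast
  qed
  have "g z = 0" if "z \<notin> unit_disk" for z
    using analytic g that by (auto simp: disk_analytic_def)
  then have fg: "f = g" using vals f0 by (intro ext) metis
  show fH: "f \<in> H" by (simp add: fg g)
  show "\<exists>xs. (\<forall>n::nat. nodes (xs n)) \<and> (\<lambda>n. ip_norm ip (\<lambda>z. kernel_comb (xs n) z - f z)) \<longlonglongrightarrow> 0"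
    using xs lim unfolding fg G_def by (intro exI[of _ xs]) simp
  have ipG: "cmod (ip f (G n)) \<le> M * ip_norm ip (G n)" for n
    using bd[OF xs[of n]] ip_kernel_comb_right[OF xs[of n] fH] by (simp add: G_def)
  have nG: "(\<lambda>n. ip_norm ip (G n)) \<longlonglongrightarrow> ip_norm ip f"
  proof (rule Lim_transform2[OF tendsto_const])
    have "\<bar>ip_norm ip f - ip_norm ip (G n)\<bar> \<le> ip_norm ip (\<lambda>z. G n z - g z)" for n
    proof -
      have "ip_norm ip (G n) \<le> ip_norm ip (\<lambda>z. G n z - g z) + ip_norm ip g"
        using ip_norm_triangle[OF diff_mem[OF G g] g, of n] by simp
      moreover have "ip_norm ip g \<le> ip_norm ip (\<lambda>z. (-1) * (G n z - g z)) + ip_norm ip (G n)"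
        using ip_norm_triangle[OF scale_mem[OF diff_mem[OF G[of n] g], of "-1"] G[of n]] by simp
      ultimately show ?thesis
        using ip_norm_scale[OF diff_mem[OF G[of n] g], of "-1"] fg by simp
    qed
    then have "\<forall>\<^sub>F n in sequentially.
        norm (ip_norm ip f - ip_norm ip (G n)) \<le> ip_norm ip (\<lambda>z. G n z - g z)" by simp
    then show "(\<lambda>n. ip_norm ip f - ip_norm ip (G n)) \<longlonglongrightarrow> 0"
      by (rule Lim_null_comparison[OF _ lim])
  qed
  have ipl: "(\<lambda>n. ip f (G n)) \<longlonglongrightarrow> ip f f"
  proof -
    have "cmod (ip f (G n) - ip f f) \<le> ip_norm ip f * ip_norm ip (\<lambda>z. G n z - g z)" for n
    proof -
      have "ip f (G n) - ip f f = ip f (\<lambda>z. G n z + (-1) * g z)"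
        by (subst ip_add_right[OF G scale_mem[OF g] fH], subst ip_scale_right[OF g fH]) (simp add: fg)
      then show ?thesis using Cauchy_Schwarz[OF fH diff_mem[OF G[of n] g]] by simp
    qed
    then have "\<forall>\<^sub>F n in sequentially.
        cmod (ip f (G n) - ip f f) \<le> ip_norm ip f * ip_norm ip (\<lambda>z. G n z - g z)"
      by simp
    then have "(\<lambda>n. ip f (G n) - ip f f) \<longlonglongrightarrow> 0"
      by (rule Lim_null_comparison[OF _ tendsto_mult_right_zero[OF lim, of "ip_norm ip f"]])
    then show ?thesis by (simp add: LIM_zero_iff)
  qed
  have "cmod (ip f f) \<le> M * ip_norm ip f"
    using ipG by (intro LIMSEQ_le[OF tendsto_norm[OF ipl] tendsto_mult_left[OF nG, of M]]) auto
  moreover have "cmod (ip f f) = (ip_norm ip f)\<^sup>2"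
    unfolding ip_self[OF fH] norm_of_real by simp
  ultimately have "(ip_norm ip f)\<^sup>2 \<le> M * ip_norm ip f" by simp
  then have le: "ip_norm ip f * ip_norm ip f \<le> M * ip_norm ip f"
    unfolding power2_eq_square .
  show "ip_norm ip f \<le> M"
  proof (cases "ip_norm ip f = 0")
    case False
    then have "0 < ip_norm ip f" using ip_norm_nonneg[OF fH] by linarith
    then show ?thesis by (rule mult_right_le_imp_le[OF le])
  qed (use M in simp)
qed

end

section \<open>Coefficient estimates for the singular inner semigroup\<close>

text \<open>
  A polynomial \<open>p\<close> of degree at most \<open>N\<close> is encoded by its reversed coefficients, \<open>q $ (N - n)\<close>
  being the coefficient of \<open>z ^ n\<close> in \<open>p\<close>. The backward shift then becomes multiplication by
  \<open>fps_X\<close>, and every co-analytic Toeplitz operator becomes multiplication by a power series. The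
  Hardy norm of \<open>p\<close> only sees the first \<open>N + 1\<close> coefficients of \<open>q\<close>.
\<close>

definition tnorm_sq :: "nat \<Rightarrow> complex fps \<Rightarrow> real" where
  "tnorm_sq N q = (\<Sum>i\<le>N. (cmod (fps_nth q i))\<^sup>2)"

text \<open>
  The squared Dirichlet norm \<open>\<Sum> (n + 1) |p_n|\<^sup>2\<close> of the polynomial encoded by \<open>q\<close>, arranged by
  summation by parts so that statements about \<open>tnorm_sq\<close> carry over; \<open>tdirichlet_sq_altdef\<close> gives
  the weighted form.
\<close>

definition tdirichlet_sq :: "nat \<Rightarrow> complex fps \<Rightarrow> real" where
  "tdirichlet_sq N q = (\<Sum>M\<le>N. tnorm_sq M q)"

lemma tnorm_sq_nonneg: "0 \<le> tnorm_sq N q"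
  by (simp add: tnorm_sq_def sum_nonneg)

lemma tdirichlet_sq_altdef: "tdirichlet_sq N q = (\<Sum>i\<le>N. real (Suc N - i) * (cmod (fps_nth q i))\<^sup>2)"
proof (induction N)
  case (Suc N)
  have "tdirichlet_sq (Suc N) q = tdirichlet_sq N q + tnorm_sq (Suc N) q" by (simp add: tdirichlet_sq_def)
  also have "\<dots> = (\<Sum>i\<le>Suc N. real (Suc N - i) * (cmod (fps_nth q i))\<^sup>2) + (\<Sum>i\<le>Suc N. (cmod (fps_nth q i))\<^sup>2)"
    by (simp add: Suc tnorm_sq_def)
  also have "\<dots> = (\<Sum>i\<le>Suc N. real (Suc (Suc N) - i) * (cmod (fps_nth q i))\<^sup>2)"
    unfolding sum.distrib[symmetric] by (intro sum.cong) (auto simp: of_nat_diff algebra_simps)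
  finally show ?case .
qed (simp add: tdirichlet_sq_def tnorm_sq_def)

abbreviation geo :: "complex fps" where
  "geo \<equiv> Abs_fps (\<lambda>n. if n = 0 then 0 else 1)"

lemma geo_eq: "(1 - fps_X) * geo = fps_X"
  by (rule fps_ext) (simp add: fps_X_nth algebra_simps)

text \<open>
  The power series of \<open>exp (- (x / 2) * (1 + z) / (1 - z))\<close>: the exponent is
  \<open>- x / 2 - x * z / (1 - z)\<close>, and \<open>geo\<close> is the series of \<open>z / (1 - z)\<close>.
\<close>

definition singular_fps :: "real \<Rightarrow> complex fps" where
  "singular_fps x = fps_const (exp (- of_real x / 2)) * (fps_exp (- of_real x) oo geo)"

lemma singular_fps_0: "singular_fps 0 = 1"
  by (simp add: singular_fps_def)

text \<open>
  The exponent is linear in \<open>x\<close> with slope \<open>- (1 / 2 + z / (1 - z))\<close>. Each coefficient is a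
  polynomial in \<open>x\<close> times an exponential, so it can be differentiated termwise.
\<close>

lemma singular_fps_has_vector_derivative:
  "((\<lambda>x. fps_nth (singular_fps x) n) has_vector_derivative
     fps_nth (- ((fps_const (1/2) + geo) * singular_fps x)) n) (at x)"
proof -
  define c where "c i = fps_nth (geo ^ i) n" for i
  define E where "E x = (\<Sum>i=0..n. (- of_real x) ^ i / fact i * c i)" for x :: real
  define E' where "E' x = (\<Sum>i=0..n. fps_nth (fps_exp (- of_real x) * fps_X) i * c i)" for x :: real
  have nth: "fps_nth (singular_fps x) n = exp (- of_real x / 2) * E x" for x
    by (simp add: singular_fps_def fps_compose_nth E_def c_def)
  have comp: "fps_nth (geo * singular_fps x) n = exp (- of_real x / 2) * E' x" for x
  proof -
    have "geo * singular_fps x = fps_const (exp (- of_real x / 2)) * ((fps_exp (- of_real x) oo geo) * (fps_X oo geo))"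
      by (simp add: singular_fps_def mult_ac)
    also have "(fps_exp (- of_real x) oo geo) * (fps_X oo geo) = (fps_exp (- of_real x) * fps_X) oo geo"
      by (rule fps_compose_mult_distrib[symmetric]) simp
    finally show ?thesis by (simp add: fps_compose_nth E'_def c_def)
  qed
  have mono: "((\<lambda>x. (- of_real x) ^ i / fact i * c i) has_vector_derivative
      - (fps_nth (fps_exp (- of_real x) * fps_X) i * c i)) (at x)" for i
  proof (cases i)
    case (Suc j)
    have "((\<lambda>z. (- z) ^ i / fact i * c i) has_field_derivative
      of_nat i * (- of_real x) ^ (i - 1) * (-1) / fact i * c i) (at (of_real x))"
      by (auto intro!: derivative_eq_intros)
    moreover have "of_nat i * (- of_real x) ^ (i - 1) * (-1) / fact i * c i =
       - (fps_nth (fps_exp (- of_real x) * fps_X) i * c i)"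
      unfolding Suc fact_Suc by (simp add: field_simps del: of_nat_Suc)
    ultimately show ?thesis
      using has_vector_derivative_real_field by fastforce
  qed simp
  have dE: "(E has_vector_derivative - E' x) (at x)"
    unfolding E_def E'_def sum_negf[symmetric] by (intro has_vector_derivative_sum mono)
  have "((\<lambda>z. exp (- z / 2)) has_field_derivative - (1/2) * exp (- of_real x / 2)) (at (of_real x :: complex))"
    by (auto intro!: derivative_eq_intros)
  then have de: "((\<lambda>x. exp (- of_real x / 2 :: complex)) has_vector_derivative
      - (1/2) * exp (- of_real x / 2)) (at x)"
    by (rule has_vector_derivative_real_field)
  have "((\<lambda>x. exp (- of_real x / 2) * E x) has_vector_derivative
      exp (- of_real x / 2) * (- E' x) + (- (1/2) * exp (- of_real x / 2)) * E x) (at x)"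
    by (rule has_vector_derivative_mult[OF de dE])
  moreover have "exp (- of_real x / 2) * (- E' x) + (- (1/2) * exp (- of_real x / 2)) * E x
      = fps_nth (- ((fps_const (1/2) + geo) * singular_fps x)) n"
    unfolding distrib_right fps_neg_nth fps_add_nth comp by (simp add: nth)
  ultimately show ?thesis unfolding nth by simp
qed

text \<open>
  The generator \<open>- (1 / 2) * (1 + z) / (1 - z)\<close> is dissipative with a defect of rank one. If the
  sequence at time \<open>x\<close> is \<open>(1 - X) Z\<close>, its derivative is \<open>- (1 / 2) (1 + X) Z\<close>, and
  \<open>Re (cnj (u - v) * (u + v)) = |u|\<^sup>2 - |v|\<^sup>2\<close> makes the sum of the derivatives telescope.
\<close>

lemma tnorm_sq_derivative:
  "((\<lambda>x. tnorm_sq N (singular_fps x * ((1 - fps_X) * P))) has_real_derivative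
     - (cmod (fps_nth (singular_fps x * P) N))\<^sup>2) (at x)"
proof -
  define Z where "Z = singular_fps x * P"
  define q where "q = (1 - fps_X) * P"
  have dq: "((\<lambda>x. fps_nth (singular_fps x * q) i) has_vector_derivative
      fps_nth (- ((fps_const (1/2) + geo) * singular_fps x * q)) i) (at x)" for i
  proof -
    have "((\<lambda>x. fps_nth (singular_fps x * q) i) has_vector_derivative
       (\<Sum>j=0..i. fps_nth (- ((fps_const (1/2) + geo) * singular_fps x)) j * fps_nth q (i - j))) (at x)"
      unfolding fps_mult_nth
      by (intro has_vector_derivative_sum bounded_linear.has_vector_derivative[OF bounded_linear_mult_left]
          singular_fps_has_vector_derivative[unfolded fps_mult_nth])
    also have "(\<Sum>j=0..i. fps_nth (- ((fps_const (1/2) + geo) * singular_fps x)) j * fps_nth q (i - j))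
       = fps_nth (- ((fps_const (1/2) + geo) * singular_fps x) * q) i"
      by (simp only: fps_mult_nth)
    finally show ?thesis by simp
  qed
  have Y: "singular_fps x * q = (1 - fps_X) * Z" by (simp add: q_def Z_def mult_ac)
  have half: "(fps_const (1/2) + geo) * (1 - fps_X) = fps_const (1/2) * (1 + fps_X :: complex fps)"
  proof -
    have "(fps_const (1/2) + geo) * (1 - fps_X) = fps_const (1/2) * (1 - fps_X) + fps_X"
      using geo_eq by (simp add: algebra_simps)
    also have "\<dots> = fps_const (1/2) * (1 + fps_X)"
      by (rule fps_ext) (simp add: fps_X_nth)
    finally show ?thesis .
  qed
  have Y': "- ((fps_const (1/2) + geo) * singular_fps x * q) = - (fps_const (1/2) * (1 + fps_X) * Z)"
    unfolding mult.assoc Y using half by (simp add: mult.assoc[symmetric])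
  define z where "z i = (if i = 0 then 0 else fps_nth Z (i - 1))" for i
  have tm: "((\<lambda>x. (cmod (fps_nth (singular_fps x * q) i))\<^sup>2) has_real_derivative
      (cmod (z i))\<^sup>2 - (cmod (z (Suc i)))\<^sup>2) (at x)" for i
  proof -
    define y y' where "y = z (Suc i) - z i" and "y' = - (1/2) * (z (Suc i) + z i)"
    have y: "fps_nth (singular_fps x * q) i = y"
      unfolding Y y_def z_def by (cases i) (simp_all add: algebra_simps)
    have y': "fps_nth (- ((fps_const (1/2) + geo) * singular_fps x * q)) i = y'"
      unfolding Y' y'_def z_def by (cases i) (simp_all add: algebra_simps)
    have "((\<lambda>x. fps_nth (singular_fps x * q) i \<bullet> fps_nth (singular_fps x * q) i) has_vector_derivative
       (fps_nth (singular_fps x * q) i \<bullet> fps_nth (- ((fps_const (1/2) + geo) * singular_fps x * q)) i +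
        fps_nth (- ((fps_const (1/2) + geo) * singular_fps x * q)) i \<bullet> fps_nth (singular_fps x * q) i)) (at x)"
      by (rule bounded_bilinear.has_vector_derivative[OF bounded_bilinear_inner dq dq])
    then have "((\<lambda>x. (cmod (fps_nth (singular_fps x * q) i))\<^sup>2) has_real_derivative (2 * (y \<bullet> y'))) (at x)"
      unfolding y y' has_real_derivative_iff_has_vector_derivative power2_norm_eq_inner
      by (simp add: inner_commute)
    moreover have "2 * (y \<bullet> y') = (cmod (z i))\<^sup>2 - (cmod (z (Suc i)))\<^sup>2"
      unfolding y_def y'_def power2_norm_eq_inner by (simp add: inner_complex_def field_simps)
    ultimately show ?thesis by simp
  qed
  have "((\<lambda>x. tnorm_sq N (singular_fps x * q)) has_real_derivative
      (\<Sum>i\<le>N. (cmod (z i))\<^sup>2 - (cmod (z (Suc i)))\<^sup>2)) (at x)"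
    unfolding tnorm_sq_def by (intro DERIV_sum tm)
  also have "(\<Sum>i\<le>N. (cmod (z i))\<^sup>2 - (cmod (z (Suc i)))\<^sup>2) =
      (cmod (z 0))\<^sup>2 - (cmod (z (Suc N)))\<^sup>2"
    by (rule sum_telescope)
  also have "\<dots> = - (cmod (fps_nth Z N))\<^sup>2" by (simp add: z_def)
  finally show ?thesis by (simp add: q_def Z_def)
qed

text \<open>
  The series \<open>1 - X\<close> is a unit, so \<open>tnorm_sq_derivative\<close> applies to every initial value.
\<close>

lemma ex_factor: "\<exists>P. q = (1 - fps_X) * (P :: complex fps)"
proof
  have "(1 - fps_X :: complex fps) * inverse (1 - fps_X) = 1"
    by (subst mult.commute, rule inverse_mult_eq_1) simp
  then show "q = (1 - fps_X) * (inverse (1 - fps_X) * q)"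
    by (simp add: mult.assoc[symmetric])
qed

lemma singular_fps_antimono:
  assumes "x \<le> y"
  shows "tnorm_sq N (singular_fps y * q) \<le> tnorm_sq N (singular_fps x * q)"
proof -
  obtain P where q: "q = (1 - fps_X) * P" using ex_factor by blast
  show ?thesis
    by (rule DERIV_nonpos_imp_nonincreasing[OF assms])
       (use tnorm_sq_derivative[of N P] in \<open>auto simp: q intro!: exI\<close>)
qed

lemma singular_fps_contraction: "tnorm_sq N (singular_fps 1 * q) \<le> tnorm_sq N q"
  using singular_fps_antimono[of 0 1 N q] by (simp add: singular_fps_0)

text \<open>
  The squared Dirichlet norm is a sum of truncated Hardy norms, so by \<open>tnorm_sq_derivative\<close> it
  decreases at the rate \<open>tnorm_sq N (singular_fps x * P)\<close>. This rate is decreasing in \<open>x\<close>, hence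
  its value at \<open>1\<close> is at most the total decrease over the unit interval.
\<close>

lemma singular_fps_bound: "tnorm_sq N (singular_fps 1 * P) \<le> tdirichlet_sq N ((1 - fps_X) * P)"
proof -
  define h where "h x = tdirichlet_sq N (singular_fps x * ((1 - fps_X) * P))" for x
  have "(h has_real_derivative - tnorm_sq N (singular_fps x * P)) (at x)" for x
    unfolding h_def tdirichlet_sq_def tnorm_sq_def[of N "singular_fps x * P"] sum_negf[symmetric]
    by (intro DERIV_sum tnorm_sq_derivative)
  then obtain z where z: "0 < z" "z < 1" "h 1 - h 0 = (1 - 0) * - tnorm_sq N (singular_fps z * P)"
    using MVT2[of 0 1 h "\<lambda>x. - tnorm_sq N (singular_fps x * P)"] by auto
  have "0 \<le> h 1" by (simp add: h_def tdirichlet_sq_def tnorm_sq_nonneg sum_nonneg)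
  moreover have "tnorm_sq N (singular_fps 1 * P) \<le> tnorm_sq N (singular_fps z * P)" using z by (intro singular_fps_antimono) simp
  ultimately show ?thesis using z by (simp add: h_def singular_fps_0)
qed

definition tnorm :: "nat \<Rightarrow> complex fps \<Rightarrow> real" where
  "tnorm N q = sqrt (tnorm_sq N q)"

lemma tnorm_L2: "tnorm N q = L2_set (\<lambda>i. cmod (fps_nth q i)) {..N}"
  by (simp add: tnorm_def tnorm_sq_def L2_set_def)

lemma tnorm_nonneg: "0 \<le> tnorm N q" by (simp add: tnorm_def tnorm_sq_nonneg)

lemma tnorm_triangle: "tnorm N (p + q) \<le> tnorm N p + tnorm N q"
proof -
  have "tnorm N (p + q) \<le> L2_set (\<lambda>i. cmod (fps_nth p i) + cmod (fps_nth q i)) {..N}"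
    unfolding tnorm_L2 by (intro L2_set_mono) (auto intro: norm_triangle_ineq)
  also have "\<dots> \<le> tnorm N p + tnorm N q" unfolding tnorm_L2 by (rule L2_set_triangle_ineq)
  finally show ?thesis .
qed

lemma tnorm_scale: "tnorm N (fps_const c * q) = cmod c * tnorm N q"
  by (simp add: tnorm_def tnorm_sq_def norm_mult power_mult_distrib sum_distrib_left[symmetric] real_sqrt_mult)

lemma tnorm_sum: "tnorm N (sum f A) \<le> (\<Sum>j\<in>A. tnorm N (f j))" if "finite A"
  using that
proof (induction A)
  case empty
  then show ?case by (simp add: tnorm_def tnorm_sq_def)
next
  case (insert x F)
  then show ?case using tnorm_triangle[of N "f x" "sum f F"] by simp
qed

lemma tnorm_X: "tnorm N (fps_X * q) \<le> tnorm N q"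
proof -
  have "tnorm_sq N (fps_X * q) \<le> tnorm_sq N q"
    unfolding tnorm_sq_def
  proof (induction N)
    case (Suc N)
    have "(\<Sum>i\<le>Suc N. (cmod (fps_nth (fps_X * q) i))\<^sup>2) = (\<Sum>i\<le>N. (cmod (fps_nth q i))\<^sup>2)"
      by (simp only: sum.atMost_Suc_shift) simp
    then show ?case by simp
  qed simp
  then show ?thesis by (simp add: tnorm_def)
qed

lemma tnorm_X_power: "tnorm N (fps_X ^ j * q) \<le> tnorm N q"
proof (induction j)
  case (Suc j)
  have "tnorm N (fps_X ^ Suc j * q) \<le> tnorm N (fps_X ^ j * q)"
    using tnorm_X[of N "fps_X ^ j * q"] by (simp add: mult.assoc)
  then show ?case using Suc by simp
qed simp

text \<open>
  Telescoping: \<open>X ^ j - 1\<close> is \<open>- (1 - X)\<close> times a sum of \<open>j\<close> powers of \<open>X\<close>, each a contraction.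
\<close>

lemma tnorm_X_power_diff: "tnorm N (fps_X ^ j * q - q) \<le> real j * tnorm N ((1 - fps_X) * q)"
proof (induction j)
  case 0
  then show ?case by (simp add: tnorm_def tnorm_sq_def)
next
  case (Suc j)
  have "fps_X ^ Suc j * q - q = fps_X * (fps_X ^ j * q - q) + fps_const (-1) * ((1 - fps_X) * q)"
    by (simp add: algebra_simps fps_const_neg[symmetric] del: fps_const_neg)
  then have "tnorm N (fps_X ^ Suc j * q - q) \<le>
      tnorm N (fps_X * (fps_X ^ j * q - q)) + tnorm N (fps_const (-1) * ((1 - fps_X) * q))"
    using tnorm_triangle by metis
  also have "\<dots> \<le> tnorm N (fps_X ^ j * q - q) + tnorm N ((1 - fps_X) * q)"
    using tnorm_X[of N "fps_X ^ j * q - q"] tnorm_scale[of N "-1" "(1 - fps_X) * q"] by simp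
  finally show ?case using Suc by (simp add: algebra_simps)
qed

lemma tnorm_cong: "(\<And>i. i \<le> N \<Longrightarrow> fps_nth p i = fps_nth q i) \<Longrightarrow> tnorm N p = tnorm N q"
  by (simp add: tnorm_def tnorm_sq_def)

text \<open>
  Split the multiplication by \<open>A\<close> at the index \<open>J\<close>. In the head replace \<open>X ^ j\<close> by \<open>X ^ j - 1\<close>, which
  is controlled by the factor \<open>1 - X\<close>; the price is the partial sum of the coefficients, and
  both it and the tail are at most \<open>e\<close>.
\<close>

lemma interpolation:
  assumes J: "cmod (\<Sum>j\<le>J. fps_nth A j) \<le> e" and tail: "\<And>N. (\<Sum>j\<in>{J<..N}. cmod (fps_nth A j)) \<le> e"
  shows "tnorm N (A * q) \<le> (\<Sum>j\<le>J. real j * cmod (fps_nth A j)) * tnorm N ((1 - fps_X) * q) + 2 * e * tnorm N q"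
proof -
  define a where "a = fps_nth A"
  define T1 where "T1 = (\<Sum>j\<le>J. fps_const (a j) * (fps_X ^ j * q - q))"
  define T2 where "T2 = fps_const (\<Sum>j\<le>J. a j) * q"
  define T3 where "T3 = (\<Sum>j\<in>{J<..max J N}. fps_const (a j) * (fps_X ^ j * q))"
  have "T1 + T2 = (\<Sum>j\<le>J. fps_const (a j) * (fps_X ^ j * q))"
  proof -
    have "fps_const (\<Sum>j\<le>J. a j) = (\<Sum>j\<le>J. fps_const (a j))"
      by (rule fps_ext) (simp add: fps_sum_nth)
    then have "T2 = (\<Sum>j\<le>J. fps_const (a j) * q)" by (simp add: T2_def sum_distrib_right)
    then show ?thesis
      unfolding T1_def by (simp only: sum.distrib[symmetric] right_diff_distrib diff_add_cancel)
  qed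
  also have "\<dots> + T3 = (\<Sum>j\<in>{..J} \<union> {J<..max J N}. fps_const (a j) * (fps_X ^ j * q))"
    unfolding T3_def by (rule sum.union_disjoint[symmetric]) auto
  also have "{..J} \<union> {J<..max J N} = {..max J N}" by auto
  finally have split: "T1 + T2 + T3 = (\<Sum>j\<le>max J N. fps_const (a j) * (fps_X ^ j * q))" .
  have "tnorm N (A * q) = tnorm N (T1 + T2 + T3)"
  proof (rule tnorm_cong)
    fix i assume i: "i \<le> N"
    have "fps_nth (T1 + T2 + T3) i = (\<Sum>j\<le>max J N. a j * (if i < j then 0 else fps_nth q (i - j)))"
      unfolding split by (simp add: fps_sum_nth fps_X_power_mult_nth)
    also have "\<dots> = (\<Sum>j=0..i. a j * fps_nth q (i - j))"
      by (rule sum.mono_neutral_cong_right) (use i in auto)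
    finally show "fps_nth (A * q) i = fps_nth (T1 + T2 + T3) i"
      by (simp add: fps_mult_nth a_def)
  qed
  also have "\<dots> \<le> tnorm N T1 + tnorm N T2 + tnorm N T3"
    using tnorm_triangle[of N "T1 + T2" T3] tnorm_triangle[of N T1 T2] by simp
  also have "tnorm N T1 \<le> (\<Sum>j\<le>J. cmod (a j) * (real j * tnorm N ((1 - fps_X) * q)))"
    unfolding T1_def
    by (rule order_trans[OF tnorm_sum sum_mono]) (auto simp: tnorm_scale intro!: mult_left_mono tnorm_X_power_diff)
  also have "\<dots> = (\<Sum>j\<le>J. real j * cmod (a j)) * tnorm N ((1 - fps_X) * q)"
    by (simp add: sum_distrib_left sum_distrib_right mult_ac)
  also have "tnorm N T2 \<le> e * tnorm N q"
    unfolding T2_def tnorm_scale by (rule mult_right_mono) (use J tnorm_nonneg in \<open>auto simp: a_def\<close>)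
  also have "tnorm N T3 \<le> (\<Sum>j\<in>{J<..max J N}. cmod (a j) * tnorm N q)"
    unfolding T3_def
    by (rule order_trans[OF tnorm_sum sum_mono]) (auto simp: tnorm_scale intro!: mult_left_mono tnorm_X_power)
  also have "\<dots> \<le> e * tnorm N q"
    unfolding sum_distrib_right[symmetric] using tail[of "max J N"]
    by (intro mult_right_mono tnorm_nonneg) (simp add: a_def)
  finally show ?thesis by (simp add: a_def algebra_simps)
qed

text \<open>
  The power series of \<open>(1 - z) powr \<gamma>\<close>.
\<close>

definition binom_fps :: "real \<Rightarrow> complex fps" where
  "binom_fps \<gamma> = Abs_fps (\<lambda>n. of_real ((-1) ^ n * (\<gamma> gchoose n)))"

text \<open>
  The partial sums \<open>s n\<close> of the coefficients are the products of the factors \<open>1 - \<gamma> / k\<close> for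
  \<open>1 \<le> k \<le> n\<close>. They decrease to \<open>0\<close> since the harmonic series diverges, and the coefficients after
  the first are their differences, so all have the same sign.
\<close>

lemma binom_fps_partial:
  fixes \<gamma> :: real
  assumes "0 < \<gamma>" "\<gamma> < 1" and e: "0 < e"
  shows "\<exists>J. cmod (\<Sum>j\<le>J. fps_nth (binom_fps \<gamma>) j) \<le> e \<and>
     (\<forall>N. (\<Sum>j\<in>{J<..N}. cmod (fps_nth (binom_fps \<gamma>) j)) \<le> e)"
proof -
  define s where "s n = (\<Sum>j\<le>n. (-1) ^ j * (\<gamma> gchoose j))" for n
  have s: "s n = (-1) ^ n * (\<gamma> - 1 gchoose n)" for n
    using gbinomial_sum_lower_neg[of \<gamma> n] by (simp add: s_def mult.commute)
  have s_Suc: "s (Suc n) = s n * (1 - \<gamma> / real (Suc n))" for n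
    unfolding s gbinomial_prod_rev by (simp add: field_simps)
  have s0: "s 0 = 1" by (simp add: s_def)
  have fac: "0 \<le> 1 - \<gamma> / real (Suc n)" for n
    using assms by (simp add: field_simps)
  have pos: "0 \<le> s n" for n by (induction n) (use fac in \<open>auto simp: s0 s_Suc\<close>)
  have le: "s n \<le> exp (- \<gamma> * harm n)" for n
  proof (induction n)
    case (Suc n)
    have "s (Suc n) \<le> exp (- \<gamma> * harm n) * exp (- \<gamma> / real (Suc n))"
      unfolding s_Suc using Suc fac exp_ge_add_one_self[of "- \<gamma> / real (Suc n)"]
      by (intro mult_mono) (auto simp del: of_nat_Suc)
    then show ?case
      by (simp add: harm_Suc exp_add[symmetric] algebra_simps divide_inverse)
  qed (simp add: s0 harm_def)
  have "((\<lambda>n. exp (- \<gamma> * harm n)) \<longlonglongrightarrow> 0)"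
  proof -
    have "filterlim (\<lambda>n. \<gamma> * (harm n :: real)) at_top sequentially"
      by (intro filterlim_tendsto_pos_mult_at_top[OF tendsto_const] assms harm_at_top)
    then have "filterlim (\<lambda>n. - (\<gamma> * (harm n :: real))) at_bot sequentially"
      by (simp add: filterlim_uminus_at_top)
    then show ?thesis by (intro filterlim_compose[OF exp_at_bot]) simp
  qed
  then obtain J where "exp (- \<gamma> * harm J) < e"
    using e by (metis (no_types, lifting) eventually_sequentially order_le_less order_tendstoD(2))
  then have J: "s J \<le> e" using le[of J] by simp
  have "(\<Sum>j\<le>J. fps_nth (binom_fps \<gamma>) j) = of_real (s J)"
    by (simp add: binom_fps_def s_def)
  then have 1: "cmod (\<Sum>j\<le>J. fps_nth (binom_fps \<gamma>) j) \<le> e" using J pos[of J] by simp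
  have a: "cmod (fps_nth (binom_fps \<gamma>) (Suc j)) = s j - s (Suc j)" for j
  proof -
    have "fps_nth (binom_fps \<gamma>) (Suc j) = of_real (s (Suc j) - s j)"
      by (simp add: binom_fps_def s_def)
    moreover have "s (Suc j) \<le> s j"
      unfolding s_Suc using pos[of j] assms by (intro mult_left_le) auto
    ultimately show ?thesis by (simp only: norm_of_real)
  qed
  have a': "cmod (fps_nth (binom_fps \<gamma>) j) = s (j - Suc 0) - s j" if "0 < j" for j
    using a[of "j - 1"] that by simp
  have 2: "(\<Sum>j\<in>{J<..N}. cmod (fps_nth (binom_fps \<gamma>) j)) \<le> e" for N
  proof (cases "J \<le> N")
    case True
    have "(\<Sum>j\<in>{J<..N}. cmod (fps_nth (binom_fps \<gamma>) j)) = (\<Sum>j\<in>{J..<N}. s j - s (Suc j))"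
      by (rule sum.reindex_bij_witness[of _ Suc "\<lambda>j. j - 1"]) (auto simp: a')
    also have "\<dots> = s J - s N" using sum_Suc_diff'[of J N "\<lambda>j. - s j"] True by simp
    also have "\<dots> \<le> e" using J pos[of N] by simp
    finally show ?thesis .
  qed (use e in simp)
  show ?thesis using 1 2 by blast
qed

section \<open>Means over circles\<close>

text \<open>
  Circles are parametrised by the angle: functions that are holomorphic in the disk then have
  continuous, hence measurable, restrictions, whatever their values outside the disk.
\<close>

definition angle :: "real measure" where
  "angle = uniform_measure lborel {0..2 * pi}"

lemma angle_emeasure: "emeasure lborel {0..2 * pi} = ennreal (2 * pi)"
  by simp

interpretation angle: finite_measure angle
  by (rule finite_measureI) (simp add: angle_def emeasure_uniform_measure_1)

lemma sets_angle [measurable_cong, simp]: "sets angle = sets borel"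
  by (simp add: angle_def)

lemma space_angle [simp]: "space angle = UNIV"
  by (simp add: angle_def)

lemma measure_angle: "measure angle UNIV = 1"
  by (simp add: angle_def measure_def emeasure_uniform_measure_1)

lemma circle_measure_angle: "circle_measure = distr angle borel cis"
  by (simp add: circle_measure_def angle_def)

lemma cis_measurable [measurable]: "cis \<in> borel_measurable borel"
  by (intro borel_measurable_continuous_onI continuous_intros)

lemma angle_integrable:
  fixes F :: "real \<Rightarrow> 'a :: {banach, second_countable_topology}"
  assumes "F \<in> borel_measurable borel" "\<And>t. norm (F t) \<le> K"
  shows "integrable angle F"
  by (rule angle.integrable_const_bound[of _ K]) (use assms in auto)

lemma angle_integral:
  fixes F :: "real \<Rightarrow> complex"
  assumes [measurable]: "F \<in> borel_measurable borel"
  shows "integral\<^sup>L angle F = (1 / (2 * pi)) *\<^sub>R (\<integral>t. indicator {0..2 * pi} t *\<^sub>R F t \<partial>lborel)"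
proof -
  have dens: "angle = density lborel (\<lambda>t. ennreal (indicator {0..2 * pi} t / (2 * pi)))"
    unfolding angle_def uniform_measure_def
    by (intro density_cong) (auto simp: angle_emeasure indicator_def divide_ennreal[symmetric] ennreal_divide_numeral split: if_splits)
  have "integral\<^sup>L angle F = (\<integral>t. (indicator {0..2 * pi} t / (2 * pi)) *\<^sub>R F t \<partial>lborel)"
    unfolding dens by (rule integral_density) auto
  also have "\<dots> = (\<integral>t. (1 / (2 * pi)) *\<^sub>R (indicator {0..2 * pi} t *\<^sub>R F t) \<partial>lborel)"
    by (intro Bochner_Integration.integral_cong) (auto simp: indicator_def)
  also have "\<dots> = (1 / (2 * pi)) *\<^sub>R (\<integral>t. indicator {0..2 * pi} t *\<^sub>R F t \<partial>lborel)"
    by (rule integral_scaleR_right)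
  finally show ?thesis .
qed

lemma angle_integral_cis:
  "(\<integral>t. cis (of_int n * t) \<partial>angle) = (if n = 0 then 1 else 0)"
proof (cases "n = 0")
  case True
  then show ?thesis by (simp add: measure_angle)
next
  case False
  define F where "F t = cis (of_int n * t) / (\<i> * of_int n)" for t :: real
  have cont: "continuous_on A (\<lambda>t. cis (of_int n * t))" for A
    by (intro continuous_intros)
  have "((\<lambda>z. exp (\<i> * of_int n * z) / (\<i> * of_int n)) has_field_derivative exp (\<i> * of_int n * of_real t)) (at (of_real t))"
    for t :: real using False by (auto intro!: derivative_eq_intros)
  then have "((\<lambda>t. exp (\<i> * of_int n * of_real t) / (\<i> * of_int n)) has_vector_derivative
      exp (\<i> * of_int n * of_real t)) (at t)" for t
    by (rule has_vector_derivative_real_field)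
  moreover have ce: "exp (\<i> * of_int n * of_real t) = cis (of_int n * t)" for t
    by (simp add: cis_conv_exp mult.assoc)
  moreover have "(\<lambda>t. exp (\<i> * of_int n * of_real t) / (\<i> * of_int n)) = F"
    by (rule ext) (simp only: F_def ce)
  ultimately have dF: "(F has_vector_derivative cis (of_int n * t)) (at t)" for t
    by (simp only:)
  then have "(\<integral>t. indicator {0..2 * pi} t *\<^sub>R cis (of_int n * t) \<partial>lborel) = F (2 * pi) - F 0"
    by (intro integral_FTC_Icc cont has_vector_derivative_at_within[OF dF]) simp
  also have "F (2 * pi) = F 0"
  proof -
    have "cis (of_int n * (2 * pi)) = 1" using cis_multiple_2pi[of n] by (simp add: mult_ac)
    then show ?thesis by (simp add: F_def)
  qed
  finally show ?thesis
    using False by (subst angle_integral) (auto intro!: borel_measurable_continuous_onI cont)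
qed

lemma angle_sums:
  fixes u :: "nat \<Rightarrow> real \<Rightarrow> complex"
  assumes c: "summable (\<lambda>m. cmod (c m))"
    and u: "\<And>m. u m \<in> borel_measurable borel" "\<And>m t. cmod (u m t) \<le> K"
    and F: "\<And>t. (\<lambda>m. c m * u m t) sums F t"
  shows "(\<lambda>m. c m * (\<integral>t. u m t \<partial>angle)) sums (\<integral>t. F t \<partial>angle)"
proof -
  have int: "integrable angle (\<lambda>t. c m * u m t)" for m
    by (rule angle_integrable[of _ "cmod (c m) * K"])
       (auto intro!: mult_left_mono u borel_measurable_times simp: norm_mult)
  have tnorm: "cmod (c m * u m t) \<le> cmod (c m) * K" for m t
    by (auto intro!: mult_left_mono u simp: norm_mult)
  have sm: "summable (\<lambda>m. cmod (c m) * K)" by (intro summable_mult2 c)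
  have "(\<lambda>m. \<integral>t. c m * u m t \<partial>angle) sums (\<integral>t. (\<Sum>m. c m * u m t) \<partial>angle)"
  proof (rule sums_integral[OF int])
    show "AE t in angle. summable (\<lambda>m. norm (c m * u m t))"
      by (intro AE_I2 summable_comparison_test'[OF sm, of 0]) (simp add: tnorm)
    show "summable (\<lambda>m. \<integral>t. norm (c m * u m t) \<partial>angle)"
    proof (rule summable_comparison_test'[OF sm, of 0])
      fix m
      have "(\<integral>t. norm (c m * u m t) \<partial>angle) \<le> (\<integral>t. cmod (c m) * K \<partial>angle)"
        by (rule integral_mono) (use int tnorm in auto)
      then show "norm (\<integral>t. norm (c m * u m t) \<partial>angle) \<le> cmod (c m) * K"
        by (simp add: integral_nonneg_AE measure_angle)
    qed
  qed
  moreover have "(\<Sum>m. c m * u m t) = F t" for t by (rule sums_unique[OF F, symmetric])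
  moreover have "(\<integral>t. c m * u m t \<partial>angle) = c m * (\<integral>t. u m t \<partial>angle)" for m by simp
  ultimately show ?thesis by simp
qed

definition taylor :: "(complex \<Rightarrow> complex) \<Rightarrow> nat \<Rightarrow> complex" where
  "taylor f n = fps_nth (fps_expansion f 0) n"

lemma taylor_sums: "f holomorphic_on unit_disk \<Longrightarrow> z \<in> unit_disk \<Longrightarrow> (\<lambda>n. taylor f n * z ^ n) sums f z"
  using holomorphic_power_series[of f 0 1 z] by (simp add: taylor_def fps_expansion_def)

lemma taylor_summable:
  assumes "f holomorphic_on unit_disk" "0 \<le> r" "r < 1"
  shows "summable (\<lambda>n. cmod (taylor f n * of_real r ^ n))"
proof -
  have "summable (\<lambda>n. taylor f n * of_real ((1 + r) / 2) ^ n)"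
    using taylor_sums[OF assms(1), of "of_real ((1 + r) / 2)"] assms by (auto simp: sums_iff norm_of_real simp del: of_real_add of_real_divide)
  then show ?thesis
    by (rule powser_insidea) (use assms in \<open>auto simp del: of_real_add of_real_divide\<close>)
qed

text \<open>
  Power series that converge in the disk have the expected Taylor coefficients; this
  identifies the coefficients of all concrete functions below.
\<close>

lemma taylor_unique:
  assumes "\<And>z. z \<in> unit_disk \<Longrightarrow> (\<lambda>n. c n * z ^ n) sums f z"
  shows "f holomorphic_on unit_disk" "taylor f n = c n"
proof -
  show h: "f holomorphic_on unit_disk"
    by (rule power_series_holomorphic[of 0 1 c]) (use assms in auto)
  have "f has_fps_expansion Abs_fps c"
  proof (rule has_fps_expansionI)
    have "\<forall>\<^sub>F z in nhds 0. z \<in> (unit_disk :: complex set)"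
      by (rule eventually_nhds_in_open) auto
    then show "\<forall>\<^sub>F z in nhds 0. (\<lambda>n. fps_nth (Abs_fps c) n * z ^ n) sums f z"
    proof (rule eventually_mono)
      fix z :: complex assume "z \<in> unit_disk"
      then show "(\<lambda>n. fps_nth (Abs_fps c) n * z ^ n) sums f z" unfolding fps_nth_Abs_fps by (rule assms)
    qed
  qed
  then have "fps_expansion f 0 = Abs_fps c" by (rule fps_expansion_eqI)
  then show "taylor f n = c n" by (simp add: taylor_def)
qed

lemma on_disk: "0 \<le> r \<Longrightarrow> r < 1 \<Longrightarrow> of_real r * cis t \<in> unit_disk"
  by (simp add: norm_mult)

lemma circle_continuous:
  assumes "f holomorphic_on unit_disk" "0 \<le> r" "r < 1"
  shows "continuous_on A (\<lambda>t. f (of_real r * cis t))"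
  by (rule continuous_on_compose2[OF holomorphic_on_imp_continuous_on[OF assms(1)]])
     (use on_disk[OF assms(2,3)] in \<open>auto intro!: continuous_intros\<close>)

lemma circle_measurable [measurable]:
  assumes "f holomorphic_on unit_disk" "0 \<le> r" "r < 1"
  shows "(\<lambda>t. f (of_real r * cis t)) \<in> borel_measurable borel"
  by (rule borel_measurable_continuous_onI[OF circle_continuous[OF assms]])

lemma circle_measurable_cnj:
  assumes "f holomorphic_on unit_disk" "0 \<le> r" "r < 1"
  shows "(\<lambda>t. cnj (f (of_real r * cis t))) \<in> borel_measurable borel"
  by (intro borel_measurable_continuous_onI continuous_intros circle_continuous assms)

lemma circle_bounded:
  assumes "f holomorphic_on unit_disk" "0 \<le> r" "r < 1"
  obtains K where "\<And>t. cmod (f (of_real r * cis t)) \<le> K"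
proof -
  have "compact (f ` cball 0 r)"
    using assms by (intro compact_continuous_image holomorphic_on_imp_continuous_on) (auto elim: holomorphic_on_subset)
  then obtain K where "\<forall>x\<in>f ` cball 0 r. cmod x \<le> K" using compact_imp_bounded bounded_iff by metis
  then show ?thesis using assms by (intro that[of K]) (auto simp: norm_mult)
qed

text \<open>
  The inner product and the squared norm of the Hardy space at radius \<open>r\<close>. Boundary values are
  never used: Hardy space pairings are limits of these means as the radius tends to one.
\<close>

definition circle_ip :: "real \<Rightarrow> (complex \<Rightarrow> complex) \<Rightarrow> (complex \<Rightarrow> complex) \<Rightarrow> complex" where
  "circle_ip r f g = (\<integral>t. f (of_real r * cis t) * cnj (g (of_real r * cis t)) \<partial>angle)"

definition circle_sq :: "real \<Rightarrow> (complex \<Rightarrow> complex) \<Rightarrow> real" where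
  "circle_sq r f = (\<integral>t. (cmod (f (of_real r * cis t)))\<^sup>2 \<partial>angle)"

lemma circle_ip_integrable:
  assumes "f holomorphic_on unit_disk" "g holomorphic_on unit_disk" "0 \<le> r" "r < 1"
  shows "integrable angle (\<lambda>t. f (of_real r * cis t) * cnj (g (of_real r * cis t)))"
proof -
  obtain K L where "\<And>t. cmod (f (of_real r * cis t)) \<le> K" "\<And>t. cmod (g (of_real r * cis t)) \<le> L"
    using circle_bounded assms by metis
  then show ?thesis
    by (intro angle_integrable[of _ "K * L"] borel_measurable_times circle_measurable circle_measurable_cnj assms)
      (auto simp: norm_mult intro!: mult_mono order_trans[OF norm_ge_zero])
qed

lemma circle_ip_self: "circle_ip r f f = of_real (circle_sq r f)"
  unfolding circle_ip_def circle_sq_def complex_norm_square[symmetric] by (rule integral_complex_of_real)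

lemma circle_sq_nonneg: "0 \<le> circle_sq r f"
  unfolding circle_sq_def by simp

lemma circle_ip_cnj: "circle_ip r g f = cnj (circle_ip r f g)"
  unfolding circle_ip_def by (subst Bochner_Integration.integral_cnj[symmetric]) (simp add: mult.commute)

lemma circle_ip_cong:
  assumes "\<And>z. z \<in> unit_disk \<Longrightarrow> f z = f' z" "\<And>z. z \<in> unit_disk \<Longrightarrow> g z = g' z" "0 \<le> r" "r < 1"
  shows "circle_ip r f g = circle_ip r f' g'"
  unfolding circle_ip_def using assms on_disk by simp

lemma circle_ip_add:
  assumes "f holomorphic_on unit_disk" "g holomorphic_on unit_disk" "h holomorphic_on unit_disk" "0 \<le> r" "r < 1"
  shows "circle_ip r (\<lambda>z. f z + g z) h = circle_ip r f h + circle_ip r g h"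
  unfolding circle_ip_def distrib_right
  by (rule Bochner_Integration.integral_add) (intro circle_ip_integrable assms)+

lemma circle_ip_scale: "circle_ip r (\<lambda>z. \<alpha> * f z) h = \<alpha> * circle_ip r f h"
  unfolding circle_ip_def mult.assoc by simp

lemma circle_ip_add_right:
  assumes "f holomorphic_on unit_disk" "g holomorphic_on unit_disk" "h holomorphic_on unit_disk" "0 \<le> r" "r < 1"
  shows "circle_ip r h (\<lambda>z. f z + g z) = circle_ip r h f + circle_ip r h g"
  using circle_ip_add[OF assms] circle_ip_cnj by (metis complex_cnj_add)

lemma circle_ip_scale_right: "circle_ip r h (\<lambda>z. \<alpha> * f z) = cnj \<alpha> * circle_ip r h f"
  using circle_ip_scale circle_ip_cnj by (metis complex_cnj_mult)

text \<open>
  Expand one factor at a time: first \<open>g\<close> against an exponential, which gives its Taylor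
  coefficients, then \<open>f\<close>.
\<close>

lemma Parseval:
  assumes f: "f holomorphic_on unit_disk" and g: "g holomorphic_on unit_disk" and r: "0 \<le> r" "r < 1"
  shows "(\<lambda>n. taylor f n * cnj (taylor g n) * of_real (r ^ (2 * n))) sums circle_ip r f g"
proof -
  have pw: "(of_real r * cis t) ^ n = of_real r ^ n * cis (of_int (int n) * t)" for t n
    by (simp add: power_mult_distrib Complex.DeMoivre)
  have mcis: "(\<lambda>t. cis (of_int m * t)) \<in> borel_measurable borel" for m :: int
    by (intro borel_measurable_continuous_onI continuous_intros)
  have mcis': "(\<lambda>t. cnj (cis (of_int m * t))) \<in> borel_measurable borel" for m :: int
    by (intro borel_measurable_continuous_onI continuous_intros)
  have coeff: "(\<integral>t. h (of_real r * cis t) * cnj (cis (of_int (int n) * t)) \<partial>angle) = taylor h n * of_real r ^ n"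
    if h: "h holomorphic_on unit_disk" for h n
  proof -
    have "(\<lambda>m. taylor h m * of_real r ^ m * (\<integral>t. cis (of_int (int m) * t) * cnj (cis (of_int (int n) * t)) \<partial>angle))
       sums (\<integral>t. h (of_real r * cis t) * cnj (cis (of_int (int n) * t)) \<partial>angle)"
    proof (rule angle_sums)
      show "summable (\<lambda>m. cmod (taylor h m * of_real r ^ m))" by (rule taylor_summable[OF h r])
      fix t
      show "(\<lambda>m. taylor h m * of_real r ^ m * (cis (of_int (int m) * t) * cnj (cis (of_int (int n) * t)))) sums
           (h (of_real r * cis t) * cnj (cis (of_int (int n) * t)))"
        using sums_mult2[OF taylor_sums[OF h on_disk[OF r]], of t "cnj (cis (of_int (int n) * t))"]
        unfolding pw by (simp add: mult_ac)
      show "cmod (cis (of_int (int m) * t) * cnj (cis (of_int (int n) * t))) \<le> 1" for m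
        by (simp add: norm_mult)
    qed (intro borel_measurable_times mcis mcis')
    moreover have "(\<integral>t. cis (of_int (int m) * t) * cnj (cis (of_int (int n) * t)) \<partial>angle) = (if m = n then 1 else 0)" for m
      using angle_integral_cis[of "int m - int n"]
      by (simp add: cis_cnj cis_mult left_diff_distrib)
    ultimately have "(\<lambda>m. taylor h m * of_real r ^ m * (if m = n then 1 else 0))
       sums (\<integral>t. h (of_real r * cis t) * cnj (cis (of_int (int n) * t)) \<partial>angle)"
      by (simp only:)
    moreover have "(\<lambda>m. taylor h m * of_real r ^ m * (if m = n then 1 else 0)) =
        (\<lambda>m. if m = n then taylor h m * of_real r ^ m else 0)"
      by auto
    moreover have "(\<lambda>m. if m = n then taylor h m * of_real r ^ m else 0) sums (taylor h n * of_real r ^ n)"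
      by (rule sums_single)
    ultimately show ?thesis using sums_unique2 by simp
  qed
  obtain K where K: "\<And>t. cmod (g (of_real r * cis t)) \<le> K" using circle_bounded[OF g r] by blast
  have "(\<lambda>n. taylor f n * of_real r ^ n * (\<integral>t. cis (of_int (int n) * t) * cnj (g (of_real r * cis t)) \<partial>angle)) sums circle_ip r f g"
    unfolding circle_ip_def
  proof (rule angle_sums)
    show "summable (\<lambda>m. cmod (taylor f m * of_real r ^ m))" by (rule taylor_summable[OF f r])
    fix t
    show "(\<lambda>m. taylor f m * of_real r ^ m * (cis (of_int (int m) * t) * cnj (g (of_real r * cis t)))) sums
         (f (of_real r * cis t) * cnj (g (of_real r * cis t)))"
      using sums_mult2[OF taylor_sums[OF f on_disk[OF r]], of t "cnj (g (of_real r * cis t))"]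
      unfolding pw by (simp add: mult_ac)
    show "cmod (cis (of_int (int m) * t) * cnj (g (of_real r * cis t))) \<le> K" for m
      using K by (simp add: norm_mult)
  qed (intro borel_measurable_times mcis circle_measurable_cnj circle_measurable g r)
  moreover have "(\<integral>t. cis (of_int (int n) * t) * cnj (g (of_real r * cis t)) \<partial>angle) = cnj (taylor g n * of_real r ^ n)" for n
    unfolding coeff[OF g, symmetric] by (subst Bochner_Integration.integral_cnj[symmetric]) (simp add: mult.commute)
  ultimately show ?thesis by (simp add: mult_ac power_mult power2_eq_square power_mult_distrib)
qed

lemma Parseval_sq:
  assumes f: "f holomorphic_on unit_disk" and r: "0 \<le> r" "r < 1"
  shows "(\<lambda>n. (cmod (taylor f n))\<^sup>2 * r ^ (2 * n)) sums circle_sq r f"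
proof -
  have "(\<lambda>n. complex_of_real ((cmod (taylor f n))\<^sup>2 * r ^ (2 * n))) sums of_real (circle_sq r f)"
    using Parseval[OF f f r] unfolding circle_ip_self complex_norm_square[symmetric] by simp
  then show ?thesis by (simp only: sums_of_real_iff)
qed

lemma circle_sq_mono:
  assumes f: "f holomorphic_on unit_disk" and r: "0 \<le> r" "r \<le> s" "s < 1"
  shows "circle_sq r f \<le> circle_sq s f"
  by (rule sums_le[OF _ Parseval_sq[OF f] Parseval_sq[OF f]])
     (use r in \<open>auto intro!: mult_left_mono power_mono\<close>)

lemma circle_sq_bound_circle:
  assumes "f holomorphic_on unit_disk" "0 \<le> r" "r < 1" and le: "\<And>t. cmod (f (of_real r * cis t)) \<le> M"
  shows "circle_sq r f \<le> M\<^sup>2"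
proof -
  have sq: "(cmod (f (of_real r * cis t)))\<^sup>2 \<le> M\<^sup>2" for t
    using le[of t] by (intro power_mono) auto
  have "circle_sq r f \<le> (\<integral>t. M\<^sup>2 \<partial>angle)"
    unfolding circle_sq_def
    by (rule integral_mono) (use sq assms in \<open>auto intro!: angle_integrable[of _ "M\<^sup>2"] borel_measurable_power
        borel_measurable_norm circle_measurable\<close>)
  then show ?thesis by (simp add: measure_angle)
qed

lemma circle_sq_bound:
  assumes "f holomorphic_on unit_disk" "0 \<le> r" "r < 1" "\<And>z. z \<in> unit_disk \<Longrightarrow> cmod (f z) \<le> M"
  shows "circle_sq r f \<le> M\<^sup>2"
  by (rule circle_sq_bound_circle[OF assms(1-3)]) (rule assms(4)[OF on_disk[OF assms(2,3)]])

text \<open>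
  Stated in the weighted form so that sums of two such estimates and limits in the radius can
  be taken before optimising in \<open>s\<close>; see \<open>le_mult_of_young\<close>.
\<close>

lemma circle_ip_young:
  assumes f: "f holomorphic_on unit_disk" and g: "g holomorphic_on unit_disk" and r: "0 \<le> r" "r < 1"
    and s: "0 < s"
  shows "cmod (circle_ip r f g) \<le> (s * circle_sq r f + circle_sq r g / s) / 2"
proof -
  have int: "integrable angle (\<lambda>t. (cmod (h (of_real r * cis t)))\<^sup>2)" if hol: "h holomorphic_on unit_disk" for h
  proof -
    obtain K where "\<And>t. cmod (h (of_real r * cis t)) \<le> K" using circle_bounded[OF hol r] by blast
    then show ?thesis
      using hol r by (intro angle_integrable[of _ "K\<^sup>2"]) (auto intro!: power_mono borel_measurable_power borel_measurable_norm circle_measurable)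
  qed
  have young: "x * y \<le> (s * x\<^sup>2 + y\<^sup>2 / s) / 2" for x y :: real
  proof -
    have "0 \<le> (s * x - y)\<^sup>2 / s" using s by simp
    also have "\<dots> = s * x\<^sup>2 + y\<^sup>2 / s - 2 * (x * y)" using s by (simp add: field_simps power2_eq_square)
    finally show ?thesis by simp
  qed
  have "cmod (circle_ip r f g) \<le> (\<integral>t. cmod (f (of_real r * cis t) * cnj (g (of_real r * cis t))) \<partial>angle)"
    unfolding circle_ip_def by (rule integral_norm_bound)
  also have "\<dots> \<le> (\<integral>t. (s * (cmod (f (of_real r * cis t)))\<^sup>2 + (cmod (g (of_real r * cis t)))\<^sup>2 / s) / 2 \<partial>angle)"
  proof (rule integral_mono)
    show "integrable angle (\<lambda>t. cmod (f (of_real r * cis t) * cnj (g (of_real r * cis t))))"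
      by (intro integrable_norm circle_ip_integrable f g r)
    show "integrable angle (\<lambda>t. (s * (cmod (f (of_real r * cis t)))\<^sup>2 + (cmod (g (of_real r * cis t)))\<^sup>2 / s) / 2)"
      by (intro Bochner_Integration.integrable_add integrable_divide integrable_mult_right int f g)
  qed (use young in \<open>simp add: norm_mult\<close>)
  also have "\<dots> = (s * circle_sq r f + circle_sq r g / s) / 2"
    unfolding circle_sq_def using int[OF f] int[OF g] by simp
  finally show ?thesis .
qed

text \<open>
  The Szego kernel, the reproducing kernel of the Hardy space.
\<close>

definition szego :: "complex \<Rightarrow> complex \<Rightarrow> complex" where
  "szego w z = 1 / (1 - cnj w * z)"

lemma szego_sums:
  assumes "w \<in> unit_disk" "z \<in> unit_disk"
  shows "(\<lambda>n. cnj w ^ n * z ^ n) sums szego w z"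
proof -
  have "cmod (cnj w * z) < 1" using assms mult_strict_mono'[of "cmod w" 1 "cmod z" 1] by (simp add: norm_mult)
  then show ?thesis unfolding szego_def power_mult_distrib[symmetric] by (rule geometric_sums)
qed

lemma szego_holomorphic: "w \<in> unit_disk \<Longrightarrow> szego w holomorphic_on unit_disk"
  by (rule taylor_unique(1)[OF szego_sums])

lemma taylor_szego: "w \<in> unit_disk \<Longrightarrow> taylor (szego w) n = cnj w ^ n"
  by (rule taylor_unique(2)[OF szego_sums])

lemma szego_bound:
  assumes "w \<in> unit_disk" "z \<in> unit_disk"
  shows "cmod (szego w z) \<le> 1 / (1 - cmod w)"
proof -
  have "cmod (cnj w * z) \<le> cmod w" using assms mult_left_le[of "cmod z" "cmod w"] by (simp add: norm_mult)
  then have "1 - cmod w \<le> cmod (1 - cnj w * z)" using norm_triangle_ineq2[of 1 "cnj w * z"] by simp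
  then show ?thesis using assms unfolding szego_def by (simp add: norm_divide frac_le)
qed

text \<open>
  The Szego kernel at \<open>w\<close> reproduces on the circle of radius \<open>r\<close> the value at \<open>r\<^sup>2 w\<close>, since both
  factors carry a power of \<open>r\<close>.
\<close>

lemma circle_ip_szego:
  assumes f: "f holomorphic_on unit_disk" and w: "w \<in> unit_disk" and r: "0 \<le> r" "r < 1"
  shows "circle_ip r f (szego w) = f (of_real (r\<^sup>2) * w)"
proof -
  have "r\<^sup>2 < 1" using r by (simp add: power_less_one_iff abs_square_less_1)
  then have "of_real (r\<^sup>2) * w \<in> unit_disk"
    using w mult_strict_mono'[of "r\<^sup>2" 1 "cmod w" 1] by (simp add: norm_mult norm_power)
  from taylor_sums[OF f this]
  have "(\<lambda>n. taylor f n * cnj (taylor (szego w) n) * of_real (r ^ (2 * n))) sums f (of_real (r\<^sup>2) * w)"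
    by (simp add: taylor_szego[OF w] power_mult_distrib power_mult mult_ac power2_eq_square)
  then show ?thesis using Parseval[OF f szego_holomorphic[OF w] r] sums_unique2 by blast
qed

text \<open>
  Radial limits are taken along this fixed sequence of radii.
\<close>

definition radius :: "nat \<Rightarrow> real" where
  "radius j = 1 - 1 / real (j + 2)"

lemma radius: "0 \<le> radius j" "radius j < 1"
  by (auto simp: radius_def)

lemma radius_tendsto: "radius \<longlonglongrightarrow> 1"
  using tendsto_diff[OF tendsto_const LIMSEQ_ignore_initial_segment[OF lim_1_over_n, of 2], of "1::real"]
  by (simp add: radius_def[abs_def])

lemma radius_at_left: "filterlim radius (at_left 1) sequentially"
  using radius_tendsto radius(2) by (auto simp: filterlim_at less_imp_neq)

lemma circle_ip_szego_limit:
  assumes f: "f holomorphic_on unit_disk" and w: "w \<in> unit_disk"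
  shows "(\<lambda>j. circle_ip (radius j) f (szego w)) \<longlonglongrightarrow> f w"
proof -
  have "isCont f w" using f w holomorphic_on_imp_continuous_on continuous_on_interior[of unit_disk f w] by auto
  moreover have "(\<lambda>j. of_real ((radius j)\<^sup>2) * w) \<longlonglongrightarrow> of_real (1\<^sup>2) * w"
    by (intro tendsto_intros radius_tendsto)
  ultimately have "(\<lambda>j. f (of_real ((radius j)\<^sup>2) * w)) \<longlonglongrightarrow> f w"
    by (intro isCont_tendsto_compose[of w f]) auto
  then show ?thesis using circle_ip_szego[OF f w radius] by simp
qed

text \<open>
  The three means combine to that of \<open>(|a|\<^sup>2 + |B|\<^sup>2 - 1) X cnj Y\<close>, which is bounded and tends
  to zero along almost every radius.
\<close>

lemma Pythagoras_limit:
  fixes a B X Y :: "complex \<Rightarrow> complex"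
  assumes hol: "a holomorphic_on unit_disk" "B holomorphic_on unit_disk"
      "X holomorphic_on unit_disk" "Y holomorphic_on unit_disk"
    and bd: "\<And>z. z \<in> unit_disk \<Longrightarrow> cmod (a z) \<le> K" "\<And>z. z \<in> unit_disk \<Longrightarrow> cmod (B z) \<le> K"
      "\<And>z. z \<in> unit_disk \<Longrightarrow> cmod (X z) \<le> K" "\<And>z. z \<in> unit_disk \<Longrightarrow> cmod (Y z) \<le> K"
    and ae: "AE t in angle. ((\<lambda>r. (cmod (a (of_real r * cis t)))\<^sup>2 + (cmod (B (of_real r * cis t)))\<^sup>2) \<longlongrightarrow> 1) (at_left 1)"
  shows "(\<lambda>j. circle_ip (radius j) (\<lambda>z. B z * X z) (\<lambda>z. B z * Y z) + circle_ip (radius j) (\<lambda>z. a z * X z) (\<lambda>z. a z * Y z)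
            - circle_ip (radius j) X Y) \<longlonglongrightarrow> 0"
proof -
  define D where "D z = (of_real ((cmod (a z))\<^sup>2 + (cmod (B z))\<^sup>2 - 1) * (X z * cnj (Y z)))" for z
  have K: "0 \<le> K" using bd(1)[of 0] norm_ge_zero[of "a 0"] by (simp del: norm_ge_zero)
  have Dbd: "cmod (D z) \<le> (K\<^sup>2 + K\<^sup>2 + 1) * (K * K)" if "z \<in> unit_disk" for z
  proof -
    have "\<bar>(cmod (a z))\<^sup>2 + (cmod (B z))\<^sup>2 - 1\<bar> \<le> K\<^sup>2 + K\<^sup>2 + 1"
      using power_mono[OF bd(1)[OF that] norm_ge_zero, of 2] power_mono[OF bd(2)[OF that] norm_ge_zero, of 2]
        zero_le_power2[of "cmod (a z)"] zero_le_power2[of "cmod (B z)"] zero_le_power2[of K]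
      by (intro abs_leI; linarith)
    moreover have "cmod (X z * cnj (Y z)) \<le> K * K"
      using bd(3,4)[OF that] K by (auto simp: norm_mult intro!: mult_mono)
    ultimately show ?thesis
      unfolding D_def by (subst norm_mult, subst norm_of_real, intro mult_mono) auto
  qed
  have eq: "circle_ip (radius j) (\<lambda>z. B z * X z) (\<lambda>z. B z * Y z) + circle_ip (radius j) (\<lambda>z. a z * X z) (\<lambda>z. a z * Y z)
            - circle_ip (radius j) X Y = (\<integral>t. D (of_real (radius j) * cis t) \<partial>angle)" for j
    unfolding circle_ip_def
    by (subst Bochner_Integration.integral_add[symmetric], (intro circle_ip_integrable holomorphic_intros hol radius)+,
        subst Bochner_Integration.integral_diff[symmetric],
        (intro Bochner_Integration.integrable_add circle_ip_integrable holomorphic_intros hol radius)+)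
       (simp add: D_def complex_norm_square algebra_simps del: of_real_power)
  have "(\<lambda>j. \<integral>t. D (of_real (radius j) * cis t) \<partial>angle) \<longlonglongrightarrow> (\<integral>t. 0 \<partial>angle)"
  proof (rule integral_dominated_convergence[of _ _ _ "\<lambda>_. (K\<^sup>2 + K\<^sup>2 + 1) * (K * K)"])
    show "(\<lambda>t. D (of_real (radius j) * cis t)) \<in> borel_measurable angle" for j
      unfolding D_def
      by (subst measurable_cong_sets[OF sets_angle refl],
          intro borel_measurable_continuous_onI continuous_intros circle_continuous hol radius)
    show "AE t in angle. cmod (D (of_real (radius j) * cis t)) \<le> (K\<^sup>2 + K\<^sup>2 + 1) * (K * K)" for j
      using Dbd[OF on_disk[OF radius]] by simp
    show "AE t in angle. (\<lambda>j. D (of_real (radius j) * cis t)) \<longlonglongrightarrow> 0"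
      using ae
    proof eventually_elim
      case (elim t)
      define s where "s j = (cmod (a (of_real (radius j) * cis t)))\<^sup>2 + (cmod (B (of_real (radius j) * cis t)))\<^sup>2" for j
      have "s \<longlonglongrightarrow> 1" unfolding s_def by (rule filterlim_compose[OF elim radius_at_left])
      then have "(\<lambda>j. \<bar>s j - 1\<bar> * (K * K)) \<longlonglongrightarrow> \<bar>1 - 1\<bar> * (K * K)"
        by (intro tendsto_intros)
      then have lim: "(\<lambda>j. \<bar>s j - 1\<bar> * (K * K)) \<longlonglongrightarrow> 0" by simp
      have "cmod (D (of_real (radius j) * cis t)) \<le> \<bar>s j - 1\<bar> * (K * K)" for j
        unfolding D_def s_def norm_mult norm_of_real complex_mod_cnj
        by (intro mult_left_mono mult_mono bd on_disk radius K norm_ge_zero) simp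
      then have "\<forall>\<^sub>F j in sequentially. cmod (D (of_real (radius j) * cis t)) \<le> \<bar>s j - 1\<bar> * (K * K)" by simp
      then show ?case by (rule Lim_null_comparison[OF _ lim])
    qed
  qed auto
  then show ?thesis unfolding eq by simp
qed

section \<open>Pairs of functions that represent elements of the space\<close>

text \<open>
  The geometric mean is the infimum of the weighted arithmetic means; the perturbation \<open>d\<close> in
  the proof covers \<open>N = 0\<close>.
\<close>

lemma le_mult_of_young:
  fixes l M N :: real
  assumes "0 \<le> M" "0 \<le> N" and le: "\<And>s. 0 < s \<Longrightarrow> l \<le> (s * M\<^sup>2 + N\<^sup>2 / s) / 2"
  shows "l \<le> M * N"
proof (rule field_le_epsilon)
  fix e :: real assume e: "0 < e"
  define d where "d = e / (M + N + 1)"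
  have d: "0 < d" using assms e by (simp add: d_def)
  have "M * (N + d) \<le> M * N + e"
  proof -
    have "M * d \<le> (M + N + 1) * d" using assms d by (intro mult_right_mono) auto
    also have "\<dots> = e" using assms by (simp add: d_def)
    finally show ?thesis by (simp add: algebra_simps)
  qed
  moreover have "l \<le> M * (N + d)"
  proof (cases "M = 0")
    case True
    have "l \<le> 0"
    proof (rule field_le_epsilon)
      fix u :: real assume u: "0 < u"
      have "l \<le> N\<^sup>2 / ((N\<^sup>2 + 1) / u) / 2" using le[of "(N\<^sup>2 + 1) / u"] u True by (simp add: add_nonneg_pos)
      also have "\<dots> = u * (N\<^sup>2 / (N\<^sup>2 + 1)) / 2" by simp
      also have "\<dots> \<le> u * 1 / 2" using u divide_le_eq_1_pos[of "N\<^sup>2 + 1" "N\<^sup>2"]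
        by (intro divide_right_mono mult_left_mono) (auto simp: add_nonneg_pos)
      finally show "l \<le> 0 + u" using u by simp
    qed
    then show ?thesis using True by simp
  next
    case False
    then have M: "0 < M" using assms by simp
    define s where "s = (N + d) / M"
    have s: "0 < s" using M d assms by (simp add: s_def)
    have "l \<le> (s * M\<^sup>2 + N\<^sup>2 / s) / 2" by (rule le[OF s])
    also have "\<dots> \<le> (s * M\<^sup>2 + (N + d)\<^sup>2 / s) / 2"
      using s d assms by (intro divide_right_mono add_left_mono power_mono) auto
    also have "\<dots> = M * (N + d)"
    proof -
      have "s * M\<^sup>2 = M * (N + d)" using M by (simp add: s_def power2_eq_square)
      moreover have "(N + d)\<^sup>2 / s = M * (N + d)"
        using M d assms(2) by (simp add: s_def power2_eq_square)
      ultimately show ?thesis by simp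
    qed
    finally show ?thesis .
  qed
  ultimately show "l \<le> M * N + e" by simp
qed

text \<open>
  The mate condition is recorded in the only form in which it is used, as the limit of
  \<open>|a|\<^sup>2 + |B|\<^sup>2\<close> along almost every radius.
\<close>

locale mate_pair = de_branges_rovnyak B H ip
  for B :: "complex \<Rightarrow> complex" and H :: "(complex \<Rightarrow> complex) set"
    and ip :: "(complex \<Rightarrow> complex) \<Rightarrow> (complex \<Rightarrow> complex) \<Rightarrow> complex" +
  fixes a :: "complex \<Rightarrow> complex" and K :: real
  assumes a_hol: "a holomorphic_on unit_disk" and B_hol: "B holomorphic_on unit_disk"
    and a_bd: "z \<in> unit_disk \<Longrightarrow> cmod (a z) \<le> K" and B_bd: "z \<in> unit_disk \<Longrightarrow> cmod (B z) \<le> 1"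
    and mate: "AE t in angle.
      ((\<lambda>r. (cmod (a (of_real r * cis t)))\<^sup>2 + (cmod (B (of_real r * cis t)))\<^sup>2) \<longlongrightarrow> 1) (at_left 1)"
begin

lemma bounded_times:
  assumes "z \<in> unit_disk \<Longrightarrow> cmod (X z) \<le> L" "z \<in> unit_disk"
  shows "cmod (B z * X z) \<le> L"
  using assms mult_mono[OF B_bd[of z] assms(1)] norm_ge_zero[of "X z"] by (simp add: norm_mult)

lemma mate_limit:
  assumes X: "X holomorphic_on unit_disk" "\<And>z. z \<in> unit_disk \<Longrightarrow> cmod (X z) \<le> L"
    and Y: "Y holomorphic_on unit_disk" "\<And>z. z \<in> unit_disk \<Longrightarrow> cmod (Y z) \<le> L"
  shows "(\<lambda>j. circle_ip (radius j) (\<lambda>z. B z * X z) (\<lambda>z. B z * Y z) + circle_ip (radius j) (\<lambda>z. a z * X z) (\<lambda>z. a z * Y z)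
            - circle_ip (radius j) X Y) \<longlonglongrightarrow> 0"
proof (rule Pythagoras_limit[OF a_hol B_hol X(1) Y(1) _ _ _ _ mate])
  fix z :: complex assume z: "z \<in> unit_disk"
  show "cmod (a z) \<le> max K (max 1 L)" "cmod (B z) \<le> max K (max 1 L)"
    "cmod (X z) \<le> max K (max 1 L)" "cmod (Y z) \<le> max K (max 1 L)"
    using a_bd[OF z] B_bd[OF z] X(2)[OF z] Y(2)[OF z] by linarith+
qed

lemma kernel_on_disk:
  "z \<in> unit_disk \<Longrightarrow> dbr_kernel B w z = szego w z + (- cnj (B w)) * (B z * szego w z)"
  by (simp add: dbr_kernel_def szego_def diff_divide_distrib)

text \<open>
  The kernel at \<open>w\<close> without the cut-off outside the disk, written in terms of the Szego kernel.
\<close>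

definition kernel_ext :: "complex \<Rightarrow> complex \<Rightarrow> complex" where
  "kernel_ext w z = szego w z + (- cnj (B w)) * (B z * szego w z)"

text \<open>
  The second component of the pair that the kernel at \<open>w\<close> is mapped to. The first component is
  the kernel itself.
\<close>

definition mate_part :: "complex \<Rightarrow> complex \<Rightarrow> complex" where
  "mate_part w z = cnj (B w) * (a z * szego w z)"

lemma kernel_ext_hol: "w \<in> unit_disk \<Longrightarrow> kernel_ext w holomorphic_on unit_disk"
  unfolding kernel_ext_def by (intro holomorphic_intros B_hol szego_holomorphic)

lemma kernel_hol: "w \<in> unit_disk \<Longrightarrow> dbr_kernel B w holomorphic_on unit_disk"
  using holomorphic_transform[OF kernel_ext_hol] kernel_on_disk unfolding kernel_ext_def by metis

lemma mate_part_hol: "w \<in> unit_disk \<Longrightarrow> mate_part w holomorphic_on unit_disk"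
  unfolding mate_part_def by (intro holomorphic_intros a_hol szego_holomorphic)

lemma circle_ip_kernel_ext_left:
  assumes w: "w \<in> unit_disk" and g: "g holomorphic_on unit_disk"
  shows "circle_ip (radius j) (kernel_ext w) g = circle_ip (radius j) (szego w) g - cnj (B w) * circle_ip (radius j) (\<lambda>z. B z * szego w z) g"
proof -
  have "circle_ip (radius j) (kernel_ext w) g = circle_ip (radius j) (szego w) g + circle_ip (radius j) (\<lambda>z. (- cnj (B w)) * (B z * szego w z)) g"
    unfolding kernel_ext_def[abs_def]
    by (rule circle_ip_add) (intro holomorphic_intros B_hol szego_holomorphic w g radius)+
  then show ?thesis unfolding circle_ip_scale by simp
qed

lemma circle_ip_kernel_ext_right:
  assumes w: "w \<in> unit_disk" and g: "g holomorphic_on unit_disk"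
  shows "circle_ip (radius j) g (kernel_ext w) = circle_ip (radius j) g (szego w) - B w * circle_ip (radius j) g (\<lambda>z. B z * szego w z)"
  using circle_ip_kernel_ext_left[OF w g, of j] circle_ip_cnj[of "radius j" "kernel_ext w" g] circle_ip_cnj[of "radius j" "szego w" g]
    circle_ip_cnj[of "radius j" "\<lambda>z. B z * szego w z" g]
  by (metis complex_cnj_cnj complex_cnj_diff complex_cnj_mult)

definition mate_comb :: "(complex \<times> complex) list \<Rightarrow> complex \<Rightarrow> complex" where
  "mate_comb xs z = (\<Sum>(c, w)\<leftarrow>xs. c * mate_part w z)"

lemma mate_comb_Nil: "mate_comb [] = (\<lambda>_. 0)"
  by (simp add: mate_comb_def fun_eq_iff)

lemma mate_comb_Cons: "mate_comb ((c, w) # xs) = (\<lambda>z. c * mate_part w z + mate_comb xs z)"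
  by (simp add: mate_comb_def fun_eq_iff)

lemma kernel_comb_hol: "nodes xs \<Longrightarrow> kernel_comb xs holomorphic_on unit_disk"
  by (induction xs) (auto simp: kernel_comb_Nil kernel_comb_Cons intro!: holomorphic_intros kernel_hol)

lemma mate_comb_hol: "nodes xs \<Longrightarrow> mate_comb xs holomorphic_on unit_disk"
  by (induction xs) (auto simp: mate_comb_Nil mate_comb_Cons intro!: holomorphic_intros mate_part_hol)

text \<open>
  The inner product of two pairs of Hardy functions at the radius \<open>radius j\<close>.
\<close>

definition pair_ip :: "nat \<Rightarrow> (complex \<Rightarrow> complex) \<Rightarrow> (complex \<Rightarrow> complex) \<Rightarrow> (complex \<Rightarrow> complex) \<Rightarrow> (complex \<Rightarrow> complex) \<Rightarrow> complex" where
  "pair_ip j x y g h = circle_ip (radius j) x g + circle_ip (radius j) y h"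

lemma pair_ip_Cons_left:
  assumes "w \<in> unit_disk" "nodes xs" "g holomorphic_on unit_disk" "h holomorphic_on unit_disk"
  shows "pair_ip j (kernel_comb ((c, w) # xs)) (mate_comb ((c, w) # xs)) g h =
    c * pair_ip j (dbr_kernel B w) (mate_part w) g h + pair_ip j (kernel_comb xs) (mate_comb xs) g h"
  unfolding pair_ip_def kernel_comb_Cons mate_comb_Cons
  using assms
  by (simp add: circle_ip_add circle_ip_scale radius kernel_hol mate_part_hol kernel_comb_hol mate_comb_hol holomorphic_on_mult algebra_simps)

lemma pair_ip_Cons_right:
  assumes "w \<in> unit_disk" "nodes xs" "x holomorphic_on unit_disk" "y holomorphic_on unit_disk"
  shows "pair_ip j x y (kernel_comb ((c, w) # xs)) (mate_comb ((c, w) # xs)) =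
    cnj c * pair_ip j x y (dbr_kernel B w) (mate_part w) + pair_ip j x y (kernel_comb xs) (mate_comb xs)"
  unfolding pair_ip_def kernel_comb_Cons mate_comb_Cons
  using assms
  by (simp add: circle_ip_add_right circle_ip_scale_right radius kernel_hol mate_part_hol kernel_comb_hol mate_comb_hol holomorphic_on_mult algebra_simps)

lemma pair_ip_Nil: "pair_ip j (kernel_comb []) (mate_comb []) g h = 0" "pair_ip j x y (kernel_comb []) (mate_comb []) = 0"
  by (simp_all add: pair_ip_def kernel_comb_Nil mate_comb_Nil circle_ip_def)

text \<open>
  The map from kernels to pairs is isometric. Expanding the first components gives four means,
  and the one of \<open>B k\<close> against \<open>B k\<close> combines with the second components by the mate condition.
\<close>

lemma kernel_pair_limit:
  assumes w: "w \<in> unit_disk" and v: "v \<in> unit_disk"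
  shows "(\<lambda>j. pair_ip j (dbr_kernel B w) (mate_part w) (dbr_kernel B v) (mate_part v)) \<longlonglongrightarrow> dbr_kernel B w v"
proof -
  note hol = holomorphic_intros B_hol a_hol szego_holomorphic[OF w] szego_holomorphic[OF v]
  define L where "L = max (1 / (1 - cmod w)) (1 / (1 - cmod v))"
  have Lw: "cmod (szego w z) \<le> L" and Lv: "cmod (szego v z) \<le> L" if "z \<in> unit_disk" for z
    using szego_bound[OF w that] szego_bound[OF v that] by (auto simp: L_def)
  define R where "R j = circle_ip (radius j) (\<lambda>z. B z * szego w z) (\<lambda>z. B z * szego v z) +
      circle_ip (radius j) (\<lambda>z. a z * szego w z) (\<lambda>z. a z * szego v z) - circle_ip (radius j) (szego w) (szego v)" for j
  have R: "R \<longlonglongrightarrow> 0" unfolding R_def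
    by (rule mate_limit) (use Lw Lv szego_holomorphic w v in auto)
  have expand: "pair_ip j (dbr_kernel B w) (mate_part w) (dbr_kernel B v) (mate_part v) =
     circle_ip (radius j) (szego w) (szego v) - cnj (B w) * circle_ip (radius j) (\<lambda>z. B z * szego w z) (szego v)
     - B v * cnj (circle_ip (radius j) (\<lambda>z. B z * szego v z) (szego w))
     + cnj (B w) * B v * (circle_ip (radius j) (szego w) (szego v) + R j)" for j
  proof -
    have "circle_ip (radius j) (dbr_kernel B w) (dbr_kernel B v) = circle_ip (radius j) (kernel_ext w) (kernel_ext v)"
      by (rule circle_ip_cong[OF _ _ radius]) (simp_all add: kernel_ext_def kernel_on_disk)
    also have "\<dots> = circle_ip (radius j) (szego w) (kernel_ext v) - cnj (B w) * circle_ip (radius j) (\<lambda>z. B z * szego w z) (kernel_ext v)"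
      by (rule circle_ip_kernel_ext_left[OF w kernel_ext_hol[OF v]])
    also have "circle_ip (radius j) (szego w) (kernel_ext v) = circle_ip (radius j) (szego w) (szego v) - B v * circle_ip (radius j) (szego w) (\<lambda>z. B z * szego v z)"
      by (rule circle_ip_kernel_ext_right[OF v szego_holomorphic[OF w]])
    also have "circle_ip (radius j) (\<lambda>z. B z * szego w z) (kernel_ext v) = circle_ip (radius j) (\<lambda>z. B z * szego w z) (szego v)
        - B v * circle_ip (radius j) (\<lambda>z. B z * szego w z) (\<lambda>z. B z * szego v z)"
      by (rule circle_ip_kernel_ext_right[OF v]) (intro hol)
    also have "circle_ip (radius j) (szego w) (\<lambda>z. B z * szego v z) = cnj (circle_ip (radius j) (\<lambda>z. B z * szego v z) (szego w))"
      by (rule circle_ip_cnj)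
    finally show ?thesis
      unfolding pair_ip_def mate_part_def[abs_def] circle_ip_scale circle_ip_scale_right R_def by (simp add: algebra_simps)
  qed
  have l1: "(\<lambda>j. circle_ip (radius j) (szego w) (szego v)) \<longlonglongrightarrow> szego w v"
    by (rule circle_ip_szego_limit[OF szego_holomorphic[OF w] v])
  have l2: "(\<lambda>j. circle_ip (radius j) (\<lambda>z. B z * szego w z) (szego v)) \<longlonglongrightarrow> B v * szego w v"
    by (rule circle_ip_szego_limit[OF _ v]) (intro hol)
  have l3: "(\<lambda>j. circle_ip (radius j) (\<lambda>z. B z * szego v z) (szego w)) \<longlonglongrightarrow> B w * szego v w"
    by (rule circle_ip_szego_limit[OF _ w]) (intro hol)
  have "(\<lambda>j. pair_ip j (dbr_kernel B w) (mate_part w) (dbr_kernel B v) (mate_part v)) \<longlonglongrightarrow>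
     szego w v - cnj (B w) * (B v * szego w v) - B v * cnj (B w * szego v w) + cnj (B w) * B v * (szego w v + 0)"
    unfolding expand by (intro tendsto_intros l1 l2 l3 R)
  also have "szego w v - cnj (B w) * (B v * szego w v) - B v * cnj (B w * szego v w) + cnj (B w) * B v * (szego w v + 0)
     = dbr_kernel B w v"
    unfolding kernel_on_disk[OF v] by (simp add: szego_def mult.commute)
  finally show ?thesis .
qed

lemma comb_pair_limit:
  assumes xs: "nodes xs" and ys: "nodes ys"
  shows "(\<lambda>j. pair_ip j (kernel_comb xs) (mate_comb xs) (kernel_comb ys) (mate_comb ys)) \<longlonglongrightarrow> ip (kernel_comb xs) (kernel_comb ys)"
  using xs
proof (induction xs)
  case Nil
  then show ?case using kernel_comb_mem[OF ys] unfolding pair_ip_Nil by (simp add: kernel_comb_Nil ip_zero_left)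
next
  case (Cons p xs)
  obtain c w where p: "p = (c, w)" by force
  have w: "w \<in> unit_disk" and n: "nodes xs" using Cons.prems p by auto
  have ker: "(\<lambda>j. pair_ip j (dbr_kernel B w) (mate_part w) (kernel_comb ys) (mate_comb ys)) \<longlonglongrightarrow> ip (dbr_kernel B w) (kernel_comb ys)"
    using ys
  proof (induction ys)
    case Nil
    then show ?case using kernel_mem[OF w] unfolding pair_ip_Nil by (simp add: kernel_comb_Nil ip_zero_right)
  next
    case (Cons q ys)
    obtain d v where q: "q = (d, v)" by force
    have v: "v \<in> unit_disk" and m: "nodes ys" using Cons.prems q by auto
    have "ip (dbr_kernel B w) (kernel_comb ((d, v) # ys)) = cnj d * dbr_kernel B w v + ip (dbr_kernel B w) (kernel_comb ys)"
      unfolding kernel_comb_Cons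
      using kernel_mem[OF w] kernel_mem[OF v] kernel_comb_mem[OF m] reproducing[OF v kernel_mem[OF w]]
      by (simp add: ip_add_right scale_mem ip_scale_right)
    then show ?case
      unfolding q pair_ip_Cons_right[OF v m kernel_hol[OF w] mate_part_hol[OF w]]
      by (simp only:) (intro tendsto_intros kernel_pair_limit w v Cons.IH m)
  qed
  have "ip (kernel_comb ((c, w) # xs)) (kernel_comb ys) = c * ip (dbr_kernel B w) (kernel_comb ys) + ip (kernel_comb xs) (kernel_comb ys)"
    unfolding kernel_comb_Cons
    using kernel_mem[OF w] kernel_comb_mem[OF ys] kernel_comb_mem[OF n] by (simp add: ip_add scale_mem ip_scale)
  then show ?case
    unfolding p pair_ip_Cons_left[OF w n kernel_comb_hol[OF ys] mate_comb_hol[OF ys]]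
    by (simp only:) (intro tendsto_intros ker Cons.IH n)
qed

lemma comb_norm_limit:
  assumes xs: "nodes xs"
  shows "(\<lambda>j. circle_sq (radius j) (kernel_comb xs) + circle_sq (radius j) (mate_comb xs)) \<longlonglongrightarrow> (ip_norm ip (kernel_comb xs))\<^sup>2"
proof -
  have "(\<lambda>j. complex_of_real (circle_sq (radius j) (kernel_comb xs) + circle_sq (radius j) (mate_comb xs))) \<longlonglongrightarrow> of_real ((ip_norm ip (kernel_comb xs))\<^sup>2)"
    using comb_pair_limit[OF xs xs] unfolding pair_ip_def circle_ip_self ip_self[OF kernel_comb_mem[OF xs]] by simp
  then show ?thesis by (rule tendsto_of_real_iff[THEN iffD1])
qed

text \<open>
  Pairing \<open>(x, y)\<close> with the pairs of kernels evaluates \<open>f\<close>, and the pairs are an isometric image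
  of the kernels, so the Cauchy-Schwarz inequality for pairs is the hypothesis of \<open>represented\<close>.
\<close>

lemma pair_represents:
  assumes x: "x holomorphic_on unit_disk" and y: "y holomorphic_on unit_disk"
    and M: "0 \<le> M" and bd: "\<And>j. circle_sq (radius j) x + circle_sq (radius j) y \<le> M\<^sup>2"
    and f0: "\<And>z. z \<notin> unit_disk \<Longrightarrow> f z = 0"
    and f: "\<And>w. w \<in> unit_disk \<Longrightarrow> (\<lambda>j. pair_ip j x y (dbr_kernel B w) (mate_part w)) \<longlonglongrightarrow> f w"
  shows "f \<in> H" "ip_norm ip f \<le> M"
proof -
  have lim: "(\<lambda>j. pair_ip j x y (kernel_comb xs) (mate_comb xs)) \<longlonglongrightarrow> (\<Sum>(c, w)\<leftarrow>xs. cnj c * f w)" if "nodes xs" for xs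
    using that
  proof (induction xs)
    case (Cons p xs)
    obtain c w where p: "p = (c, w)" by force
    have w: "w \<in> unit_disk" and n: "nodes xs" using Cons.prems p by auto
    show ?case
      unfolding p pair_ip_Cons_right[OF w n x y]
      by (simp only: list.map sum_list.Cons prod.case) (intro tendsto_intros f w Cons.IH n)
  qed (simp add: pair_ip_Nil)
  have key: "cmod (\<Sum>(c, w)\<leftarrow>xs. cnj c * f w) \<le> M * ip_norm ip (kernel_comb xs)" if n: "nodes xs" for xs
  proof (rule le_mult_of_young[OF M ip_norm_nonneg[OF kernel_comb_mem[OF n]]])
    fix s :: real assume s: "0 < s"
    have "cmod (pair_ip j x y (kernel_comb xs) (mate_comb xs)) \<le> (s * M\<^sup>2 + (circle_sq (radius j) (kernel_comb xs) + circle_sq (radius j) (mate_comb xs)) / s) / 2" for j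
    proof -
      have "cmod (pair_ip j x y (kernel_comb xs) (mate_comb xs)) \<le> cmod (circle_ip (radius j) x (kernel_comb xs)) + cmod (circle_ip (radius j) y (mate_comb xs))"
        unfolding pair_ip_def by (rule norm_triangle_ineq)
      also have "\<dots> \<le> (s * circle_sq (radius j) x + circle_sq (radius j) (kernel_comb xs) / s) / 2 + (s * circle_sq (radius j) y + circle_sq (radius j) (mate_comb xs) / s) / 2"
        by (intro add_mono circle_ip_young x y kernel_comb_hol mate_comb_hol n radius s)
      also have "\<dots> = (s * (circle_sq (radius j) x + circle_sq (radius j) y) + (circle_sq (radius j) (kernel_comb xs) + circle_sq (radius j) (mate_comb xs)) / s) / 2"
        by (simp add: algebra_simps add_divide_distrib)
      also have "\<dots> \<le> (s * M\<^sup>2 + (circle_sq (radius j) (kernel_comb xs) + circle_sq (radius j) (mate_comb xs)) / s) / 2"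
        using s bd[of j] by (intro divide_right_mono add_right_mono mult_left_mono) auto
      finally show ?thesis .
    qed
    moreover have "(\<lambda>j. (s * M\<^sup>2 + (circle_sq (radius j) (kernel_comb xs) + circle_sq (radius j) (mate_comb xs)) / s) / 2) \<longlonglongrightarrow>
        (s * M\<^sup>2 + (ip_norm ip (kernel_comb xs))\<^sup>2 / s) / 2"
      using s by (intro tendsto_intros comb_norm_limit n) auto
    ultimately show "cmod (\<Sum>(c, w)\<leftarrow>xs. cnj c * f w) \<le> (s * M\<^sup>2 + (ip_norm ip (kernel_comb xs))\<^sup>2 / s) / 2"
      by (intro LIMSEQ_le[OF tendsto_norm[OF lim[OF n]]]) auto
  qed
  show "f \<in> H" "ip_norm ip f \<le> M" using represented[OF f0 M key] by blast+
qed

text \<open>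
  The hypothesis of \<open>represented\<close> is preserved under pointwise limits, so balls of the space are
  closed under them.
\<close>

lemma bounded_limit_mem:
  assumes F: "\<And>n. F n \<in> H" "\<And>n. ip_norm ip (F n) \<le> M"
    and f0: "\<And>z. z \<notin> unit_disk \<Longrightarrow> f z = 0"
    and f: "\<And>w. w \<in> unit_disk \<Longrightarrow> (\<lambda>n. F n w) \<longlonglongrightarrow> f w"
  shows "f \<in> H" "ip_norm ip f \<le> M"
proof -
  have M: "0 \<le> M" using ip_norm_nonneg[OF F(1)] F(2) order_trans by blast
  have key: "cmod (\<Sum>(c, w)\<leftarrow>xs. cnj c * f w) \<le> M * ip_norm ip (kernel_comb xs)" if n: "nodes xs" for xs
  proof -
    have lim: "(\<lambda>n. (\<Sum>(c, w)\<leftarrow>xs. cnj c * F n w)) \<longlonglongrightarrow> (\<Sum>(c, w)\<leftarrow>xs. cnj c * f w)"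
      using n by (induction xs) (auto intro!: tendsto_intros f)
    have "cmod (\<Sum>(c, w)\<leftarrow>xs. cnj c * F m w) \<le> M * ip_norm ip (kernel_comb xs)" for m
    proof -
      have "cmod (\<Sum>(c, w)\<leftarrow>xs. cnj c * F m w) \<le> ip_norm ip (F m) * ip_norm ip (kernel_comb xs)"
        unfolding ip_kernel_comb_right[OF n F(1), symmetric] by (rule Cauchy_Schwarz[OF F(1) kernel_comb_mem[OF n]])
      also have "\<dots> \<le> M * ip_norm ip (kernel_comb xs)"
        by (intro mult_right_mono F ip_norm_nonneg kernel_comb_mem n)
      finally show ?thesis .
    qed
    then show ?thesis by (intro LIMSEQ_le_const2[OF tendsto_norm[OF lim]]) auto
  qed
  show "f \<in> H" "ip_norm ip f \<le> M" using represented[OF f0 M key] by blast+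
qed

lemma approximable:
  assumes f: "f \<in> H"
  obtains xs where "\<And>n::nat. nodes (xs n)" "(\<lambda>n. ip_norm ip (\<lambda>z. kernel_comb (xs n) z - f z)) \<longlonglongrightarrow> 0"
proof -
  have f0: "f z = 0" if "z \<notin> unit_disk" for z using f analytic that by (auto simp: disk_analytic_def)
  have key: "cmod (\<Sum>(c, w)\<leftarrow>xs. cnj c * f w) \<le> ip_norm ip f * ip_norm ip (kernel_comb xs)" if n: "nodes xs" for xs
    unfolding ip_kernel_comb_right[OF n f, symmetric] by (rule Cauchy_Schwarz[OF f kernel_comb_mem[OF n]])
  show ?thesis using represented(2)[OF f0 ip_norm_nonneg[OF f] key] that by blast
qed

lemma mem_hol: "f \<in> H \<Longrightarrow> f holomorphic_on unit_disk"
  using analytic by (auto simp: disk_analytic_def)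

text \<open>
  The means increase with the radius and, together with those of the second component, tend to
  the squared norm.
\<close>

lemma circle_sq_kernel_comb_le:
  assumes n: "nodes xs"
  shows "circle_sq (radius j) (kernel_comb xs) \<le> (ip_norm ip (kernel_comb xs))\<^sup>2"
proof (rule LIMSEQ_le_const[OF comb_norm_limit[OF n]], intro exI[of _ j] allI impI)
  fix m assume "j \<le> m"
  then have "radius j \<le> radius m" by (simp add: radius_def frac_le)
  then have "circle_sq (radius j) (kernel_comb xs) \<le> circle_sq (radius m) (kernel_comb xs)" by (intro circle_sq_mono kernel_comb_hol n radius)
  then show "circle_sq (radius j) (kernel_comb xs) \<le> circle_sq (radius m) (kernel_comb xs) + circle_sq (radius m) (mate_comb xs)"
    using circle_sq_nonneg[of "radius m" "mate_comb xs"] by simp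
qed

lemma kernel_norm_le:
  assumes "w \<in> unit_disk" "cmod w \<le> r" "r < 1"
  shows "ip_norm ip (dbr_kernel B w) \<le> sqrt (2 / (1 - r))"
proof -
  have "(ip_norm ip (dbr_kernel B w))\<^sup>2 \<le> cmod (dbr_kernel B w w)"
    unfolding kernel_diag[OF assms(1)] by (rule complex_Re_le_cmod)
  also have "\<dots> = cmod (1 - cnj (B w) * B w) * cmod (szego w w)"
    using assms by (simp add: dbr_kernel_def szego_def norm_divide)
  also have "\<dots> \<le> 2 * (1 / (1 - r))"
  proof (intro mult_mono)
    have "cmod (cnj (B w) * B w) \<le> 1" using B_bd[OF assms(1)] by (simp add: norm_mult mult_le_one)
    then show "cmod (1 - cnj (B w) * B w) \<le> 2" using norm_triangle_ineq4[of 1 "cnj (B w) * B w"] by simp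
    have "cmod (szego w w) \<le> 1 / (1 - cmod w)" by (rule szego_bound) (use assms in auto)
    also have "\<dots> \<le> 1 / (1 - r)" using assms by (intro frac_le) auto
    finally show "cmod (szego w w) \<le> 1 / (1 - r)" .
  qed auto
  finally show ?thesis by (intro real_le_rsqrt) simp
qed

text \<open>
  The space is contractively contained in the Hardy space: kernels are dense, and norm
  convergence is bounded pointwise convergence on circles.
\<close>

lemma circle_sq_le:
  assumes f: "f \<in> H"
  shows "circle_sq (radius j) f \<le> (ip_norm ip f)\<^sup>2"
proof -
  obtain xs where xs: "\<And>n::nat. nodes (xs n)" and lim: "(\<lambda>n. ip_norm ip (\<lambda>z. kernel_comb (xs n) z - f z)) \<longlonglongrightarrow> 0"
    using approximable[OF f] by blast
  define G where "G n = kernel_comb (xs n)" for n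
  have G: "G n \<in> H" for n by (simp add: G_def kernel_comb_mem xs)
  have dist: "\<bar>ip_norm ip (G n) - ip_norm ip f\<bar> \<le> ip_norm ip (\<lambda>z. G n z - f z)" for n
  proof -
    have "ip_norm ip (G n) \<le> ip_norm ip (\<lambda>z. G n z - f z) + ip_norm ip f"
      using ip_norm_triangle[OF diff_mem[OF G f] f, of n] by simp
    moreover have "ip_norm ip f \<le> ip_norm ip (\<lambda>z. (-1) * (G n z - f z)) + ip_norm ip (G n)"
      using ip_norm_triangle[OF scale_mem[OF diff_mem[OF G[of n] f], of "-1"] G[of n]] by simp
    ultimately show ?thesis
      using ip_norm_scale[OF diff_mem[OF G[of n] f], of "-1"] by simp
  qed
  have "(\<lambda>n. ip_norm ip (G n) - ip_norm ip f) \<longlonglongrightarrow> 0"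
  proof (rule Lim_null_comparison[OF _ lim])
    show "\<forall>\<^sub>F n in sequentially. norm (ip_norm ip (G n) - ip_norm ip f) \<le> ip_norm ip (\<lambda>z. kernel_comb (xs n) z - f z)"
      using dist by (simp add: G_def)
  qed
  then have nG: "(\<lambda>n. ip_norm ip (G n)) \<longlonglongrightarrow> ip_norm ip f" by (simp add: LIM_zero_iff)
  then have "Bseq (\<lambda>n. ip_norm ip (G n))" by (rule convergentI[THEN convergent_imp_Bseq])
  then obtain M where M: "\<And>n. \<bar>ip_norm ip (G n)\<bar> \<le> M" unfolding Bseq_def by auto
  define C where "C = sqrt (2 / (1 - radius j))"
  have pt: "(\<lambda>n. G n w) \<longlonglongrightarrow> f w" if "w \<in> unit_disk" for w
    by (rule norm_limit_pointwise[OF G f _ that]) (use lim in \<open>simp add: G_def\<close>)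
  have "(\<lambda>n. circle_sq (radius j) (G n)) \<longlonglongrightarrow> circle_sq (radius j) f"
    unfolding circle_sq_def
  proof (rule integral_dominated_convergence[of _ _ _ "\<lambda>_. (M * C)\<^sup>2"])
    show "AE t in angle. (\<lambda>n. (cmod (G n (of_real (radius j) * cis t)))\<^sup>2) \<longlonglongrightarrow> (cmod (f (of_real (radius j) * cis t)))\<^sup>2"
      by (intro AE_I2 tendsto_intros pt on_disk radius)
    show "AE t in angle. norm ((cmod (G n (of_real (radius j) * cis t)))\<^sup>2) \<le> (M * C)\<^sup>2" for n
    proof (rule AE_I2)
      fix t
      let ?z = "of_real (radius j) * cis t"
      have z: "?z \<in> unit_disk" by (rule on_disk[OF radius])
      have "cmod (G n ?z) \<le> ip_norm ip (G n) * ip_norm ip (dbr_kernel B ?z)"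
        by (rule eval_bound[OF z G])
      also have "\<dots> \<le> M * C"
      proof (intro mult_mono)
        show "ip_norm ip (dbr_kernel B ?z) \<le> C"
          unfolding C_def using radius by (intro kernel_norm_le z) (auto simp: norm_mult)
        show "ip_norm ip (G n) \<le> M" using M[of n] by simp
        show "0 \<le> M" using M[of 0] by linarith
      qed (intro ip_norm_nonneg kernel_mem z)
      finally show "norm ((cmod (G n ?z))\<^sup>2) \<le> (M * C)\<^sup>2" by (simp add: power_mono)
    qed
    show "(\<lambda>t. (cmod (f (of_real (radius j) * cis t)))\<^sup>2) \<in> borel_measurable angle"
      by (subst measurable_cong_sets[OF sets_angle refl],
          intro borel_measurable_continuous_onI continuous_intros circle_continuous mem_hol f radius)
    show "(\<lambda>t. (cmod (G n (of_real (radius j) * cis t)))\<^sup>2) \<in> borel_measurable angle" for n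
      by (subst measurable_cong_sets[OF sets_angle refl],
          intro borel_measurable_continuous_onI continuous_intros circle_continuous mem_hol G radius)
  qed simp
  then show ?thesis
  proof (rule LIMSEQ_le)
    show "(\<lambda>n. (ip_norm ip (G n))\<^sup>2) \<longlonglongrightarrow> (ip_norm ip f)\<^sup>2" by (intro tendsto_intros nG)
    show "\<exists>N. \<forall>n\<ge>N. circle_sq (radius j) (G n) \<le> (ip_norm ip (G n))\<^sup>2"
      using circle_sq_kernel_comb_le[OF xs] by (auto simp: G_def)
  qed
qed

text \<open>
  Both coefficient sequences are square summable, so the series in Parseval's formula is
  dominated.
\<close>

lemma circle_ip_limit:
  assumes X: "X holomorphic_on unit_disk" and Y: "Y holomorphic_on unit_disk"
    and bd: "\<And>j. circle_sq (radius j) X \<le> M" "\<And>j. circle_sq (radius j) Y \<le> M"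
  shows "convergent (\<lambda>j. circle_ip (radius j) X Y)"
proof -
  have sq: "summable (\<lambda>n. (cmod (taylor Z n))\<^sup>2)" if Z: "Z holomorphic_on unit_disk" and bZ: "\<And>j. circle_sq (radius j) Z \<le> M" for Z
  proof (rule bounded_imp_summable)
    fix n
    have "(\<lambda>j. \<Sum>k\<le>n. (cmod (taylor Z k))\<^sup>2 * radius j ^ (2 * k)) \<longlonglongrightarrow> (\<Sum>k\<le>n. (cmod (taylor Z k))\<^sup>2 * 1 ^ (2 * k))"
      by (intro tendsto_intros radius_tendsto)
    moreover have "(\<Sum>k\<le>n. (cmod (taylor Z k))\<^sup>2 * radius j ^ (2 * k)) \<le> M" for j
    proof -
      have "(\<Sum>k\<le>n. (cmod (taylor Z k))\<^sup>2 * radius j ^ (2 * k)) \<le> circle_sq (radius j) Z"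
        unfolding sums_unique[OF Parseval_sq[OF Z radius]]
        by (intro sum_le_suminf sums_summable[OF Parseval_sq[OF Z radius]]) (auto simp: radius)
      then show ?thesis using bZ[of j] by simp
    qed
    ultimately have "(\<Sum>k\<le>n. (cmod (taylor Z k))\<^sup>2 * 1 ^ (2 * k)) \<le> M"
      by (intro LIMSEQ_le_const2) auto
    then show "(\<Sum>k\<le>n. (cmod (taylor Z k))\<^sup>2) \<le> M" by simp
  qed simp
  define c where "c k = taylor X k * cnj (taylor Y k)" for k
  have "summable (\<lambda>k. cmod (c k))"
  proof (rule summable_comparison_test'[of _ 0])
    show "summable (\<lambda>k. (cmod (taylor X k))\<^sup>2 + (cmod (taylor Y k))\<^sup>2)"
      by (intro summable_add sq X Y bd)
    fix k
    have "0 \<le> (cmod (taylor X k) - cmod (taylor Y k))\<^sup>2" by simp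
    then have "2 * (cmod (taylor X k) * cmod (taylor Y k)) \<le> (cmod (taylor X k))\<^sup>2 + (cmod (taylor Y k))\<^sup>2"
      by (simp add: power2_diff)
    moreover have "0 \<le> cmod (taylor X k) * cmod (taylor Y k)" by simp
    ultimately show "norm (cmod (c k)) \<le> (cmod (taylor X k))\<^sup>2 + (cmod (taylor Y k))\<^sup>2"
      unfolding c_def norm_mult real_norm_def complex_mod_cnj by linarith
  qed
  moreover have "(\<lambda>j. c k * of_real (radius j ^ (2 * k))) \<longlonglongrightarrow> c k * of_real (1 ^ (2 * k))" for k
    by (intro tendsto_intros radius_tendsto)
  moreover have "\<forall>\<^sub>F (k, j) in at_top \<times>\<^sub>F sequentially. norm (c k * of_real (radius j ^ (2 * k))) \<le> cmod (c k)"
    by (intro always_eventually)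
      (auto simp: norm_mult norm_power radius(1) intro!: mult_left_le power_le_one radius(1) less_imp_le[OF radius(2)])
  ultimately have "(\<lambda>j. \<Sum>k. c k * of_real (radius j ^ (2 * k))) \<longlonglongrightarrow> (\<Sum>k. c k * of_real (1 ^ (2 * k)))"
    using tannerys_theorem[of "\<lambda>k j. c k * of_real (radius j ^ (2 * k))" "\<lambda>k. c k * of_real (1 ^ (2 * k))" sequentially "\<lambda>k. cmod (c k)"]
    by simp
  moreover have "(\<Sum>k. c k * of_real (radius j ^ (2 * k))) = circle_ip (radius j) X Y" for j
    using Parseval[OF X Y radius, of j] by (simp add: c_def sums_iff)
  ultimately show ?thesis unfolding convergent_def by auto
qed

lemma circle_ip_Cauchy_Schwarz:
  assumes "X holomorphic_on unit_disk" "Y holomorphic_on unit_disk" "0 \<le> M" "0 \<le> N"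
    and "circle_sq (radius j) X \<le> M\<^sup>2" "circle_sq (radius j) Y \<le> N\<^sup>2"
  shows "cmod (circle_ip (radius j) X Y) \<le> M * N"
proof (rule le_mult_of_young[OF assms(3,4)])
  fix s :: real assume s: "0 < s"
  have "cmod (circle_ip (radius j) X Y) \<le> (s * circle_sq (radius j) X + circle_sq (radius j) Y / s) / 2"
    by (intro circle_ip_young assms radius s)
  also have "\<dots> \<le> (s * M\<^sup>2 + N\<^sup>2 / s) / 2"
    using s assms by (intro divide_right_mono add_mono mult_left_mono) auto
  finally show "cmod (circle_ip (radius j) X Y) \<le> (s * M\<^sup>2 + N\<^sup>2 / s) / 2" .
qed

text \<open>
  The pair \<open>(0, a h)\<close> represents an element \<open>g\<close>: by the mate condition, pairing it with the pair
  of a kernel is the same as pairing \<open>B h\<close> with that kernel. The identity \<open>\<langle>f, B h\<rangle> = ip f g\<close> thus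
  holds for kernels and extends to the space by density and \<open>circle_sq_le\<close>.
\<close>

lemma representer:
  assumes h: "h holomorphic_on unit_disk" and hb: "\<And>z. z \<in> unit_disk \<Longrightarrow> cmod (h z) \<le> L"
    and M: "0 \<le> M" and ah: "\<And>j. circle_sq (radius j) (\<lambda>z. a z * h z) \<le> M\<^sup>2"
  shows "\<exists>g\<in>H. ip_norm ip g \<le> M \<and>
     (\<forall>f\<in>H. (\<lambda>j. circle_ip (radius j) f (\<lambda>z. B z * h z)) \<longlonglongrightarrow> ip f g)"
proof -
  note hol = holomorphic_intros B_hol a_hol szego_holomorphic h
  \<comment> \<open>The value at \<open>w\<close> is the pairing of \<open>B h\<close> with the kernel at \<open>w\<close>.\<close>
  define g where "g w = (if w \<in> unit_disk then lim (\<lambda>j. circle_ip (radius j) (\<lambda>z. B z * h z) (dbr_kernel B w)) else 0)" for w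
  have L: "0 \<le> L" using order_trans[OF norm_ge_zero hb[of 0]] by simp
  have diff: "(\<lambda>j. circle_ip (radius j) (\<lambda>z. B z * h z) (dbr_kernel B w) - pair_ip j (\<lambda>_. 0) (\<lambda>z. a z * h z) (dbr_kernel B w) (mate_part w)) \<longlonglongrightarrow> 0"
    if w: "w \<in> unit_disk" for w
  proof -
    have mate: "(\<lambda>j. circle_ip (radius j) (\<lambda>z. B z * h z) (\<lambda>z. B z * szego w z) + circle_ip (radius j) (\<lambda>z. a z * h z) (\<lambda>z. a z * szego w z)
            - circle_ip (radius j) h (szego w)) \<longlonglongrightarrow> 0"
    proof (rule mate_limit)
      show "cmod (h z) \<le> max L (1 / (1 - cmod w))" "cmod (szego w z) \<le> max L (1 / (1 - cmod w))" if "z \<in> unit_disk" for z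
        using hb[OF that] szego_bound[OF w that] by auto
    qed (intro hol w)+
    have c1: "(\<lambda>j. circle_ip (radius j) (\<lambda>z. B z * h z) (szego w)) \<longlonglongrightarrow> B w * h w"
      by (rule circle_ip_szego_limit[OF _ w]) (intro hol)
    have c2: "(\<lambda>j. circle_ip (radius j) h (szego w)) \<longlonglongrightarrow> h w" by (rule circle_ip_szego_limit[OF h w])
    have eq: "circle_ip (radius j) (\<lambda>z. B z * h z) (dbr_kernel B w) - pair_ip j (\<lambda>_. 0) (\<lambda>z. a z * h z) (dbr_kernel B w) (mate_part w) =
      circle_ip (radius j) (\<lambda>z. B z * h z) (szego w) - B w * circle_ip (radius j) h (szego w) -
       B w * (circle_ip (radius j) (\<lambda>z. B z * h z) (\<lambda>z. B z * szego w z) + circle_ip (radius j) (\<lambda>z. a z * h z) (\<lambda>z. a z * szego w z)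
            - circle_ip (radius j) h (szego w))" for j
    proof -
      have "circle_ip (radius j) (\<lambda>z. B z * h z) (dbr_kernel B w) = circle_ip (radius j) (\<lambda>z. B z * h z) (kernel_ext w)"
        by (rule circle_ip_cong[OF _ _ radius]) (simp_all add: kernel_ext_def kernel_on_disk)
      also have "\<dots> = circle_ip (radius j) (\<lambda>z. B z * h z) (szego w) - B w * circle_ip (radius j) (\<lambda>z. B z * h z) (\<lambda>z. B z * szego w z)"
        by (rule circle_ip_kernel_ext_right[OF w]) (intro hol)
      finally show ?thesis
        unfolding pair_ip_def mate_part_def[abs_def] circle_ip_scale_right by (simp add: circle_ip_def algebra_simps)
    qed
    have "(\<lambda>j. circle_ip (radius j) (\<lambda>z. B z * h z) (dbr_kernel B w) - pair_ip j (\<lambda>_. 0) (\<lambda>z. a z * h z) (dbr_kernel B w) (mate_part w))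
       \<longlonglongrightarrow> B w * h w - B w * h w - B w * 0"
      unfolding eq by (intro tendsto_intros c1 c2 mate)
    then show ?thesis by simp
  qed
  have Bh: "(\<lambda>z. B z * h z) holomorphic_on unit_disk" by (intro hol)
  have circle_sq_Bh: "circle_sq (radius j) (\<lambda>z. B z * h z) \<le> L\<^sup>2" for j
    by (rule circle_sq_bound[OF Bh radius]) (rule bounded_times[of _ h], rule hb)
  have lim: "(\<lambda>j. circle_ip (radius j) (\<lambda>z. B z * h z) (dbr_kernel B w)) \<longlonglongrightarrow> g w" if w: "w \<in> unit_disk" for w
  proof -
    have "convergent (\<lambda>j. circle_ip (radius j) (\<lambda>z. B z * h z) (dbr_kernel B w))"
    proof (rule circle_ip_limit[OF Bh kernel_hol[OF w]])
      show "circle_sq (radius j) (\<lambda>z. B z * h z) \<le> max (L\<^sup>2) ((ip_norm ip (dbr_kernel B w))\<^sup>2)" for j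
        using circle_sq_Bh[of j] by simp
      show "circle_sq (radius j) (dbr_kernel B w) \<le> max (L\<^sup>2) ((ip_norm ip (dbr_kernel B w))\<^sup>2)" for j
        using circle_sq_le[OF kernel_mem[OF w], of j] by simp
    qed
    then show ?thesis using w by (simp add: g_def convergent_LIMSEQ_iff)
  qed
  have gp: "(\<lambda>j. pair_ip j (\<lambda>_. 0) (\<lambda>z. a z * h z) (dbr_kernel B w) (mate_part w)) \<longlonglongrightarrow> g w" if w: "w \<in> unit_disk" for w
    using tendsto_diff[OF lim[OF w] diff[OF w]] by simp
  have ah_hol: "(\<lambda>z. a z * h z) holomorphic_on unit_disk" by (intro hol)
  have ah0: "circle_sq (radius j) (\<lambda>_. 0) + circle_sq (radius j) (\<lambda>z. a z * h z) \<le> M\<^sup>2" for j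
    using ah[of j] by (simp add: circle_sq_def)
  have g0: "g z = 0" if "z \<notin> unit_disk" for z using that unfolding g_def by (rule if_not_P)
  have g: "g \<in> H" "ip_norm ip g \<le> M"
    using pair_represents[OF holomorphic_on_const ah_hol M ah0 g0 gp] by blast+
  have comb: "(\<lambda>j. circle_ip (radius j) (kernel_comb xs) (\<lambda>z. B z * h z)) \<longlonglongrightarrow> ip (kernel_comb xs) g" if "nodes xs" for xs
    using that
  proof (induction xs)
    case Nil
    then show ?case using g by (simp add: kernel_comb_Nil circle_ip_def ip_zero_left)
  next
    case (Cons p xs)
    obtain c w where p: "p = (c, w)" by force
    have w: "w \<in> unit_disk" and n: "nodes xs" using Cons.prems p by auto
    have "(\<lambda>j. cnj (circle_ip (radius j) (\<lambda>z. B z * h z) (dbr_kernel B w))) \<longlonglongrightarrow> cnj (ip g (dbr_kernel B w))"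
      unfolding reproducing[OF w g(1)] by (intro tendsto_intros lim w)
    then have k: "(\<lambda>j. circle_ip (radius j) (dbr_kernel B w) (\<lambda>z. B z * h z)) \<longlonglongrightarrow> ip (dbr_kernel B w) g"
      unfolding circle_ip_cnj[symmetric] ip_cnj[OF g(1) kernel_mem[OF w], symmetric] .
    have "circle_ip (radius j) (kernel_comb ((c, w) # xs)) (\<lambda>z. B z * h z) =
       c * circle_ip (radius j) (dbr_kernel B w) (\<lambda>z. B z * h z) + circle_ip (radius j) (kernel_comb xs) (\<lambda>z. B z * h z)" for j
      unfolding kernel_comb_Cons circle_ip_scale[symmetric]
      by (rule circle_ip_add) (intro holomorphic_intros kernel_hol kernel_comb_hol n w Bh radius)+
    moreover have "ip (kernel_comb ((c, w) # xs)) g = c * ip (dbr_kernel B w) g + ip (kernel_comb xs) g"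
      unfolding kernel_comb_Cons using kernel_mem[OF w] kernel_comb_mem[OF n] g by (simp add: ip_add scale_mem ip_scale)
    ultimately show ?case
      unfolding p by (simp only:) (intro tendsto_intros k Cons.IH n)
  qed
  have "(\<lambda>j. circle_ip (radius j) f (\<lambda>z. B z * h z)) \<longlonglongrightarrow> ip f g" if f: "f \<in> H" for f
  proof (rule LIMSEQ_I)
    fix e :: real assume e: "0 < e"
    obtain xs where xs: "\<And>n::nat. nodes (xs n)" and lm: "(\<lambda>n. ip_norm ip (\<lambda>z. kernel_comb (xs n) z - f z)) \<longlonglongrightarrow> 0"
      using approximable[OF f] by blast
    have "0 < e / (2 * (L + M + 1))" using e L M by simp
    from order_tendstoD(2)[OF lm this] obtain n where
      n: "ip_norm ip (\<lambda>z. kernel_comb (xs n) z - f z) < e / (2 * (L + M + 1))"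
      by (auto simp: eventually_sequentially)
    define G where "G = kernel_comb (xs n)"
    define D where "D = (\<lambda>z. G z - f z)"
    have G: "G \<in> H" unfolding G_def by (rule kernel_comb_mem[OF xs])
    have D: "D \<in> H" unfolding D_def by (rule diff_mem[OF G f])
    have Dn: "ip_norm ip D * (L + M) \<le> e / 2"
    proof -
      have "ip_norm ip D * (L + M) \<le> e / (2 * (L + M + 1)) * (L + M + 1)"
        using n L M ip_norm_nonneg[OF D] e by (intro mult_mono) (auto simp: D_def G_def)
      also have "\<dots> = e / 2"
      proof -
        have "e / (2 * x) * x = e / 2" if "x \<noteq> 0" for x :: real using that by simp
        from this[of "L + M + 1"] show ?thesis using L M by linarith
      qed
      finally show ?thesis .
    qed
    obtain N where N: "\<And>j. N \<le> j \<Longrightarrow> cmod (circle_ip (radius j) G (\<lambda>z. B z * h z) - ip G g) < e / 2"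
      using LIMSEQ_D[OF comb[OF xs[of n]], of "e / 2"] e by (auto simp: G_def)
    have "cmod (circle_ip (radius j) f (\<lambda>z. B z * h z) - ip f g) < e" if j: "N \<le> j" for j
    proof -
      have "circle_ip (radius j) G (\<lambda>z. B z * h z) = circle_ip (radius j) (\<lambda>z. D z + f z) (\<lambda>z. B z * h z)" by (simp add: D_def)
      also have "\<dots> = circle_ip (radius j) D (\<lambda>z. B z * h z) + circle_ip (radius j) f (\<lambda>z. B z * h z)"
        by (intro circle_ip_add mem_hol D f Bh radius)
      finally have 1: "circle_ip (radius j) f (\<lambda>z. B z * h z) = circle_ip (radius j) G (\<lambda>z. B z * h z) - circle_ip (radius j) D (\<lambda>z. B z * h z)" by simp
      have 2: "ip D g = ip G g - ip f g" unfolding D_def by (rule ip_diff_left[OF G f g(1)])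
      have "cmod (circle_ip (radius j) f (\<lambda>z. B z * h z) - ip f g) =
          cmod ((circle_ip (radius j) G (\<lambda>z. B z * h z) - ip G g) + (ip D g - circle_ip (radius j) D (\<lambda>z. B z * h z)))"
        unfolding 1 2 by (simp add: algebra_simps)
      also have "\<dots> \<le> cmod (circle_ip (radius j) G (\<lambda>z. B z * h z) - ip G g) + cmod (ip D g - circle_ip (radius j) D (\<lambda>z. B z * h z))"
        by (rule norm_triangle_ineq)
      also have "cmod (ip D g - circle_ip (radius j) D (\<lambda>z. B z * h z)) \<le> cmod (ip D g) + cmod (circle_ip (radius j) D (\<lambda>z. B z * h z))"
        by (rule norm_triangle_ineq4)
      also have "cmod (ip D g) \<le> ip_norm ip D * M"
        by (rule order_trans[OF Cauchy_Schwarz[OF D g(1)]]) (intro mult_left_mono g ip_norm_nonneg D)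
      also have "cmod (circle_ip (radius j) D (\<lambda>z. B z * h z)) \<le> ip_norm ip D * L"
        by (intro circle_ip_Cauchy_Schwarz mem_hol D Bh ip_norm_nonneg L circle_sq_le circle_sq_Bh)
      finally show ?thesis using N[OF j] Dn by (simp add: algebra_simps)
    qed
    then show "\<exists>N. \<forall>j\<ge>N. norm (circle_ip (radius j) f (\<lambda>z. B z * h z) - ip f g) < e" by blast
  qed
  then show ?thesis using g by blast
qed

end

section \<open>The Dirichlet norm in terms of Taylor coefficients\<close>

lemma measurable_Complex [measurable]: "(\<lambda>(x, y). Complex x y) \<in> borel \<Otimes>\<^sub>M borel \<rightarrow>\<^sub>M borel"
proof -
  have "(\<lambda>p. Complex (fst p) (snd p)) \<in> borel_measurable (borel :: (real \<times> real) measure)"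
    unfolding Complex_eq by (intro borel_measurable_continuous_onI continuous_intros)
  then show ?thesis by (simp add: borel_prod split_beta')
qed

text \<open>
  Lebesgue measure on the complex plane is a product measure, which makes Fubini available in
  Cartesian coordinates.
\<close>

lemma lborel_complex: "(lborel :: complex measure) = distr (lborel \<Otimes>\<^sub>M lborel) borel (\<lambda>(x, y). Complex x y)"
proof (rule lborel_eqI)
  fix l u :: complex
  assume lu: "\<And>b. b \<in> Basis \<Longrightarrow> l \<bullet> b \<le> u \<bullet> b"
  have le: "Re l \<le> Re u" "Im l \<le> Im u" using lu[of 1] lu[of \<i>] by (auto simp: Basis_complex_def)
  have "(\<lambda>(x, y). Complex x y) -` box l u \<inter> space (lborel \<Otimes>\<^sub>M lborel) = {Re l<..<Re u} \<times> {Im l<..<Im u}"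
    by (auto simp: box_def Basis_complex_def space_pair_measure)
  then show "emeasure (distr (lborel \<Otimes>\<^sub>M lborel) borel (\<lambda>(x, y). Complex x y)) (box l u) = ennreal (\<Prod>b\<in>Basis. (u - l) \<bullet> b)"
    using le by (subst emeasure_distr)
      (auto simp: lborel.emeasure_pair_measure_Times Basis_complex_def ennreal_mult)
qed simp

lemma nn_integral_complex:
  fixes F :: "complex \<Rightarrow> ennreal"
  assumes [measurable]: "F \<in> borel_measurable borel"
  shows "(\<integral>\<^sup>+z. F z \<partial>lborel) = (\<integral>\<^sup>+x. \<integral>\<^sup>+y. F (Complex x y) \<partial>lborel \<partial>lborel)"
    and "(\<integral>\<^sup>+z. F z \<partial>lborel) = (\<integral>\<^sup>+y. \<integral>\<^sup>+x. F (Complex x y) \<partial>lborel \<partial>lborel)"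
proof -
  have m: "(\<lambda>(x, y). F (Complex x y)) \<in> borel_measurable (lborel \<Otimes>\<^sub>M lborel)"
    using measurable_compose[OF measurable_Complex assms] by (simp add: split_beta')
  have "(\<integral>\<^sup>+z. F z \<partial>lborel) = (\<integral>\<^sup>+p. (\<lambda>(x, y). F (Complex x y)) p \<partial>(lborel \<Otimes>\<^sub>M lborel))"
    by (subst lborel_complex, subst nn_integral_distr) (auto simp: split_beta')
  also have "\<dots> = (\<integral>\<^sup>+x. \<integral>\<^sup>+y. F (Complex x y) \<partial>lborel \<partial>lborel)"
    using lborel.nn_integral_fst[OF m] by simp
  finally show 1: "(\<integral>\<^sup>+z. F z \<partial>lborel) = (\<integral>\<^sup>+x. \<integral>\<^sup>+y. F (Complex x y) \<partial>lborel \<partial>lborel)" .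
  show "(\<integral>\<^sup>+z. F z \<partial>lborel) = (\<integral>\<^sup>+y. \<integral>\<^sup>+x. F (Complex x y) \<partial>lborel \<partial>lborel)"
    unfolding 1 using lborel_pair.Fubini[of "\<lambda>(x, y). F (Complex x y)"] m by simp
qed

lemma nn_integral_shift:
  fixes F :: "real \<Rightarrow> ennreal"
  assumes "F \<in> borel_measurable borel"
  shows "(\<integral>\<^sup>+x. F (x + t) \<partial>lborel) = (\<integral>\<^sup>+x. F x \<partial>lborel)"
  using nn_integral_real_affine[OF assms, of 1 t] by (simp add: add.commute)

lemma shear_invariance:
  fixes F :: "complex \<Rightarrow> ennreal"
  assumes F [measurable]: "F \<in> borel_measurable borel"
  shows "(\<integral>\<^sup>+z. F (Complex (Re z + k * Im z) (Im z)) \<partial>lborel) = (\<integral>\<^sup>+z. F z \<partial>lborel)"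
    and "(\<integral>\<^sup>+z. F (Complex (Re z) (Im z + k * Re z)) \<partial>lborel) = (\<integral>\<^sup>+z. F z \<partial>lborel)"
proof -
  have c: "(\<lambda>z. Complex (Re z + k * Im z) (Im z)) \<in> borel_measurable borel"
    "(\<lambda>z. Complex (Re z) (Im z + k * Re z)) \<in> borel_measurable borel"
    "(\<lambda>x. Complex x y) \<in> borel_measurable borel" "(\<lambda>y. Complex x y) \<in> borel_measurable borel" for x y
    unfolding Complex_eq by (intro borel_measurable_continuous_onI continuous_intros)+
  note m = measurable_compose[OF c(1) F] measurable_compose[OF c(2) F]
    measurable_compose[OF c(3) F] measurable_compose[OF c(4) F]
  show "(\<integral>\<^sup>+z. F (Complex (Re z + k * Im z) (Im z)) \<partial>lborel) = (\<integral>\<^sup>+z. F z \<partial>lborel)"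
    unfolding nn_integral_complex(2)[OF m(1)] nn_integral_complex(2)[OF F]
    by (simp add: nn_integral_shift[OF m(3)])
  show "(\<integral>\<^sup>+z. F (Complex (Re z) (Im z + k * Re z)) \<partial>lborel) = (\<integral>\<^sup>+z. F z \<partial>lborel)"
    unfolding nn_integral_complex(1)[OF m(2)] nn_integral_complex(1)[OF F]
    by (simp add: nn_integral_shift[OF m(4)])
qed

text \<open>
  A rotation is a product of three shears, and shears preserve Lebesgue measure by Fubini and
  translation invariance. The shear factor \<open>- tan (t / 2)\<close> is undefined for half turns, which
  form a null set of angles.
\<close>

lemma rotation_invariance:
  fixes F :: "complex \<Rightarrow> ennreal"
  assumes F: "F \<in> borel_measurable borel" and t: "cos (t / 2) \<noteq> 0"
  shows "(\<integral>\<^sup>+z. F (cis t * z) \<partial>lborel) = (\<integral>\<^sup>+z. F z \<partial>lborel)"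
proof -
  define k where "k = - tan (t / 2)"
  define X where "X z = Complex (Re z + k * Im z) (Im z)" for z
  define Y where "Y z = Complex (Re z) (Im z + sin t * Re z)" for z
  have mX: "X \<in> borel_measurable borel" and mY: "Y \<in> borel_measurable borel"
    unfolding X_def Y_def Complex_eq by (intro borel_measurable_continuous_onI continuous_intros)+
  have s: "sin t = 2 * sin (t / 2) * cos (t / 2)" and c: "cos t = 1 - 2 * (sin (t / 2))\<^sup>2"
    using sin_double[of "t / 2"] cos_double_sin[of "t / 2"] by simp_all
  have c': "cos t = 2 * (cos (t / 2))\<^sup>2 - 1" using cos_double_cos[of "t / 2"] by simp
  have k1: "1 + k * sin t = cos t" using t unfolding k_def tan_def s c by (simp add: power2_eq_square)
  have k2: "k * (1 + cos t) = - sin t" using t unfolding k_def tan_def s c' by (simp add: power2_eq_square)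
  have k3: "k + k * cos t = - sin t" using k2 by (simp add: algebra_simps)
  have rot: "cis t * z = X (Y (X z))" for z
  proof (rule complex_eqI)
    have "Re (X (Y (X z))) = Re z * (1 + k * sin t) + Im z * (k + k * (1 + k * sin t))"
      by (simp add: X_def Y_def algebra_simps)
    then show "Re (cis t * z) = Re (X (Y (X z)))" unfolding k1 k3 by simp
    have "Im (X (Y (X z))) = sin t * Re z + Im z * (1 + k * sin t)"
      by (simp add: X_def Y_def algebra_simps)
    then show "Im (cis t * z) = Im (X (Y (X z)))" unfolding k1 by simp
  qed
  have "(\<integral>\<^sup>+z. F (X (Y (X z))) \<partial>lborel) = (\<integral>\<^sup>+z. F (X (Y z)) \<partial>lborel)"
    using shear_invariance(1)[OF measurable_compose[OF mY measurable_compose[OF mX F]], of k] by (simp add: X_def)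
  also have "\<dots> = (\<integral>\<^sup>+z. F (X z) \<partial>lborel)"
    using shear_invariance(2)[OF measurable_compose[OF mX F], of "sin t"] by (simp add: Y_def)
  also have "\<dots> = (\<integral>\<^sup>+z. F z \<partial>lborel)"
    using shear_invariance(1)[OF F, of k] by (simp add: X_def)
  finally show ?thesis unfolding rot .
qed

lemma emeasure_disk: "0 \<le> r \<Longrightarrow> emeasure lborel (ball (0::complex) r) = ennreal (pi * r\<^sup>2)"
  by (simp add: emeasure_ball eval_unit_ball_vol)

lemma sets_disk_area [measurable_cong, simp]: "sets disk_area = sets borel"
  by (simp add: disk_area_def)

lemma nn_integral_disk_area:
  assumes "F \<in> borel_measurable borel"
  shows "(\<integral>\<^sup>+z. F z \<partial>disk_area) = (\<integral>\<^sup>+z. F z * indicator unit_disk z \<partial>lborel) / ennreal pi"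
  unfolding disk_area_def using assms by (subst nn_integral_uniform_measure) (auto simp: emeasure_disk)

interpretation disk_area: finite_measure disk_area
  by (rule finite_measureI) (auto simp: disk_area_def emeasure_uniform_measure_1 emeasure_disk)

lemma rotation_disk_area:
  assumes F: "F \<in> borel_measurable borel" and t: "cos (t / 2) \<noteq> 0"
  shows "(\<integral>\<^sup>+z. F (cis t * z) \<partial>disk_area) = (\<integral>\<^sup>+z. F z \<partial>disk_area)"
proof -
  have mt: "(\<lambda>z. cis t * z) \<in> borel_measurable borel"
    by (intro borel_measurable_continuous_onI continuous_intros)
  have "(\<integral>\<^sup>+z. F (cis t * z) * indicator unit_disk z \<partial>lborel) = (\<integral>\<^sup>+z. (\<lambda>z. F z * indicator unit_disk z) (cis t * z) \<partial>lborel)"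
    by (intro nn_integral_cong) (auto simp: indicator_def norm_mult)
  also have "\<dots> = (\<integral>\<^sup>+z. F z * indicator unit_disk z \<partial>lborel)"
    by (rule rotation_invariance[OF _ t]) (intro borel_measurable_times_ennreal F borel_measurable_indicator borel_open open_ball)
  finally show ?thesis
    by (simp add: nn_integral_disk_area[OF F] nn_integral_disk_area[OF measurable_compose[OF mt F]])
qed

lemma AE_angle_cos: "AE t in angle. cos (t / 2) \<noteq> 0"
proof -
  have "countable {t. cos (t / 2) = (0 :: real)}"
  proof (rule countable_subset)
    show "{t. cos (t / 2) = 0} \<subseteq> range (\<lambda>n. real_of_int n * pi)"
      by (auto simp: cos_zero_iff_int image_iff)
  qed simp
  then have "AE t in lborel. cos (t / 2) \<noteq> (0 :: real)"
    using AE_discrete_difference[of _ lborel] by (intro AE_I[of _ _ "{t. cos (t / 2) = 0}"]) (auto intro!: emeasure_lborel_countable borel_closed closed_Collect_eq continuous_intros)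
  then show ?thesis
    unfolding angle_def by (intro AE_uniform_measureI) auto
qed

text \<open>
  Polar coordinates in the weak form that is needed: averaging over rotations does not change
  an area integral.
\<close>

lemma average_disk_area:
  assumes F [measurable]: "F \<in> borel_measurable borel"
  shows "(\<integral>\<^sup>+z. F z \<partial>disk_area) = (\<integral>\<^sup>+z. \<integral>\<^sup>+t. F (cis t * z) \<partial>angle \<partial>disk_area)"
proof -
  interpret pair_sigma_finite disk_area angle by standard
  have c: "(\<lambda>p. F (cis (snd p) * fst p)) \<in> borel_measurable (disk_area \<Otimes>\<^sub>M angle)"
  proof -
    have "(\<lambda>p :: complex \<times> real. cis (snd p) * fst p) \<in> borel_measurable borel"
      by (intro borel_measurable_continuous_onI continuous_intros)
    then have "(\<lambda>p :: complex \<times> real. F (cis (snd p) * fst p)) \<in> borel_measurable (borel \<Otimes>\<^sub>M borel)"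
      using F by (auto simp: borel_prod)
    then show ?thesis by (subst measurable_cong_sets[OF sets_pair_measure_cong[OF sets_disk_area sets_angle] refl])
  qed
  have "(\<integral>\<^sup>+z. F z \<partial>disk_area) = (\<integral>\<^sup>+t. (\<integral>\<^sup>+z. F z \<partial>disk_area) \<partial>angle)"
    using angle.emeasure_eq_measure by (simp add: measure_angle)
  also have "\<dots> = (\<integral>\<^sup>+t. (\<integral>\<^sup>+z. F (cis t * z) \<partial>disk_area) \<partial>angle)"
    by (rule nn_integral_cong_AE) (use AE_angle_cos in eventually_elim, simp add: rotation_disk_area[OF F])
  also have "\<dots> = (\<integral>\<^sup>+z. \<integral>\<^sup>+t. F (cis t * z) \<partial>angle \<partial>disk_area)"
    using Fubini[of "\<lambda>(z, t). F (cis t * z)"] c by (simp add: split_beta')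
  finally show ?thesis .
qed

text \<open>
  Layer cake: \<open>|z| ^ (2 n)\<close> is the integral of \<open>2 n r ^ (2 n - 1)\<close> over \<open>0 \<le> r \<le> |z|\<close>, and the set
  \<open>|z| \<ge> r\<close> has normalised area \<open>1 - r\<^sup>2\<close>.
\<close>

lemma disk_moment: "(\<integral>\<^sup>+z. ennreal (cmod z ^ (2 * n)) \<partial>disk_area) = ennreal (1 / real (n + 1))"
proof (cases "n = 0")
  case True
  then show ?thesis by (simp add: disk_area_def emeasure_uniform_measure_1 emeasure_disk)
next
  case False
  interpret P: pair_sigma_finite disk_area "lborel :: real measure" by standard
  define h where "h r = ennreal (2 * real n * r ^ (2 * n - 1))" for r :: real
  define E where "E = {p :: complex \<times> real. 0 \<le> snd p \<and> snd p \<le> 1 \<and> snd p \<le> cmod (fst p)}"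
  have "closed E" unfolding E_def by (intro closed_Collect_conj closed_Collect_le continuous_intros)
  then have E: "E \<in> sets (borel \<Otimes>\<^sub>M borel)" unfolding borel_prod by (rule borel_closed)
  have hm: "h \<in> borel_measurable borel" unfolding h_def by measurable
  have mm: "(\<lambda>(z, r). h r * indicator E (z, r)) \<in> borel_measurable (disk_area \<Otimes>\<^sub>M lborel)"
  proof -
    have "(\<lambda>(z :: complex, r). h r * indicator E (z, r)) \<in> borel_measurable (borel \<Otimes>\<^sub>M borel)"
      using E hm by measurable
    then show ?thesis by (subst measurable_cong_sets[OF sets_pair_measure_cong[OF sets_disk_area sets_lborel] refl])
  qed
  have deriv: "((\<lambda>r. r ^ (2 * n)) has_real_derivative 2 * real n * r ^ (2 * n - 1)) (at r)" for r :: real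
    by (auto intro!: derivative_eq_intros)
  have inner: "(\<integral>\<^sup>+r. h r * indicator E (z, r) \<partial>lborel) = ennreal (cmod z ^ (2 * n))" if z: "z \<in> unit_disk" for z
  proof -
    have "(\<integral>\<^sup>+r. h r * indicator E (z, r) \<partial>lborel) = (\<integral>\<^sup>+r. ennreal (2 * real n * r ^ (2 * n - 1)) * indicator {0..cmod z} r \<partial>lborel)"
      by (intro nn_integral_cong) (use z in \<open>auto simp: h_def E_def indicator_def\<close>)
    also have "\<dots> = ennreal (cmod z ^ (2 * n) - 0 ^ (2 * n))"
      by (rule nn_integral_FTC_Icc) (use deriv in auto)
    finally show ?thesis using False by simp
  qed
  have outer: "(\<integral>\<^sup>+z. h r * indicator E (z, r) \<partial>disk_area) = ennreal (2 * real n * (r ^ (2 * n - 1) - r ^ (2 * n + 1))) * indicator {0..1} r" for r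
  proof (cases "0 \<le> r \<and> r \<le> 1")
    case True
    have meas: "emeasure disk_area {z. r \<le> cmod z} = ennreal (1 - r\<^sup>2)"
    proof -
      have "unit_disk \<inter> {z :: complex. r \<le> cmod z} = unit_disk - ball 0 r" by auto
      moreover have "emeasure lborel (unit_disk - ball (0 :: complex) r) = ennreal (pi * 1\<^sup>2) - ennreal (pi * r\<^sup>2)"
        using True by (subst emeasure_Diff) (auto simp: emeasure_disk)
      moreover have "\<dots> = ennreal (pi * (1 - r\<^sup>2))"
        using True by (subst ennreal_minus) (auto simp: algebra_simps)
      ultimately have "emeasure lborel (unit_disk \<inter> {z :: complex. r \<le> cmod z}) = ennreal (pi * (1 - r\<^sup>2))" by simp
      moreover have "{z :: complex. r \<le> cmod z} \<in> sets borel"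
        by (intro borel_closed closed_Collect_le continuous_intros)
      ultimately show ?thesis
        using True by (simp add: disk_area_def emeasure_disk divide_ennreal power_le_one)
    qed
    have mr: "{z :: complex. r \<le> cmod z} \<in> sets disk_area"
      unfolding sets_disk_area by (intro borel_closed closed_Collect_le continuous_intros)
    have "(\<integral>\<^sup>+z. h r * indicator E (z, r) \<partial>disk_area) = (\<integral>\<^sup>+z. h r * indicator {z. r \<le> cmod z} z \<partial>disk_area)"
      by (intro nn_integral_cong) (use True in \<open>auto simp: E_def indicator_def\<close>)
    also have "\<dots> = h r * ennreal (1 - r\<^sup>2)"
      using mr by (simp add: nn_integral_cmult_indicator meas)
    also have "\<dots> = ennreal (2 * real n * (r ^ (2 * n - 1) - r ^ (2 * n + 1)))"
    proof -
      have "r ^ (2 * n + 1) = r ^ (2 * n - 1) * r\<^sup>2" using False by (simp add: power_add[symmetric])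
      then show ?thesis
        unfolding h_def using True
        by (subst ennreal_mult[symmetric]) (auto simp: algebra_simps power_le_one)
    qed
    finally show ?thesis using True by simp
  next
    case False
    then have "indicator E (z, r) = (0 :: ennreal)" for z by (auto simp: E_def)
    then show ?thesis using False by simp
  qed
  have "(\<integral>\<^sup>+z. ennreal (cmod z ^ (2 * n)) \<partial>disk_area) = (\<integral>\<^sup>+z. \<integral>\<^sup>+r. h r * indicator E (z, r) \<partial>lborel \<partial>disk_area)"
  proof (rule nn_integral_cong_AE)
    have "AE z in disk_area. z \<in> unit_disk"
      unfolding disk_area_def by (rule AE_uniform_measureI) auto
    then show "AE z in disk_area. ennreal (cmod z ^ (2 * n)) = (\<integral>\<^sup>+r. h r * indicator E (z, r) \<partial>lborel)"
      by eventually_elim (rule inner[symmetric])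
  qed
  also have "\<dots> = (\<integral>\<^sup>+r. \<integral>\<^sup>+z. h r * indicator E (z, r) \<partial>disk_area \<partial>lborel)"
    using P.Fubini[OF mm] by simp
  also have "\<dots> = (\<integral>\<^sup>+r. ennreal (2 * real n * (r ^ (2 * n - 1) - r ^ (2 * n + 1))) * indicator {0..1} r \<partial>lborel)"
    unfolding outer ..
  also have "\<dots> = ennreal ((1 ^ (2 * n) - real n / real (n + 1) * 1 ^ (2 * n + 2)) - (0 ^ (2 * n) - real n / real (n + 1) * 0 ^ (2 * n + 2)))"
  proof (rule nn_integral_FTC_Icc)
    fix r :: real assume r: "r \<in> {0..1}"
    show "((\<lambda>r. r ^ (2 * n) - real n / real (n + 1) * r ^ (2 * n + 2)) has_real_derivative 2 * real n * (r ^ (2 * n - 1) - r ^ (2 * n + 1))) (at r)"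
    proof -
      have "((\<lambda>r. r ^ (2 * n) - real n / real (n + 1) * r ^ (2 * n + 2)) has_real_derivative
        2 * real n * r ^ (2 * n - 1) - real n / real (n + 1) * (real (2 * n + 2) * r ^ (2 * n + 1))) (at r)"
      proof (intro DERIV_diff DERIV_cmult deriv)
        show "((\<lambda>r. r ^ (2 * n + 2)) has_real_derivative real (2 * n + 2) * r ^ (2 * n + 1)) (at r)"
          using DERIV_pow[of "2 * n + 2" r] by simp
      qed
      moreover have "real n / real (n + 1) * (real (2 * n + 2) * r ^ (2 * n + 1)) = 2 * real n * r ^ (2 * n + 1)"
      proof -
        have e: "real (2 * n + 2) = 2 * real (n + 1)" by simp
        have "x / y * (2 * y * w) = 2 * x * w" if "y \<noteq> 0" for x y w :: real
          using that by simp
        from this[of "real (n + 1)" "real n" "r ^ (2 * n + 1)"] show ?thesis unfolding e by simp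
      qed
      ultimately show ?thesis by (simp add: algebra_simps)
    qed
    have "r ^ (2 * n + 1) \<le> r ^ (2 * n - 1)" using r by (intro power_decreasing) auto
    then show "0 \<le> 2 * real n * (r ^ (2 * n - 1) - r ^ (2 * n + 1))" by simp
  qed auto
  also have "\<dots> = ennreal (1 / real (n + 1))" using False by (simp add: power_0_left) (simp add: field_simps)
  finally show ?thesis .
qed

lemma borel_disk:
  assumes "g holomorphic_on unit_disk"
  shows "(\<lambda>z. indicator unit_disk z *\<^sub>R g z) \<in> borel_measurable borel"
  by (intro borel_measurable_continuous_on_indicator holomorphic_on_imp_continuous_on assms) auto

lemma nn_integral_circle_sq:
  assumes g: "g holomorphic_on unit_disk" and r: "0 \<le> r" "r < 1"
  shows "(\<integral>\<^sup>+t. ennreal ((cmod (g (of_real r * cis t)))\<^sup>2) \<partial>angle) = (\<Sum>n. ennreal ((cmod (taylor g n))\<^sup>2 * r ^ (2 * n)))"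
proof -
  obtain K where K: "\<And>t. cmod (g (of_real r * cis t)) \<le> K" using circle_bounded[OF g r] by blast
  have "integrable angle (\<lambda>t. (cmod (g (of_real r * cis t)))\<^sup>2)"
  proof (rule angle_integrable[of _ "K\<^sup>2"])
    show "(\<lambda>t. (cmod (g (of_real r * cis t)))\<^sup>2) \<in> borel_measurable borel"
      by (intro borel_measurable_continuous_onI continuous_intros circle_continuous g r)
    show "norm ((cmod (g (of_real r * cis t)))\<^sup>2) \<le> K\<^sup>2" for t
      using K[of t] by (simp add: power_mono)
  qed
  then have "(\<integral>\<^sup>+t. ennreal ((cmod (g (of_real r * cis t)))\<^sup>2) \<partial>angle) = ennreal (circle_sq r g)"
    unfolding circle_sq_def by (rule nn_integral_eq_integral) simp
  also have "\<dots> = (\<Sum>n. ennreal ((cmod (taylor g n))\<^sup>2 * r ^ (2 * n)))"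
    by (rule suminf_ennreal_eq[OF _ Parseval_sq[OF g r], symmetric]) (simp add: r)
  finally show ?thesis .
qed

lemma taylor_rotate:
  assumes g: "g holomorphic_on unit_disk"
  shows "(\<lambda>w. g (cis \<alpha> * w)) holomorphic_on unit_disk" "taylor (\<lambda>w. g (cis \<alpha> * w)) n = taylor g n * cis \<alpha> ^ n"
proof -
  have s: "(\<lambda>n. (taylor g n * cis \<alpha> ^ n) * z ^ n) sums g (cis \<alpha> * z)" if "z \<in> unit_disk" for z
    using taylor_sums[OF g, of "cis \<alpha> * z"] that by (simp add: norm_mult power_mult_distrib mult.assoc)
  show "(\<lambda>w. g (cis \<alpha> * w)) holomorphic_on unit_disk" by (rule taylor_unique(1)[OF s])
  show "taylor (\<lambda>w. g (cis \<alpha> * w)) n = taylor g n * cis \<alpha> ^ n" by (rule taylor_unique(2)[OF s])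
qed

lemma AE_disk: "AE z in disk_area. z \<in> unit_disk"
  unfolding disk_area_def by (rule AE_uniform_measureI) auto

text \<open>
  Averaging over rotations replaces \<open>|g z|\<^sup>2\<close> by its mean over the circle through \<open>z\<close>, to which
  Parseval applies; the moments of the disk finish the computation.
\<close>

lemma area_Parseval:
  assumes g: "g holomorphic_on unit_disk"
  shows "(\<integral>\<^sup>+z. ennreal ((cmod (g z))\<^sup>2) \<partial>disk_area) = (\<Sum>n. ennreal ((cmod (taylor g n))\<^sup>2 / real (n + 1)))"
proof -
  define F where "F z = ennreal ((cmod (indicator unit_disk z *\<^sub>R g z))\<^sup>2)" for z
  have F: "F \<in> borel_measurable borel" unfolding F_def using borel_disk[OF g] by measurable
  have circ: "(\<integral>\<^sup>+t. F (cis t * z) \<partial>angle) = (\<Sum>n. ennreal ((cmod (taylor g n))\<^sup>2) * ennreal (cmod z ^ (2 * n)))"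
    if z: "z \<in> unit_disk" for z
  proof -
    define \<alpha> where "\<alpha> = Arg z"
    have zz: "z = of_real (cmod z) * cis \<alpha>" using rcis_cmod_Arg[of z] by (simp add: rcis_def \<alpha>_def)
    have Feq: "F (cis t * z) = ennreal ((cmod (g (cis \<alpha> * (of_real (cmod z) * cis t))))\<^sup>2)" for t
    proof -
      have e: "cis t * z = cis \<alpha> * (of_real (cmod z) * cis t)" by (subst zz) (simp add: mult_ac)
      have "indicator unit_disk (cis t * z) = (1 :: real)" using z by (simp add: norm_mult)
      then show ?thesis by (simp only: F_def scaleR_one e)
    qed
    have z01: "0 \<le> cmod z" "cmod z < 1" using z by auto
    have "(\<integral>\<^sup>+t. F (cis t * z) \<partial>angle) =
       (\<integral>\<^sup>+t. ennreal ((cmod (g (cis \<alpha> * (of_real (cmod z) * cis t))))\<^sup>2) \<partial>angle)"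
      by (intro nn_integral_cong) (rule Feq)
    also have "\<dots> = (\<Sum>n. ennreal ((cmod (taylor (\<lambda>w. g (cis \<alpha> * w)) n))\<^sup>2 * cmod z ^ (2 * n)))"
      by (rule nn_integral_circle_sq[OF taylor_rotate(1)[OF g] z01])
    also have "\<dots> = (\<Sum>n. ennreal ((cmod (taylor g n))\<^sup>2) * ennreal (cmod z ^ (2 * n)))"
      by (simp add: taylor_rotate(2)[OF g] norm_mult norm_power ennreal_mult)
    finally show ?thesis .
  qed
  have "(\<integral>\<^sup>+z. ennreal ((cmod (g z))\<^sup>2) \<partial>disk_area) = (\<integral>\<^sup>+z. F z \<partial>disk_area)"
    by (rule nn_integral_cong_AE) (use AE_disk in eventually_elim, simp add: F_def)
  also have "\<dots> = (\<integral>\<^sup>+z. \<integral>\<^sup>+t. F (cis t * z) \<partial>angle \<partial>disk_area)" by (rule average_disk_area[OF F])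
  also have "\<dots> = (\<integral>\<^sup>+z. (\<Sum>n. ennreal ((cmod (taylor g n))\<^sup>2) * ennreal (cmod z ^ (2 * n))) \<partial>disk_area)"
    by (rule nn_integral_cong_AE) (use AE_disk in eventually_elim, simp add: circ)
  also have "\<dots> = (\<Sum>n. \<integral>\<^sup>+z. ennreal ((cmod (taylor g n))\<^sup>2) * ennreal (cmod z ^ (2 * n)) \<partial>disk_area)"
    by (rule nn_integral_suminf) measurable
  also have "\<dots> = (\<Sum>n. ennreal ((cmod (taylor g n))\<^sup>2 / real (n + 1)))"
    by (subst nn_integral_cmult) (measurable, simp add: disk_moment ennreal_mult[symmetric] del: of_nat_add of_nat_Suc)
  finally show ?thesis .
qed

lemma hardy_Parseval:
  assumes f: "f \<in> disk_analytic"
  shows "hardy2_norm_sq f = (\<Sum>n. ennreal ((cmod (taylor f n))\<^sup>2))"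
proof -
  have hol: "f holomorphic_on unit_disk" and f0: "\<And>z. z \<notin> unit_disk \<Longrightarrow> f z = 0"
    using f by (auto simp: disk_analytic_def)
  have "f = (\<lambda>z. indicator unit_disk z *\<^sub>R f z)" using f0 by (auto simp: indicator_def fun_eq_iff)
  then have fm [measurable]: "f \<in> borel_measurable borel" using borel_disk[OF hol] by simp
  have eq: "(\<integral>\<^sup>+\<zeta>. ennreal ((cmod (f (of_real r * \<zeta>)))\<^sup>2) \<partial>circle_measure) = (\<Sum>n. ennreal ((cmod (taylor f n))\<^sup>2 * r ^ (2 * n)))"
    if r: "0 \<le> r" "r < 1" for r
  proof -
    have meas: "(\<lambda>\<zeta>. ennreal ((cmod (f (of_real r * \<zeta>)))\<^sup>2)) \<in> borel_measurable borel" by measurable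
    have "(\<integral>\<^sup>+\<zeta>. ennreal ((cmod (f (of_real r * \<zeta>)))\<^sup>2) \<partial>circle_measure) =
        (\<integral>\<^sup>+t. ennreal ((cmod (f (of_real r * cis t)))\<^sup>2) \<partial>angle)"
      unfolding circle_measure_angle
    proof (rule nn_integral_distr)
      show "cis \<in> angle \<rightarrow>\<^sub>M borel"
        unfolding measurable_cong_sets[OF sets_angle refl] by (rule cis_measurable)
      show "(\<lambda>\<zeta>. ennreal ((cmod (f (of_real r * \<zeta>)))\<^sup>2)) \<in> borel_measurable (distr angle borel cis)"
        using meas by simp
    qed
    also have "\<dots> = (\<Sum>n. ennreal ((cmod (taylor f n))\<^sup>2 * r ^ (2 * n)))"
      by (rule nn_integral_circle_sq[OF hol r])
    finally show ?thesis .
  qed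
  show ?thesis
  proof (rule antisym)
    show "hardy2_norm_sq f \<le> (\<Sum>n. ennreal ((cmod (taylor f n))\<^sup>2))"
      unfolding hardy2_norm_sq_def
    proof (rule SUP_least)
      fix r :: real assume r: "r \<in> {0..<1}"
      have r01: "0 \<le> r" "r < 1" using r by simp_all
      have le: "(cmod (taylor f n))\<^sup>2 * r ^ (2 * n) \<le> (cmod (taylor f n))\<^sup>2" for n
        using mult_left_mono[OF power_le_one[OF r01(1) less_imp_le[OF r01(2)]] zero_le_power2, of "cmod (taylor f n)" "2 * n"]
        by simp
      show "(\<integral>\<^sup>+\<zeta>. ennreal ((cmod (f (of_real r * \<zeta>)))\<^sup>2) \<partial>circle_measure) \<le> (\<Sum>n. ennreal ((cmod (taylor f n))\<^sup>2))"
        unfolding eq[OF r01] by (intro suminf_le summableI ennreal_leI le)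
    qed
    show "(\<Sum>n. ennreal ((cmod (taylor f n))\<^sup>2)) \<le> hardy2_norm_sq f"
      unfolding suminf_eq_SUP
    proof (rule SUP_least)
      fix N
      have "(\<lambda>j. ennreal (\<Sum>n<N. (cmod (taylor f n))\<^sup>2 * radius j ^ (2 * n))) \<longlonglongrightarrow> ennreal (\<Sum>n<N. (cmod (taylor f n))\<^sup>2 * 1 ^ (2 * n))"
        by (intro tendsto_ennrealI tendsto_intros radius_tendsto)
      moreover have "ennreal (\<Sum>n<N. (cmod (taylor f n))\<^sup>2 * radius j ^ (2 * n)) \<le> hardy2_norm_sq f" for j
      proof -
        have "ennreal (\<Sum>n<N. (cmod (taylor f n))\<^sup>2 * radius j ^ (2 * n)) = (\<Sum>n<N. ennreal ((cmod (taylor f n))\<^sup>2 * radius j ^ (2 * n)))"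
          by (rule sum_ennreal[symmetric]) (simp add: radius)
        also have "\<dots> \<le> (\<Sum>n. ennreal ((cmod (taylor f n))\<^sup>2 * radius j ^ (2 * n)))"
          by (rule sum_le_suminf) auto
        also have "\<dots> \<le> hardy2_norm_sq f"
          unfolding hardy2_norm_sq_def eq[OF radius, symmetric] by (rule SUP_upper) (simp add: radius)
        finally show ?thesis .
      qed
      ultimately have "ennreal (\<Sum>n<N. (cmod (taylor f n))\<^sup>2 * 1 ^ (2 * n)) \<le> hardy2_norm_sq f"
        by (intro LIMSEQ_le_const2) auto
      then show "(\<Sum>n<N. ennreal ((cmod (taylor f n))\<^sup>2)) \<le> hardy2_norm_sq f" by simp
    qed
  qed
qed

lemma taylor_deriv: "taylor (deriv f) n = of_nat (Suc n) * taylor f (Suc n)"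
  unfolding taylor_def fps_expansion_def by (simp add: funpow_Suc_right del: funpow.simps of_nat_Suc)

theorem dirichlet_norm_sq_series:
  assumes f: "f \<in> disk_analytic"
  shows "dirichlet_norm_sq f = (\<Sum>n. ennreal (real (n + 1) * (cmod (taylor f n))\<^sup>2))"
proof -
  have hol: "f holomorphic_on unit_disk" using f by (auto simp: disk_analytic_def)
  have d: "deriv f holomorphic_on unit_disk" by (rule holomorphic_deriv[OF hol open_ball])
  have "(\<integral>\<^sup>+z. ennreal ((cmod (deriv f z))\<^sup>2) \<partial>disk_area) = (\<Sum>n. ennreal ((cmod (taylor (deriv f) n))\<^sup>2 / real (n + 1)))"
    by (rule area_Parseval[OF d])
  also have "\<dots> = (\<Sum>n. ennreal (real (Suc n) * (cmod (taylor f (Suc n)))\<^sup>2))"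
    by (simp add: taylor_deriv norm_mult power_mult_distrib power2_eq_square field_simps del: of_nat_Suc)
  also have "\<dots> = (\<Sum>n. ennreal (real n * (cmod (taylor f n))\<^sup>2))"
    by (subst (2) suminf_offset[of _ 1]) (simp_all add: summableI del: of_nat_Suc)
  finally have a: "(\<integral>\<^sup>+z. ennreal ((cmod (deriv f z))\<^sup>2) \<partial>disk_area) = (\<Sum>n. ennreal (real n * (cmod (taylor f n))\<^sup>2))" .
  have "dirichlet_norm_sq f = (\<Sum>n. ennreal ((cmod (taylor f n))\<^sup>2) + ennreal (real n * (cmod (taylor f n))\<^sup>2))"
    unfolding dirichlet_norm_sq_def hardy_Parseval[OF f] a by (rule suminf_add) auto
  also have "\<dots> = (\<Sum>n. ennreal (real (n + 1) * (cmod (taylor f n))\<^sup>2))"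
    by (subst ennreal_plus[symmetric]) (auto simp: algebra_simps)
  finally show ?thesis .
qed

lemma dirichlet_space_summable:
  assumes f: "f \<in> dirichlet_space"
  shows "summable (\<lambda>n. real (n + 1) * (cmod (taylor f n))\<^sup>2)"
    and "(dirichlet_norm f)\<^sup>2 = (\<Sum>n. real (n + 1) * (cmod (taylor f n))\<^sup>2)"
proof -
  have fa: "f \<in> disk_analytic" and fin: "dirichlet_norm_sq f < \<infinity>" using f by (auto simp: dirichlet_space_def)
  note eq = dirichlet_norm_sq_series[OF fa]
  show s: "summable (\<lambda>n. real (n + 1) * (cmod (taylor f n))\<^sup>2)"
    by (rule summable_suminf_not_top) (use fin eq in \<open>auto simp: top.not_eq_extremum\<close>)
  have "dirichlet_norm_sq f = ennreal (\<Sum>n. real (n + 1) * (cmod (taylor f n))\<^sup>2)"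
    unfolding eq by (rule suminf_ennreal2[OF _ s]) simp
  moreover have "0 \<le> (\<Sum>n. real (n + 1) * (cmod (taylor f n))\<^sup>2)" by (rule suminf_nonneg[OF s]) simp
  ultimately show "(dirichlet_norm f)\<^sup>2 = (\<Sum>n. real (n + 1) * (cmod (taylor f n))\<^sup>2)"
    by (simp add: dirichlet_norm_def)
qed

lemma dirichlet_spaceI:
  assumes f: "f \<in> disk_analytic" and s: "(\<lambda>n. real (n + 1) * (cmod (taylor f n))\<^sup>2) sums S"
  shows "f \<in> dirichlet_space" "dirichlet_norm f = sqrt S"
proof -
  have eq: "dirichlet_norm_sq f = ennreal S"
    unfolding dirichlet_norm_sq_series[OF f] by (rule suminf_ennreal_eq[OF _ s]) simp
  then show "f \<in> dirichlet_space" using f by (simp add: dirichlet_space_def)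
  have "0 \<le> S" using sums_le[OF _ sums_zero s] by simp
  then show "dirichlet_norm f = sqrt S" using eq by (simp add: dirichlet_norm_def)
qed

section \<open>Outer functions\<close>

lemma sets_circle_measure [measurable_cong, simp]: "sets circle_measure = sets borel"
  by (simp add: circle_measure_def)

lemma space_circle_measure [simp]: "space circle_measure = UNIV"
  by (simp add: circle_measure_def)

lemma cis_measurable_angle [measurable]: "cis \<in> angle \<rightarrow>\<^sub>M borel"
  unfolding measurable_cong_sets[OF sets_angle refl] by (rule cis_measurable)

lemma AE_circle: "AE \<zeta> in circle_measure. cmod \<zeta> = 1"
  unfolding circle_measure_angle by (subst AE_distr_iff) auto

interpretation circle: finite_measure circle_measure
  unfolding circle_measure_angle by (rule angle.finite_measure_distr) simp

text \<open>
  The exponent in the definition of an outer function.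
\<close>

definition herglotz :: "(complex \<Rightarrow> real) \<Rightarrow> complex \<Rightarrow> complex" where
  "herglotz k z = (\<integral>\<zeta>. (\<zeta> + z) / (\<zeta> - z) * of_real (k \<zeta>) \<partial>circle_measure)"

lemma herglotz_kernel_sums:
  assumes "cmod \<zeta> = 1" "cmod z < 1"
  shows "(\<lambda>n. (if n = 0 then 1 else 2) * (cnj \<zeta> * z) ^ n) sums ((\<zeta> + z) / (\<zeta> - z))"
proof -
  define w where "w = cnj \<zeta> * z"
  have w: "cmod w < 1" using assms by (simp add: w_def norm_mult)
  have zz: "\<zeta> * cnj \<zeta> = 1" using complex_norm_square[of \<zeta>] assms by simp
  have z: "z = \<zeta> * w" using zz by (simp add: w_def mult.assoc[symmetric])
  have \<zeta>: "\<zeta> \<noteq> 0" using assms by auto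
  have w1: "1 - w \<noteq> 0" using w by auto
  have "(\<lambda>n. 2 * w ^ n) sums (2 * (1 / (1 - w)))" by (intro sums_mult geometric_sums w)
  then have "(\<lambda>n. 2 * w ^ n - (if n = 0 then 1 else 0)) sums (2 * (1 / (1 - w)) - 1)"
    by (intro sums_diff sums_single[of 0 "\<lambda>_. 1"])
  moreover have "2 * (1 / (1 - w)) - 1 = (\<zeta> + z) / (\<zeta> - z)"
  proof -
    have "(\<zeta> + z) / (\<zeta> - z) = (\<zeta> * (1 + w)) / (\<zeta> * (1 - w))" by (simp add: z algebra_simps)
    also have "\<dots> = (1 + w) / (1 - w)" using \<zeta> by simp
    finally show ?thesis using w1 by (simp add: field_simps)
  qed
  moreover have "(\<lambda>n. 2 * w ^ n - (if n = 0 then 1 else 0)) = (\<lambda>n. (if n = 0 then 1 else 2) * w ^ n)"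
    by (auto simp: fun_eq_iff)
  ultimately show ?thesis by (simp add: w_def)
qed

lemma herglotz_kernel_bound:
  assumes "cmod \<zeta> = 1" "cmod z < 1"
  shows "cmod ((\<zeta> + z) / (\<zeta> - z)) \<le> 2 / (1 - cmod z)"
proof -
  have "cmod (\<zeta> + z) \<le> 2" using norm_triangle_ineq[of \<zeta> z] assms by simp
  moreover have "1 - cmod z \<le> cmod (\<zeta> - z)" using norm_triangle_ineq2[of \<zeta> z] assms by simp
  ultimately show ?thesis unfolding norm_divide using assms by (intro frac_le) auto
qed

text \<open>
  The real part is the Poisson kernel.
\<close>

lemma herglotz_kernel_Re:
  assumes "cmod \<zeta> = 1" "cmod z < 1"
  shows "0 \<le> Re ((\<zeta> + z) / (\<zeta> - z))"
proof -
  have "Re ((\<zeta> + z) / (\<zeta> - z)) = Re ((\<zeta> + z) * cnj (\<zeta> - z)) / (cmod (\<zeta> - z))\<^sup>2"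
    by (subst complex_div_cnj) (simp only: of_real_power[symmetric] Re_divide_of_real)
  also have "Re ((\<zeta> + z) * cnj (\<zeta> - z)) = (cmod \<zeta>)\<^sup>2 - (cmod z)\<^sup>2"
    unfolding cmod_power2 by (simp add: algebra_simps power2_eq_square)
  finally have "Re ((\<zeta> + z) / (\<zeta> - z)) = ((cmod \<zeta>)\<^sup>2 - (cmod z)\<^sup>2) / (cmod (\<zeta> - z))\<^sup>2" .
  moreover have "0 \<le> (cmod \<zeta>)\<^sup>2 - (cmod z)\<^sup>2" using assms by (simp add: power_le_one)
  ultimately show ?thesis by (metis divide_nonneg_nonneg zero_le_power2)
qed

lemma herglotz_integrable:
  assumes k: "integrable circle_measure k" and z: "cmod z < 1"
  shows "integrable circle_measure (\<lambda>\<zeta>. (\<zeta> + z) / (\<zeta> - z) * of_real (k \<zeta>))"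
proof (rule Bochner_Integration.integrable_bound)
  show "integrable circle_measure (\<lambda>\<zeta>. 2 / (1 - cmod z) * k \<zeta>)" by (intro integrable_mult_right k)
  have [measurable]: "k \<in> borel_measurable borel" using borel_measurable_integrable[OF k] by simp
  show "(\<lambda>\<zeta>. (\<zeta> + z) / (\<zeta> - z) * of_real (k \<zeta>)) \<in> borel_measurable circle_measure"
    by measurable
  show "AE \<zeta> in circle_measure. norm ((\<zeta> + z) / (\<zeta> - z) * of_real (k \<zeta>)) \<le> norm (2 / (1 - cmod z) * k \<zeta>)"
    using AE_circle
  proof eventually_elim
    case (elim \<zeta>)
    have "norm ((\<zeta> + z) / (\<zeta> - z) * of_real (k \<zeta>)) = cmod ((\<zeta> + z) / (\<zeta> - z)) * \<bar>k \<zeta>\<bar>"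
      by (simp only: norm_mult norm_of_real)
    also have "\<dots> \<le> 2 / (1 - cmod z) * \<bar>k \<zeta>\<bar>"
      by (intro mult_right_mono herglotz_kernel_bound elim z) simp
    also have "\<dots> = norm (2 / (1 - cmod z) * k \<zeta>)" using z by (simp add: abs_mult)
    finally show ?case .
  qed
qed

lemma herglotz_sums:
  assumes k: "integrable circle_measure k" and z: "z \<in> unit_disk"
  shows "(\<lambda>n. (if n = 0 then 1 else 2) * (\<integral>\<zeta>. cnj \<zeta> ^ n * of_real (k \<zeta>) \<partial>circle_measure) * z ^ n) sums herglotz k z"
proof -
  have z1: "cmod z < 1" using z by simp
  define s :: "nat \<Rightarrow> complex" where "s n = (if n = 0 then 1 else 2)" for n
  define u where "u n \<zeta> = cnj \<zeta> ^ n * complex_of_real (k \<zeta>)" for n \<zeta>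
  have [measurable]: "k \<in> borel_measurable borel" using borel_measurable_integrable[OF k] by simp
  have cm: "cnj \<in> borel_measurable borel" by (intro borel_measurable_continuous_onI continuous_intros)
  have um: "u n \<in> borel_measurable borel" for n
    unfolding u_def by (intro borel_measurable_times borel_measurable_power cm) measurable
  have ub: "AE \<zeta> in circle_measure. cmod (u n \<zeta>) = \<bar>k \<zeta>\<bar>" for n
    using AE_circle by eventually_elim (simp add: u_def norm_mult norm_power)
  have ui: "integrable circle_measure (u n)" for n
    by (rule Bochner_Integration.integrable_bound[OF k]) (use um ub[of n] in auto)
  have sb: "cmod (s n) \<le> 2" for n by (simp add: s_def)
  have int: "integrable circle_measure (\<lambda>\<zeta>. (s n * z ^ n) * u n \<zeta>)" for n by (intro integrable_mult_right ui)
  have "(\<lambda>n. \<integral>\<zeta>. (s n * z ^ n) * u n \<zeta> \<partial>circle_measure) sums (\<integral>\<zeta>. (\<Sum>n. (s n * z ^ n) * u n \<zeta>) \<partial>circle_measure)"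
  proof (rule sums_integral[OF int])
    have sz: "summable (\<lambda>n. 2 * cmod z ^ n * x)" for x
      by (intro summable_mult summable_mult2 summable_geometric) (simp add: z1)
    have bd: "cmod (s n * z ^ n * u n \<zeta>) \<le> 2 * cmod z ^ n * \<bar>k \<zeta>\<bar>" if "cmod \<zeta> = 1" for n \<zeta>
    proof -
      have "cmod (s n * z ^ n * u n \<zeta>) = cmod (s n) * cmod z ^ n * \<bar>k \<zeta>\<bar>"
        using that by (simp add: u_def norm_mult norm_power)
      also have "\<dots> \<le> 2 * cmod z ^ n * \<bar>k \<zeta>\<bar>" by (intro mult_right_mono sb) auto
      finally show ?thesis .
    qed
    show "AE \<zeta> in circle_measure. summable (\<lambda>n. norm (s n * z ^ n * u n \<zeta>))"
      using AE_circle
    proof eventually_elim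
      case (elim \<zeta>)
      show ?case by (rule summable_comparison_test'[OF sz[of "\<bar>k \<zeta>\<bar>"], of 0]) (simp add: bd[OF elim])
    qed
    show "summable (\<lambda>n. \<integral>\<zeta>. norm (s n * z ^ n * u n \<zeta>) \<partial>circle_measure)"
    proof (rule summable_comparison_test'[OF sz, of 0])
      fix n
      have "(\<integral>\<zeta>. norm (s n * z ^ n * u n \<zeta>) \<partial>circle_measure) \<le> (\<integral>\<zeta>. 2 * cmod z ^ n * \<bar>k \<zeta>\<bar> \<partial>circle_measure)"
      proof (rule integral_mono_AE)
        show "integrable circle_measure (\<lambda>\<zeta>. norm (s n * z ^ n * u n \<zeta>))" by (intro integrable_norm int)
        show "integrable circle_measure (\<lambda>\<zeta>. 2 * cmod z ^ n * \<bar>k \<zeta>\<bar>)" by (intro integrable_mult_right integrable_abs k)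
        show "AE \<zeta> in circle_measure. norm (s n * z ^ n * u n \<zeta>) \<le> 2 * cmod z ^ n * \<bar>k \<zeta>\<bar>"
          using AE_circle by eventually_elim (rule bd)
      qed
      then show "norm (\<integral>\<zeta>. norm (s n * z ^ n * u n \<zeta>) \<partial>circle_measure) \<le> 2 * cmod z ^ n * (\<integral>\<zeta>. \<bar>k \<zeta>\<bar> \<partial>circle_measure)"
        by (simp add: integral_nonneg_AE)
    qed
  qed
  moreover have "(\<integral>\<zeta>. (\<Sum>n. (s n * z ^ n) * u n \<zeta>) \<partial>circle_measure) = herglotz k z"
    unfolding herglotz_def
  proof (rule integral_cong_AE)
    show "(\<lambda>\<zeta>. \<Sum>n. s n * z ^ n * u n \<zeta>) \<in> borel_measurable circle_measure"
      using um by measurable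
    show "(\<lambda>\<zeta>. (\<zeta> + z) / (\<zeta> - z) * of_real (k \<zeta>)) \<in> borel_measurable circle_measure" by measurable
    show "AE \<zeta> in circle_measure. (\<Sum>n. s n * z ^ n * u n \<zeta>) = (\<zeta> + z) / (\<zeta> - z) * of_real (k \<zeta>)"
      using AE_circle
    proof eventually_elim
      case (elim \<zeta>)
      have "(\<lambda>n. (s n * (cnj \<zeta> * z) ^ n) * of_real (k \<zeta>)) sums ((\<zeta> + z) / (\<zeta> - z) * of_real (k \<zeta>))"
        unfolding s_def by (intro sums_mult2 herglotz_kernel_sums elim z1)
      then show ?case by (simp add: sums_iff u_def power_mult_distrib mult_ac)
    qed
  qed
  moreover have "(\<integral>\<zeta>. (s n * z ^ n) * u n \<zeta> \<partial>circle_measure) = s n * (\<integral>\<zeta>. u n \<zeta> \<partial>circle_measure) * z ^ n" for n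
    by simp
  ultimately show ?thesis by (simp only: s_def u_def)
qed

lemma herglotz_holomorphic: "integrable circle_measure k \<Longrightarrow> herglotz k holomorphic_on unit_disk"
  by (rule taylor_unique(1)[OF herglotz_sums])

lemma herglotz_const:
  assumes z: "z \<in> unit_disk"
  shows "herglotz (\<lambda>_. c) z = of_real c"
proof -
  have "(\<integral>\<zeta>. cnj \<zeta> ^ n * of_real c \<partial>circle_measure) = (if n = 0 then of_real c else 0)" for n
  proof -
    have m: "(\<lambda>\<zeta>. cnj \<zeta> ^ n * complex_of_real c) \<in> borel_measurable borel"
      by (intro borel_measurable_continuous_onI continuous_intros)
    have "(\<integral>\<zeta>. cnj \<zeta> ^ n * of_real c \<partial>circle_measure) = (\<integral>t. cnj (cis t) ^ n * of_real c \<partial>angle)"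
      unfolding circle_measure_angle by (rule integral_distr[OF cis_measurable_angle m])
    also have "\<dots> = (\<integral>t. cis (of_int (- int n) * t) \<partial>angle) * of_real c"
      by (simp add: cis_cnj Complex.DeMoivre)
    also have "\<dots> = (if n = 0 then of_real c else 0)"
      unfolding angle_integral_cis by simp
    finally show ?thesis .
  qed
  then have "(\<lambda>n. if n = 0 then complex_of_real c else 0) sums herglotz (\<lambda>_. c) z"
    using herglotz_sums[OF circle.integrable_const z, of c] by (auto simp: if_distrib[of "\<lambda>x. x * _"] if_distrib[of "\<lambda>x. _ * x"] cong: if_cong)
  moreover have "(\<lambda>n. if n = 0 then complex_of_real c else 0) sums complex_of_real c"
    by (rule sums_single)
  ultimately show ?thesis using sums_unique2 by blast
qed

lemma herglotz_mono:
  assumes k: "integrable circle_measure k" and l: "integrable circle_measure l"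
    and le: "\<And>\<zeta>. k \<zeta> \<le> l \<zeta>" and z: "z \<in> unit_disk"
  shows "Re (herglotz k z) \<le> Re (herglotz l z)"
proof -
  have z1: "cmod z < 1" using z by simp
  have int: "Re (herglotz h z) = (\<integral>\<zeta>. Re ((\<zeta> + z) / (\<zeta> - z) * of_real (h \<zeta>)) \<partial>circle_measure)"
    if "integrable circle_measure h" for h
    unfolding herglotz_def by (rule integral_Re[symmetric]) (rule herglotz_integrable[OF that z1])
  show ?thesis
    unfolding int[OF k] int[OF l]
  proof (rule integral_mono_AE)
    show "AE \<zeta> in circle_measure. Re ((\<zeta> + z) / (\<zeta> - z) * of_real (k \<zeta>)) \<le> Re ((\<zeta> + z) / (\<zeta> - z) * of_real (l \<zeta>))"
      using AE_circle
    proof eventually_elim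
      case (elim \<zeta>)
      have "Re (x * of_real y) = Re x * y" for x y by simp
      then show ?case by (simp only: mult_left_mono[OF le herglotz_kernel_Re[OF elim z1]])
    qed
  qed (intro integrable_Re herglotz_integrable k l z1)+
qed

text \<open>
  Truncate the logarithm \<open>k\<close> of the boundary modulus from below at \<open>- m\<close>. The reciprocals \<open>G m\<close> of
  the resulting outer functions are bounded, their products with \<open>a\<close> are contractive because the
  Poisson kernel is positive, and they tend to unimodular constants by dominated convergence.
  A non-constant inner factor of \<open>a\<close> would rule this out.
\<close>

lemma outer_reciprocal:
  assumes "outer_function a"
  obtains G :: "nat \<Rightarrow> complex \<Rightarrow> complex" where
    "\<And>m. G m holomorphic_on unit_disk" "\<And>m. \<exists>L. \<forall>z\<in>unit_disk. cmod (G m z) \<le> L"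
    "\<And>m z. z \<in> unit_disk \<Longrightarrow> cmod (G m z * a z) \<le> 1"
    "\<And>z. z \<in> unit_disk \<Longrightarrow> (\<lambda>m. cmod (G m z * a z)) \<longlonglongrightarrow> 1"
proof -
  obtain \<alpha> k where \<alpha>: "cmod \<alpha> = 1" and k: "integrable circle_measure k"
    and a: "\<And>z. z \<in> unit_disk \<Longrightarrow> a z = \<alpha> * exp (herglotz k z)"
    using assms unfolding outer_function_def herglotz_def by blast
  define km where "km m \<zeta> = max (k \<zeta>) (- real m)" for m \<zeta>
  have kmeas [measurable]: "k \<in> borel_measurable borel" using borel_measurable_integrable[OF k] by simp
  have kmi: "integrable circle_measure (km m)" for m
    unfolding km_def by (intro integrable_max k circle.integrable_const)
  have kml: "k \<zeta> \<le> km m \<zeta>" "- real m \<le> km m \<zeta>" "\<bar>km m \<zeta>\<bar> \<le> \<bar>k \<zeta>\<bar>" for m \<zeta>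
    by (auto simp: km_def)
  define G where "G m z = exp (- herglotz (km m) z)" for m z
  have prod: "cmod (G m z * a z) = exp (Re (herglotz k z) - Re (herglotz (km m) z))" if "z \<in> unit_disk" for m z
    unfolding G_def a[OF that] norm_mult \<alpha> norm_exp_eq_Re by (simp add: exp_add[symmetric])
  show ?thesis
  proof
    show "G m holomorphic_on unit_disk" for m
      unfolding G_def by (intro holomorphic_intros herglotz_holomorphic kmi)
    show "\<exists>L. \<forall>z\<in>unit_disk. cmod (G m z) \<le> L" for m
    proof (intro exI ballI)
      fix z :: complex assume z: "z \<in> unit_disk"
      have "Re (herglotz (\<lambda>_. - real m) z) \<le> Re (herglotz (km m) z)"
        by (intro herglotz_mono kmi circle.integrable_const kml z)
      then show "cmod (G m z) \<le> exp (real m)"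
        unfolding herglotz_const[OF z] by (simp add: G_def)
    qed
    show "cmod (G m z * a z) \<le> 1" if z: "z \<in> unit_disk" for m z
      unfolding prod[OF z] using herglotz_mono[OF k kmi kml(1) z] by simp
    show "(\<lambda>m. cmod (G m z * a z)) \<longlonglongrightarrow> 1" if z: "z \<in> unit_disk" for z
    proof -
      have z1: "cmod z < 1" using z by simp
      have "(\<lambda>m. herglotz (km m) z) \<longlonglongrightarrow> herglotz k z"
        unfolding herglotz_def
      proof (rule integral_dominated_convergence[of _ _ _ "\<lambda>\<zeta>. 2 / (1 - cmod z) * \<bar>k \<zeta>\<bar>"])
        show "integrable circle_measure (\<lambda>\<zeta>. 2 / (1 - cmod z) * \<bar>k \<zeta>\<bar>)"
          by (intro integrable_mult_right integrable_abs k)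
        show "AE \<zeta> in circle_measure. (\<lambda>m. (\<zeta> + z) / (\<zeta> - z) * of_real (km m \<zeta>)) \<longlonglongrightarrow> (\<zeta> + z) / (\<zeta> - z) * of_real (k \<zeta>)"
        proof (intro AE_I2 tendsto_intros)
          fix \<zeta>
          obtain N :: nat where N: "- k \<zeta> \<le> real N" using real_arch_simple by blast
          have "\<forall>\<^sub>F m in sequentially. km m \<zeta> = k \<zeta>"
            unfolding eventually_sequentially
          proof (intro exI[of _ N] allI impI)
            fix m assume "N \<le> m"
            then have "- k \<zeta> \<le> real m" using N by simp
            then show "km m \<zeta> = k \<zeta>" by (simp add: km_def)
          qed
          then show "(\<lambda>m. km m \<zeta>) \<longlonglongrightarrow> k \<zeta>" by (rule tendsto_eventually)
        qed
        show "AE \<zeta> in circle_measure. norm ((\<zeta> + z) / (\<zeta> - z) * of_real (km m \<zeta>)) \<le> 2 / (1 - cmod z) * \<bar>k \<zeta>\<bar>" for m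
          using AE_circle
        proof eventually_elim
          case (elim \<zeta>)
          show ?case unfolding norm_mult norm_of_real
            using z1 by (intro mult_mono herglotz_kernel_bound elim kml) auto
        qed
        show "(\<lambda>\<zeta>. (\<zeta> + z) / (\<zeta> - z) * of_real (k \<zeta>)) \<in> borel_measurable circle_measure" by measurable
        show "(\<lambda>\<zeta>. (\<zeta> + z) / (\<zeta> - z) * of_real (km m \<zeta>)) \<in> borel_measurable circle_measure" for m
          unfolding km_def by measurable
      qed
      then have "(\<lambda>m. exp (Re (herglotz k z) - Re (herglotz (km m) z))) \<longlonglongrightarrow> exp (Re (herglotz k z) - Re (herglotz k z))"
        by (intro tendsto_intros)
      then show ?thesis unfolding prod[OF z] by simp
    qed
  qed
qed

section \<open>Embedding the Dirichlet space\<close>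

lemma has_fps_expansion_disk:
  "f holomorphic_on unit_disk \<Longrightarrow> f has_fps_expansion fps_expansion f 0"
  by (rule has_fps_expansion_fps_expansion[of unit_disk]) auto

lemma fps_expansion_mult_disk:
  assumes "f holomorphic_on unit_disk" "g holomorphic_on unit_disk"
  shows "fps_expansion (\<lambda>z. f z * g z) 0 = fps_expansion f 0 * fps_expansion g 0"
  by (intro fps_expansion_eqI has_fps_expansion_mult has_fps_expansion_disk assms)

lemma taylor_cong:
  assumes "f holomorphic_on unit_disk" "\<And>z. z \<in> unit_disk \<Longrightarrow> f z = g z"
  shows "taylor f n = taylor g n"
  using taylor_unique(2)[of "taylor f" g n] taylor_sums[OF assms(1)] assms(2) by simp

text \<open>
  The conjugated coefficients are chosen so that the pairing of an encoded polynomial with \<open>X\<close>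
  is one coefficient of a product of power series; see \<open>circle_ip_rev_poly_limit\<close>.
\<close>

definition cnj_coeffs :: "(complex \<Rightarrow> complex) \<Rightarrow> complex fps" where
  "cnj_coeffs X = Abs_fps (\<lambda>n. cnj (taylor X n))"

text \<open>
  The polynomial encoded by the first \<open>N + 1\<close> coefficients of \<open>q\<close>, cut off outside the disk like
  all elements of the space.
\<close>

definition rev_poly :: "nat \<Rightarrow> complex fps \<Rightarrow> complex \<Rightarrow> complex" where
  "rev_poly N q z = (if z \<in> unit_disk then \<Sum>n\<le>N. fps_nth q (N - n) * z ^ n else 0)"

lemma rev_poly_sums:
  assumes "z \<in> unit_disk"
  shows "(\<lambda>n. (if n \<le> N then fps_nth q (N - n) else 0) * z ^ n) sums rev_poly N q z"
proof -
  have "(\<lambda>n. if n \<in> {..N} then fps_nth q (N - n) * z ^ n else 0) sums (\<Sum>n\<le>N. fps_nth q (N - n) * z ^ n)"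
    by (rule sums_If_finite_set) simp
  moreover have "(\<lambda>n. if n \<in> {..N} then fps_nth q (N - n) * z ^ n else 0) =
      (\<lambda>n. (if n \<le> N then fps_nth q (N - n) else 0) * z ^ n)" by auto
  ultimately show ?thesis using assms by (simp add: rev_poly_def)
qed

lemma rev_poly_hol: "rev_poly N q holomorphic_on unit_disk"
  by (rule taylor_unique(1)[OF rev_poly_sums])

lemma taylor_rev_poly: "taylor (rev_poly N q) n = (if n \<le> N then fps_nth q (N - n) else 0)"
  by (rule taylor_unique(2)[OF rev_poly_sums])

lemma sum_reflect: "(\<Sum>n\<le>N. f (N - n)) = (\<Sum>n\<le>N. f n)" for f :: "nat \<Rightarrow> 'a :: comm_monoid_add"
  by (rule sum.reindex_bij_witness[of _ "\<lambda>n. N - n" "\<lambda>n. N - n"]) auto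

lemma circle_sq_rev_poly: "circle_sq (radius j) (rev_poly N q) \<le> tnorm_sq N q"
proof -
  have "(\<lambda>n. if n \<in> {..N} then (cmod (fps_nth q (N - n)))\<^sup>2 * radius j ^ (2 * n) else 0) sums
     (\<Sum>n\<le>N. (cmod (fps_nth q (N - n)))\<^sup>2 * radius j ^ (2 * n))"
    by (rule sums_If_finite_set) simp
  moreover have "(\<lambda>n. (cmod (taylor (rev_poly N q) n))\<^sup>2 * radius j ^ (2 * n)) =
     (\<lambda>n. if n \<in> {..N} then (cmod (fps_nth q (N - n)))\<^sup>2 * radius j ^ (2 * n) else 0)"
    by (auto simp: taylor_rev_poly)
  ultimately have "circle_sq (radius j) (rev_poly N q) = (\<Sum>n\<le>N. (cmod (fps_nth q (N - n)))\<^sup>2 * radius j ^ (2 * n))"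
    using Parseval_sq[OF rev_poly_hol radius, of N q j] sums_unique2 by simp
  also have "\<dots> \<le> (\<Sum>n\<le>N. (cmod (fps_nth q (N - n)))\<^sup>2)"
  proof (rule sum_mono)
    fix n
    show "(cmod (fps_nth q (N - n)))\<^sup>2 * radius j ^ (2 * n) \<le> (cmod (fps_nth q (N - n)))\<^sup>2"
      using mult_left_mono[OF power_le_one[OF radius(1) less_imp_le[OF radius(2)]] zero_le_power2, of "cmod (fps_nth q (N - n))" j "2 * n"]
      by simp
  qed
  also have "\<dots> = tnorm_sq N q" unfolding tnorm_sq_def by (rule sum_reflect)
  finally show ?thesis .
qed

lemma circle_ip_rev_poly_limit:
  assumes X: "X holomorphic_on unit_disk"
  shows "(\<lambda>j. circle_ip (radius j) (rev_poly N q) X) \<longlonglongrightarrow> fps_nth (q * cnj_coeffs X) N"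
proof -
  define t where "t j n = fps_nth q (N - n) * cnj (taylor X n) * of_real (radius j ^ (2 * n))" for j n
  have "circle_ip (radius j) (rev_poly N q) X = (\<Sum>n\<le>N. t j n)" for j
  proof -
    have "(\<lambda>n. if n \<in> {..N} then t j n else 0) sums (\<Sum>n\<le>N. t j n)"
      by (rule sums_If_finite_set) simp
    moreover have "(\<lambda>n. taylor (rev_poly N q) n * cnj (taylor X n) * of_real (radius j ^ (2 * n))) = (\<lambda>n. if n \<in> {..N} then t j n else 0)"
      by (auto simp: taylor_rev_poly t_def)
    ultimately show ?thesis
      using Parseval[OF rev_poly_hol X radius, of N q j] sums_unique2 by simp
  qed
  moreover have "(\<lambda>j. \<Sum>n\<le>N. t j n) \<longlonglongrightarrow> (\<Sum>n\<le>N. fps_nth q (N - n) * cnj (taylor X n) * of_real (1 ^ (2 * n)))"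
    unfolding t_def by (intro tendsto_intros radius_tendsto)
  moreover have "(\<Sum>n\<le>N. fps_nth q (N - n) * cnj (taylor X n) * of_real (1 ^ (2 * n))) = fps_nth (q * cnj_coeffs X) N"
  proof -
    have "fps_nth (q * cnj_coeffs X) N = (\<Sum>n\<le>N. fps_nth q n * cnj (taylor X (N - n)))"
      unfolding fps_mult_nth cnj_coeffs_def by (simp add: atLeast0AtMost)
    also have "\<dots> = (\<Sum>n\<le>N. fps_nth q (N - n) * cnj (taylor X (N - (N - n))))"
      by (rule sum_reflect[symmetric])
    also have "\<dots> = (\<Sum>n\<le>N. fps_nth q (N - n) * cnj (taylor X n) * of_real (1 ^ (2 * n)))"
      by (intro sum.cong) auto
    finally show ?thesis ..
  qed
  ultimately show ?thesis by simp
qed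

definition hardy_norm :: "(complex \<Rightarrow> complex) \<Rightarrow> real" where
  "hardy_norm f = sqrt (\<Sum>n. (cmod (taylor f n))\<^sup>2)"

text \<open>
  Real Taylor coefficients of \<open>Phi\<close> keep complex conjugation out of the action of the Toeplitz
  operator on reversed coefficients.
\<close>

locale mate_quotient = mate_pair B H ip a K
  for B :: "complex \<Rightarrow> complex" and H :: "(complex \<Rightarrow> complex) set"
    and ip :: "(complex \<Rightarrow> complex) \<Rightarrow> (complex \<Rightarrow> complex) \<Rightarrow> complex"
    and a :: "complex \<Rightarrow> complex" and K :: real +
  fixes Phi :: "complex \<Rightarrow> complex"
  assumes Phi_hol: "Phi holomorphic_on unit_disk"
    and quotient: "z \<in> unit_disk \<Longrightarrow> B z = Phi z * a z"
    and Phi_real: "cnj (taylor Phi n) = taylor Phi n"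
begin

abbreviation \<Phi> :: "complex fps" where "\<Phi> \<equiv> fps_expansion Phi 0"

text \<open>
  The polynomial encoded by \<open>q\<close> is represented by the pair whose second component is encoded by
  \<open>\<Phi> * q\<close>. In the reproducing property the terms \<open>\<langle>p, B k\<rangle>\<close> and \<open>\<langle>T p, a k\<rangle>\<close> cancel: both are the
  same coefficient of a product of power series, because \<open>B = \<Phi> a\<close>.
\<close>

lemma rev_poly_mem:
  shows "rev_poly N q \<in> H" "ip_norm ip (rev_poly N q) \<le> tnorm N q + tnorm N (\<Phi> * q)"
proof -
  define x where "x = rev_poly N q"
  define y where "y = rev_poly N (\<Phi> * q)"
  define M where "M = sqrt (tnorm_sq N q + tnorm_sq N (\<Phi> * q))"
  have M: "0 \<le> M" by (simp add: M_def tnorm_sq_nonneg)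
  have bd: "circle_sq (radius j) x + circle_sq (radius j) y \<le> M\<^sup>2" for j
    using circle_sq_rev_poly[of j N q] circle_sq_rev_poly[of j N "\<Phi> * q"] by (simp add: M_def x_def y_def tnorm_sq_nonneg)
  have lim: "(\<lambda>j. pair_ip j x y (dbr_kernel B w) (mate_part w)) \<longlonglongrightarrow> x w" if w: "w \<in> unit_disk" for w
  proof -
    have ac: "(\<lambda>z. a z * szego w z) holomorphic_on unit_disk" and Bc: "(\<lambda>z. B z * szego w z) holomorphic_on unit_disk"
      by (intro holomorphic_intros a_hol B_hol szego_holomorphic w)+
    have "cnj_coeffs (\<lambda>z. B z * szego w z) = \<Phi> * cnj_coeffs (\<lambda>z. a z * szego w z)"
    proof (rule fps_ext)
      fix n
      have "taylor (\<lambda>z. B z * szego w z) n = taylor (\<lambda>z. Phi z * (a z * szego w z)) n"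
        by (rule taylor_cong[OF Bc]) (simp add: quotient)
      also have "\<dots> = fps_nth (\<Phi> * fps_expansion (\<lambda>z. a z * szego w z) 0) n"
        unfolding taylor_def fps_expansion_mult_disk[OF Phi_hol ac] ..
      finally show "fps_nth (cnj_coeffs (\<lambda>z. B z * szego w z)) n = fps_nth (\<Phi> * cnj_coeffs (\<lambda>z. a z * szego w z)) n"
        using Phi_real by (simp add: cnj_coeffs_def fps_mult_nth taylor_def)
    qed
    then have eq: "q * cnj_coeffs (\<lambda>z. B z * szego w z) = (\<Phi> * q) * cnj_coeffs (\<lambda>z. a z * szego w z)" by (simp add: mult_ac)
    have 1: "(\<lambda>j. circle_ip (radius j) x (szego w)) \<longlonglongrightarrow> x w" unfolding x_def by (rule circle_ip_szego_limit[OF rev_poly_hol w])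
    have 2: "(\<lambda>j. circle_ip (radius j) x (\<lambda>z. B z * szego w z)) \<longlonglongrightarrow> fps_nth (q * cnj_coeffs (\<lambda>z. B z * szego w z)) N"
      unfolding x_def by (rule circle_ip_rev_poly_limit[OF Bc])
    have 3: "(\<lambda>j. circle_ip (radius j) y (\<lambda>z. a z * szego w z)) \<longlonglongrightarrow> fps_nth (q * cnj_coeffs (\<lambda>z. B z * szego w z)) N"
      unfolding y_def eq by (rule circle_ip_rev_poly_limit[OF ac])
    have "pair_ip j x y (dbr_kernel B w) (mate_part w) = circle_ip (radius j) x (szego w) - B w * circle_ip (radius j) x (\<lambda>z. B z * szego w z)
       + B w * circle_ip (radius j) y (\<lambda>z. a z * szego w z)" for j
    proof -
      have "circle_ip (radius j) x (dbr_kernel B w) = circle_ip (radius j) x (kernel_ext w)"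
        by (rule circle_ip_cong[OF _ _ radius]) (simp_all add: kernel_ext_def kernel_on_disk)
      also have "\<dots> = circle_ip (radius j) x (szego w) - B w * circle_ip (radius j) x (\<lambda>z. B z * szego w z)"
        unfolding x_def by (rule circle_ip_kernel_ext_right[OF w rev_poly_hol])
      finally show ?thesis unfolding pair_ip_def mate_part_def[abs_def] circle_ip_scale_right by simp
    qed
    moreover have "(\<lambda>j. circle_ip (radius j) x (szego w) - B w * circle_ip (radius j) x (\<lambda>z. B z * szego w z)
       + B w * circle_ip (radius j) y (\<lambda>z. a z * szego w z)) \<longlonglongrightarrow>
       x w - B w * fps_nth (q * cnj_coeffs (\<lambda>z. B z * szego w z)) N + B w * fps_nth (q * cnj_coeffs (\<lambda>z. B z * szego w z)) N"
      by (intro tendsto_intros 1 2 3)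
    ultimately show ?thesis by simp
  qed
  have x0: "x z = 0" if "z \<notin> unit_disk" for z using that unfolding x_def rev_poly_def by (rule if_not_P)
  have hol: "x holomorphic_on unit_disk" "y holomorphic_on unit_disk" by (simp_all only: x_def y_def rev_poly_hol)
  note r = pair_represents[OF hol M bd x0 lim]
  show "rev_poly N q \<in> H" using r(1) by (simp add: x_def)
  have "ip_norm ip (rev_poly N q) \<le> M" using r(2) by (simp add: x_def)
  also have "M \<le> tnorm N q + tnorm N (\<Phi> * q)"
    unfolding M_def tnorm_def by (rule sqrt_add_le_add_sqrt) (auto simp: tnorm_sq_nonneg)
  finally show "ip_norm ip (rev_poly N q) \<le> tnorm N q + tnorm N (\<Phi> * q)" .
qed

text \<open>
  Apply the estimate to the Taylor polynomials and pass to the pointwise limit.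
\<close>

lemma dirichlet_embeds:
  assumes bd: "\<And>N q. tnorm N (\<Phi> * q) \<le> C * tnorm N q + e * sqrt (tdirichlet_sq N q)"
    and C: "0 \<le> C" and e: "0 \<le> e" and f: "f \<in> dirichlet_space"
  shows "f \<in> H" "ip_norm ip f \<le> (1 + C) * hardy_norm f + e * dirichlet_norm f"
proof -
  have fa: "f \<in> disk_analytic" using f by (simp add: dirichlet_space_def)
  then have hol: "f holomorphic_on unit_disk" and f0: "\<And>z. z \<notin> unit_disk \<Longrightarrow> f z = 0"
    by (auto simp: disk_analytic_def)
  note s = dirichlet_space_summable[OF f]
  have s1: "summable (\<lambda>n. (cmod (taylor f n))\<^sup>2)"
    by (rule summable_comparison_test'[OF s(1), of 0]) (simp add: distrib_right)
  define q where "q N = Abs_fps (\<lambda>i. if i \<le> N then taylor f (N - i) else 0)" for N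
  have hq: "tnorm_sq N (q N) = (\<Sum>n\<le>N. (cmod (taylor f n))\<^sup>2)" for N
    unfolding tnorm_sq_def q_def by (subst sum_reflect[of "\<lambda>n. (cmod (taylor f n))\<^sup>2", symmetric]) (auto intro!: sum.cong)
  have dq: "tdirichlet_sq N (q N) = (\<Sum>n\<le>N. real (n + 1) * (cmod (taylor f n))\<^sup>2)" for N
    unfolding tdirichlet_sq_altdef q_def
    by (subst sum_reflect[of "\<lambda>n. real (n + 1) * (cmod (taylor f n))\<^sup>2", symmetric])
       (auto intro!: sum.cong simp: Suc_diff_le)
  have h: "tnorm N (q N) \<le> hardy_norm f" for N
    unfolding tnorm_def hardy_norm_def hq by (intro real_sqrt_le_mono sum_le_suminf s1) auto
  have D0: "0 \<le> dirichlet_norm f" unfolding dirichlet_norm_def by simp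
  have d: "sqrt (tdirichlet_sq N (q N)) \<le> dirichlet_norm f" for N
  proof (rule real_le_lsqrt[OF D0])
    show "tdirichlet_sq N (q N) \<le> (dirichlet_norm f)\<^sup>2"
      unfolding dq s(2) by (intro sum_le_suminf s(1)) auto
  qed
  define F where "F N = rev_poly N (q N)" for N
  have FH: "F N \<in> H" for N unfolding F_def by (rule rev_poly_mem)
  have Fn: "ip_norm ip (F N) \<le> (1 + C) * hardy_norm f + e * dirichlet_norm f" for N
  proof -
    have "ip_norm ip (F N) \<le> tnorm N (q N) + tnorm N (\<Phi> * q N)" unfolding F_def by (rule rev_poly_mem)
    also have "\<dots> \<le> tnorm N (q N) + (C * tnorm N (q N) + e * sqrt (tdirichlet_sq N (q N)))" using bd by simp
    also have "\<dots> \<le> hardy_norm f + (C * hardy_norm f + e * dirichlet_norm f)"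
      by (intro add_mono mult_left_mono h d C e)
    finally show ?thesis by (simp add: algebra_simps)
  qed
  have Fl: "(\<lambda>N. F N w) \<longlonglongrightarrow> f w" if w: "w \<in> unit_disk" for w
  proof -
    have "F N w = (\<Sum>n\<le>N. taylor f n * w ^ n)" for N
      using w by (simp add: F_def rev_poly_def q_def)
    then show ?thesis using taylor_sums[OF hol w] unfolding sums_def_le by simp
  qed
  show "f \<in> H" "ip_norm ip f \<le> (1 + C) * hardy_norm f + e * dirichlet_norm f"
    using bounded_limit_mem[OF FH Fn f0 Fl] by blast+
qed

end

lemma one_minus_nz: "z \<in> unit_disk \<Longrightarrow> 1 - z \<noteq> (0 :: complex)"
  by auto

lemma one_minus_Re: "z \<in> unit_disk \<Longrightarrow> 0 < Re (1 - z)"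
  using complex_Re_le_cmod[of z] by simp

lemma one_minus_nonpos: "z \<in> unit_disk \<Longrightarrow> 1 - z \<notin> \<real>\<^sub>\<le>\<^sub>0"
  using one_minus_Re[of z] by (auto simp: complex_nonpos_Reals_iff)

lemma theta_hol: "theta holomorphic_on unit_disk"
  unfolding theta_def[abs_def] by (intro holomorphic_intros) (use one_minus_nz in auto)

lemma powr_hol: "(\<lambda>z. (1 - z) powr of_real c) holomorphic_on unit_disk"
  by (intro holomorphic_intros one_minus_nonpos)

lemma phi_hol: "phi c holomorphic_on unit_disk"
  unfolding phi_def[abs_def] by (intro holomorphic_intros powr_hol) (use one_minus_nz in auto)

lemma inverse_expansion: "fps_expansion (\<lambda>z. 1 / (1 - z)) 0 = inverse (1 - fps_X :: complex fps)"
proof -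
  have "(\<lambda>z :: complex. 1 - z) has_fps_expansion 1 - fps_X" by (intro fps_expansion_intros)
  then have "(\<lambda>z :: complex. inverse (1 - z)) has_fps_expansion inverse (1 - fps_X)"
    by (intro has_fps_expansion_inverse) auto
  then show ?thesis by (intro fps_expansion_eqI) (simp add: inverse_eq_divide)
qed

lemma theta_expansion: "fps_expansion theta 0 = singular_fps 1"
proof (rule fps_expansion_eqI)
  have inv: "(\<lambda>z :: complex. 1 / (1 - z)) has_fps_expansion inverse (1 - fps_X)"
    unfolding inverse_expansion[symmetric] by (rule has_fps_expansion_disk) (intro holomorphic_intros one_minus_nz)
  have geo_inv: "fps_X * inverse (1 - fps_X) = (geo :: complex fps)"
  proof -
    have i: "(1 - fps_X) * inverse (1 - fps_X) = (1 :: complex fps)"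
      by (subst mult.commute, rule inverse_mult_eq_1) simp
    have "fps_X * inverse (1 - fps_X) = ((1 - fps_X) * geo) * inverse (1 - fps_X)" unfolding geo_eq ..
    also have "\<dots> = geo * ((1 - fps_X) * inverse (1 - fps_X))" by (simp only: mult_ac)
    finally show ?thesis unfolding i by simp
  qed
  have g: "(\<lambda>z :: complex. z * (1 / (1 - z))) has_fps_expansion geo"
    unfolding geo_inv[symmetric] by (intro has_fps_expansion_mult inv fps_expansion_intros)
  have "((\<lambda>x. exp (-1 * x)) \<circ> (\<lambda>z :: complex. z * (1 / (1 - z)))) has_fps_expansion (fps_exp (-1) oo geo)"
    by (rule has_fps_expansion_compose[OF has_fps_expansion_exp g]) simp
  then have "(\<lambda>z. exp (-1/2) * ((\<lambda>x. exp (-1 * x)) \<circ> (\<lambda>z :: complex. z * (1 / (1 - z)))) z) has_fps_expansion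
      fps_const (exp (-1/2)) * (fps_exp (-1) oo geo)"
    by (intro has_fps_expansion_mult has_fps_expansion_const)
  moreover have "fps_const (exp (-1/2)) * (fps_exp (-1) oo geo) = singular_fps 1"
    by (simp add: singular_fps_def)
  moreover have "\<forall>\<^sub>F z in nhds 0. exp (-1/2) * ((\<lambda>x. exp (-1 * x)) \<circ> (\<lambda>z :: complex. z * (1 / (1 - z)))) z = theta z"
  proof (rule eventually_mono)
    show "\<forall>\<^sub>F z in nhds 0. z \<in> (unit_disk :: complex set)" by (rule eventually_nhds_in_open) auto
    fix z :: complex assume z: "z \<in> unit_disk"
    have "- (1 / 2) * ((1 + z) / (1 - z)) = -1/2 + -1 * (z * (1 / (1 - z)))"
      using one_minus_nz[OF z] by (simp add: field_simps)
    then show "exp (-1/2) * ((\<lambda>x. exp (-1 * x)) \<circ> (\<lambda>z. z * (1 / (1 - z)))) z = theta z"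
      unfolding theta_def by (simp only: exp_add o_def)
  qed
  ultimately show "theta has_fps_expansion singular_fps 1"
    by (simp only: has_fps_expansion_cong[OF _ refl])
qed

lemma powr_expansion: "fps_expansion (\<lambda>z. (1 - z) powr of_real \<gamma>) 0 = binom_fps \<gamma>"
proof (rule fps_ext)
  fix n
  have real: "(complex_of_real \<gamma> gchoose k) = of_real (\<gamma> gchoose k)" for k
    by (simp add: gbinomial_prod_rev)
  have "(\<lambda>k. fps_nth (binom_fps \<gamma>) k * z ^ k) sums ((1 - z) powr of_real \<gamma>)" if "z \<in> unit_disk" for z
  proof -
    have "(\<lambda>k. (complex_of_real \<gamma> gchoose k) * (- z) ^ k) sums (1 + - z) powr of_real \<gamma>"
      by (rule gen_binomial_complex) (use that in simp)
    then show ?thesis by (simp add: binom_fps_def real power_minus[of z] mult_ac)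
  qed
  then show "fps_nth (fps_expansion (\<lambda>z. (1 - z) powr of_real \<gamma>) 0) n = fps_nth (binom_fps \<gamma>) n"
    using taylor_unique(2)[of "fps_nth (binom_fps \<gamma>)"] by (simp add: taylor_def)
qed

text \<open>
  Factor \<open>phi c\<close> as \<open>(1 - z) powr (1 - c)\<close> over \<open>1 - z\<close>; the division by \<open>1 - z\<close> is what
  \<open>singular_fps_bound\<close> absorbs.
\<close>

lemma phi_expansion: "fps_expansion (phi c) 0 = inverse (1 - fps_X) * binom_fps (1 - c)"
proof -
  have hol: "(\<lambda>z. 1 / (1 - z)) holomorphic_on unit_disk" by (intro holomorphic_intros one_minus_nz)
  have "fps_expansion (phi c) 0 = fps_expansion (\<lambda>z. 1 / (1 - z) * (1 - z) powr of_real (1 - c)) 0"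
  proof (rule fps_ext)
    fix n
    have "taylor (phi c) n = taylor (\<lambda>z. 1 / (1 - z) * (1 - z) powr of_real (1 - c)) n"
    proof (rule taylor_cong[OF phi_hol])
      fix z :: complex assume "z \<in> unit_disk"
      then have "1 - z \<noteq> 0" by (rule one_minus_nz)
      then show "phi c z = 1 / (1 - z) * (1 - z) powr of_real (1 - c)"
        by (simp add: phi_def powr_diff)
    qed
    then show "fps_nth (fps_expansion (phi c) 0) n = fps_nth (fps_expansion (\<lambda>z. 1 / (1 - z) * (1 - z) powr of_real (1 - c)) 0) n"
      by (simp add: taylor_def)
  qed
  also have "\<dots> = inverse (1 - fps_X) * binom_fps (1 - c)"
    unfolding fps_expansion_mult_disk[OF hol powr_hol] inverse_expansion powr_expansion ..
  finally show ?thesis .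
qed

definition real_fps :: "complex fps \<Rightarrow> bool" where
  "real_fps F \<longleftrightarrow> (\<forall>n. fps_nth F n \<in> \<real>)"

lemma real_fps_mult: "real_fps F \<Longrightarrow> real_fps G \<Longrightarrow> real_fps (F * G)"
  by (auto simp: real_fps_def fps_mult_nth intro!: sum_in_Reals)

lemma real_fps_power: "real_fps F \<Longrightarrow> real_fps (F ^ n)"
proof (induction n)
  case 0
  show ?case by (simp add: real_fps_def)
next
  case (Suc n)
  then show ?case unfolding power_Suc by (intro real_fps_mult)
qed

lemma real_fps_singular_fps: "real_fps (singular_fps x)"
proof -
  have g: "real_fps (geo ^ n)" for n by (rule real_fps_power) (simp add: real_fps_def)
  have "exp (- complex_of_real x / 2) = of_real (exp (- x / 2))" by (simp add: exp_of_real[symmetric])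
  then have "real_fps (fps_const (exp (- complex_of_real x / 2)))" by (auto simp: real_fps_def simp del: of_real_exp)
  moreover have "real_fps (fps_exp (- complex_of_real x) oo geo)"
  proof -
    have "(- complex_of_real x) ^ i / fact i = of_real ((- x) ^ i / fact i)" for i by simp
    then have "(- complex_of_real x) ^ i / fact i \<in> \<real>" for i by (metis Reals_of_real)
    then have "fps_nth (fps_exp (- complex_of_real x)) i \<in> \<real>" for i by (simp only: fps_exp_nth of_nat_fact)
    then show ?thesis
      using g unfolding real_fps_def fps_compose_nth by (blast intro: sum_in_Reals Reals_mult)
  qed
  ultimately show ?thesis unfolding singular_fps_def by (rule real_fps_mult)
qed

lemma Phi_coeff_real: "cnj (taylor (\<lambda>z. theta z * phi c z) n) = taylor (\<lambda>z. theta z * phi c z) n"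
proof -
  have i: "(1 - fps_X) * inverse (1 - fps_X) = (1 :: complex fps)"
    by (subst mult.commute, rule inverse_mult_eq_1) simp
  have "Abs_fps (\<lambda>_. 1) * (1 - fps_X) = (1 :: complex fps)"
    by (rule fps_ext) (simp add: algebra_simps)
  then have "inverse (1 - fps_X) = (Abs_fps (\<lambda>_. 1) * (1 - fps_X)) * (inverse (1 - fps_X) :: complex fps)" by simp
  also have "\<dots> = Abs_fps (\<lambda>_. 1)" unfolding mult.assoc i by simp
  finally have "real_fps (inverse (1 - fps_X))" by (simp add: real_fps_def)
  moreover have "real_fps (binom_fps (1 - c))" by (simp add: real_fps_def binom_fps_def)
  ultimately have "real_fps (singular_fps 1 * (inverse (1 - fps_X) * binom_fps (1 - c)))"
    by (intro real_fps_mult real_fps_singular_fps)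
  then show ?thesis
    unfolding taylor_def fps_expansion_mult_disk[OF theta_hol phi_hol] theta_expansion phi_expansion
    by (simp add: real_fps_def Reals_cnj_iff)
qed

lemma Phi_bound_critical:
  "tnorm N (fps_expansion (\<lambda>z. theta z * phi 1 z) 0 * q) \<le> sqrt (tdirichlet_sq N q)"
proof -
  have i: "(1 - fps_X) * inverse (1 - fps_X) = (1 :: complex fps)"
    by (subst mult.commute, rule inverse_mult_eq_1) simp
  have "binom_fps (1 - 1) = 1"
    by (rule fps_ext) (simp add: binom_fps_def gbinomial_0_left)
  then have e: "fps_expansion (\<lambda>z. theta z * phi 1 z) 0 * q = singular_fps 1 * (inverse (1 - fps_X) * q)"
    unfolding fps_expansion_mult_disk[OF theta_hol phi_hol] theta_expansion phi_expansion by (simp add: mult.assoc)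
  have 2: "(1 - fps_X) * (inverse (1 - fps_X) * q) = q" unfolding mult.assoc[symmetric] i by simp
  show ?thesis
    unfolding e tnorm_def by (rule real_sqrt_le_mono) (use singular_fps_bound[of N "inverse (1 - fps_X) * q"] in \<open>simp only: 2\<close>)
qed

text \<open>
  Interpolation between the critical bound for \<open>theta / (1 - z)\<close> and the contractivity of \<open>theta\<close>.
\<close>

lemma Phi_bound_subcritical:
  assumes c: "0 < c" "c < 1" and e: "0 < e"
  shows "\<exists>C\<ge>0. \<forall>N q. tnorm N (fps_expansion (\<lambda>z. theta z * phi c z) 0 * q) \<le> C * tnorm N q + e * sqrt (tdirichlet_sq N q)"
proof -
  define A where "A = binom_fps (1 - c)"
  obtain J where J: "cmod (\<Sum>j\<le>J. fps_nth A j) \<le> e / 2" "\<And>N. (\<Sum>j\<in>{J<..N}. cmod (fps_nth A j)) \<le> e / 2"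
    using binom_fps_partial[of "1 - c" "e / 2"] c e unfolding A_def by auto
  define C where "C = (\<Sum>j\<le>J. real j * cmod (fps_nth A j))"
  have C: "0 \<le> C" unfolding C_def by (intro sum_nonneg) auto
  have i: "(1 - fps_X) * inverse (1 - fps_X) = (1 :: complex fps)"
    by (subst mult.commute, rule inverse_mult_eq_1) simp
  have "tnorm N (fps_expansion (\<lambda>z. theta z * phi c z) 0 * q) \<le> C * tnorm N q + e * sqrt (tdirichlet_sq N q)" for N q
  proof -
    define Y where "Y = singular_fps 1 * (inverse (1 - fps_X) * q)"
    have eq: "fps_expansion (\<lambda>z. theta z * phi c z) 0 * q = A * Y"
      unfolding fps_expansion_mult_disk[OF theta_hol phi_hol] theta_expansion phi_expansion A_def Y_def by (simp only: mult_ac)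
    have 1: "(1 - fps_X) * Y = singular_fps 1 * q"
    proof -
      have "(1 - fps_X) * Y = singular_fps 1 * ((1 - fps_X) * inverse (1 - fps_X)) * q" unfolding Y_def by (simp only: mult_ac)
      then show ?thesis unfolding i by simp
    qed
    have 2: "(1 - fps_X) * (inverse (1 - fps_X) * q) = q" unfolding mult.assoc[symmetric] i by simp
    have "tnorm N (A * Y) \<le> C * tnorm N ((1 - fps_X) * Y) + 2 * (e / 2) * tnorm N Y"
      unfolding C_def by (rule interpolation[OF J])
    also have "\<dots> \<le> C * tnorm N q + 2 * (e / 2) * sqrt (tdirichlet_sq N q)"
    proof (intro add_mono mult_left_mono C)
      show "tnorm N ((1 - fps_X) * Y) \<le> tnorm N q" unfolding 1 tnorm_def by (intro real_sqrt_le_mono singular_fps_contraction)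
      show "tnorm N Y \<le> sqrt (tdirichlet_sq N q)"
        unfolding Y_def tnorm_def
        by (rule real_sqrt_le_mono) (use singular_fps_bound[of N "inverse (1 - fps_X) * q"] in \<open>simp only: 2\<close>)
    qed (use e in simp)
    finally show ?thesis unfolding eq by simp
  qed
  then show ?thesis using C by blast
qed

section \<open>Compactness of the embedding\<close>

lemma dirichlet_hol: "f \<in> dirichlet_space \<Longrightarrow> f holomorphic_on unit_disk"
  by (auto simp: dirichlet_space_def disk_analytic_def)

lemma taylor_diff:
  assumes f: "f holomorphic_on unit_disk" and g: "g holomorphic_on unit_disk"
  shows "taylor (\<lambda>z. f z - g z) n = taylor f n - taylor g n"
proof (rule taylor_unique(2))
  fix z :: complex assume "z \<in> unit_disk"
  from sums_diff[OF taylor_sums[OF f this] taylor_sums[OF g this]]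
  show "(\<lambda>n. (taylor f n - taylor g n) * z ^ n) sums (f z - g z)" by (simp add: algebra_simps)
qed

lemma dirichlet_norm_nonneg: "0 \<le> dirichlet_norm f"
  by (simp add: dirichlet_norm_def)

lemma dirichlet_diff:
  assumes f: "f \<in> dirichlet_space" "dirichlet_norm f \<le> 1" and g: "g \<in> dirichlet_space" "dirichlet_norm g \<le> 1"
  shows "(\<lambda>z. f z - g z) \<in> dirichlet_space" "dirichlet_norm (\<lambda>z. f z - g z) \<le> 2"
proof -
  note hf = dirichlet_hol[OF f(1)] and hg = dirichlet_hol[OF g(1)]
  note sf = dirichlet_space_summable[OF f(1)] and sg = dirichlet_space_summable[OF g(1)]
  let ?h = "\<lambda>z. f z - g z"
  let ?F = "\<lambda>n. 2 * (real (n + 1) * (cmod (taylor f n))\<^sup>2) + 2 * (real (n + 1) * (cmod (taylor g n))\<^sup>2)"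
  have ha: "?h \<in> disk_analytic"
    using f(1) g(1) unfolding dirichlet_space_def disk_analytic_def by (auto intro!: holomorphic_on_diff)
  have le: "real (n + 1) * (cmod (taylor ?h n))\<^sup>2 \<le> ?F n" for n
  proof -
    have "(cmod (taylor f n - taylor g n))\<^sup>2 \<le> (cmod (taylor f n) + cmod (taylor g n))\<^sup>2"
      by (intro power_mono norm_triangle_ineq4) simp
    also have "\<dots> \<le> 2 * (cmod (taylor f n))\<^sup>2 + 2 * (cmod (taylor g n))\<^sup>2"
      using zero_le_power2[of "cmod (taylor f n) - cmod (taylor g n)"] unfolding power2_sum power2_diff by linarith
    finally have "real (n + 1) * (cmod (taylor f n - taylor g n))\<^sup>2 \<le> real (n + 1) * (2 * (cmod (taylor f n))\<^sup>2 + 2 * (cmod (taylor g n))\<^sup>2)"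
      by (intro mult_left_mono) auto
    then show ?thesis unfolding taylor_diff[OF hf hg] by (simp add: algebra_simps)
  qed
  have sF: "summable ?F" by (intro summable_add summable_mult sf sg)
  have s: "summable (\<lambda>n. real (n + 1) * (cmod (taylor ?h n))\<^sup>2)"
    by (rule summable_comparison_test'[OF sF, of 0]) (use le in \<open>simp add: abs_mult\<close>)
  show "?h \<in> dirichlet_space" by (rule dirichlet_spaceI(1)[OF ha summable_sums[OF s]])
  have "(\<Sum>n. real (n + 1) * (cmod (taylor ?h n))\<^sup>2) \<le> suminf ?F" by (rule suminf_le[OF le s sF])
  also have "suminf ?F = 2 * (dirichlet_norm f)\<^sup>2 + 2 * (dirichlet_norm g)\<^sup>2"
    unfolding sf(2) sg(2)
    by (subst suminf_add[symmetric], (intro summable_mult sf sg)+, subst suminf_mult[OF sf(1)], subst suminf_mult[OF sg(1)]) simp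
  also have "\<dots> \<le> 2 * 1 + 2 * 1"
    using power_le_one[OF dirichlet_norm_nonneg f(2), of 2] power_le_one[OF dirichlet_norm_nonneg g(2), of 2] by simp
  finally have "(\<Sum>n. real (n + 1) * (cmod (taylor ?h n))\<^sup>2) \<le> 2\<^sup>2" by simp
  then have "sqrt (\<Sum>n. real (n + 1) * (cmod (taylor ?h n))\<^sup>2) \<le> 2" by (intro real_le_lsqrt) auto
  then show "dirichlet_norm ?h \<le> 2" unfolding dirichlet_spaceI(2)[OF ha summable_sums[OF s]] .
qed

lemma dirichlet_coeff_bound:
  assumes f: "f \<in> dirichlet_space"
  shows "cmod (taylor f n) \<le> dirichlet_norm f"
proof -
  note s = dirichlet_space_summable[OF f]
  have "(cmod (taylor f n))\<^sup>2 \<le> real (n + 1) * (cmod (taylor f n))\<^sup>2" by (simp add: distrib_right)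
  also have "\<dots> = (\<Sum>i\<in>{n}. real (i + 1) * (cmod (taylor f i))\<^sup>2)" by simp
  also have "\<dots> \<le> (dirichlet_norm f)\<^sup>2" unfolding s(2) by (rule sum_le_suminf[OF s(1)]) auto
  finally show ?thesis by (rule power2_le_imp_le[OF _ dirichlet_norm_nonneg])
qed

text \<open>
  Coefficients of index below \<open>M\<close> are bounded by the mean over the circle of radius one half, at
  the cost of a factor \<open>4 ^ M\<close>; the others are bounded by the Dirichlet norm with a gain of
  \<open>M + 1\<close>.
\<close>

lemma hardy_norm_tail:
  assumes f: "f \<in> dirichlet_space" and D: "dirichlet_norm f \<le> 2"
    and small: "\<And>z. cmod z \<le> 1/2 \<Longrightarrow> cmod (f z) \<le> \<delta>"
  shows "(hardy_norm f)\<^sup>2 \<le> 4 ^ M * \<delta>\<^sup>2 + 4 / real (M + 1)"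
proof -
  note s = dirichlet_space_summable[OF f] and hol = dirichlet_hol[OF f]
  have half: "(0::real) \<le> 1/2" "(1/2::real) < 1" by auto
  have s1: "summable (\<lambda>n. (cmod (taylor f n))\<^sup>2)"
    by (rule summable_comparison_test'[OF s(1), of 0]) (simp add: distrib_right)
  note P = Parseval_sq[OF hol half]
  let ?G = "\<lambda>n. 4 ^ M * ((cmod (taylor f n))\<^sup>2 * (1/2) ^ (2 * n)) + (real (n + 1) * (cmod (taylor f n))\<^sup>2) / real (M + 1)"
  have sG: "?G sums (4 ^ M * circle_sq (1/2) f + (dirichlet_norm f)\<^sup>2 / real (M + 1))"
    unfolding s(2) by (intro sums_add sums_mult sums_divide P summable_sums s(1))
  have le: "(cmod (taylor f n))\<^sup>2 \<le> ?G n" for n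
  proof (cases "n < M")
    case True
    have "(1::real) \<le> 4 ^ M * (1/2) ^ (2 * n)"
    proof -
      have "(1/2::real) ^ (2 * n) = 1 / 4 ^ n" by (simp add: power_mult power_one_over)
      moreover have "(4::real) ^ n \<le> 4 ^ M" using True by (intro power_increasing) auto
      ultimately show ?thesis by simp
    qed
    from mult_right_mono[OF this, of "(cmod (taylor f n))\<^sup>2"]
    have "(cmod (taylor f n))\<^sup>2 \<le> 4 ^ M * ((cmod (taylor f n))\<^sup>2 * (1/2) ^ (2 * n))" by (simp add: mult_ac)
    then show ?thesis by (rule order_trans) simp
  next
    case False
    then have "1 \<le> real (n + 1) / real (M + 1)" by simp
    from mult_right_mono[OF this, of "(cmod (taylor f n))\<^sup>2"]
    have "(cmod (taylor f n))\<^sup>2 \<le> (real (n + 1) * (cmod (taylor f n))\<^sup>2) / real (M + 1)" by simp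
    then show ?thesis by (rule order_trans) simp
  qed
  have "(hardy_norm f)\<^sup>2 = (\<Sum>n. (cmod (taylor f n))\<^sup>2)"
    unfolding hardy_norm_def by (simp add: suminf_nonneg s1)
  also have "\<dots> \<le> 4 ^ M * circle_sq (1/2) f + (dirichlet_norm f)\<^sup>2 / real (M + 1)"
    by (rule sums_le[OF le summable_sums[OF s1] sG])
  also have "\<dots> \<le> 4 ^ M * \<delta>\<^sup>2 + 4 / real (M + 1)"
  proof (intro add_mono mult_left_mono divide_right_mono)
    show "circle_sq (1/2) f \<le> \<delta>\<^sup>2"
      by (rule circle_sq_bound_circle[OF hol half]) (intro small, simp add: norm_mult)
    show "(dirichlet_norm f)\<^sup>2 \<le> 4" using power_mono[OF D dirichlet_norm_nonneg, of 2] by simp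
  qed auto
  finally show ?thesis .
qed

text \<open>
  The unit ball of the Dirichlet space is a normal family, because its Taylor coefficients are
  bounded by one.
\<close>

lemma dirichlet_ball_Montel:
  assumes \<sigma>: "\<And>n::nat. \<sigma> n \<in> dirichlet_space" "\<And>n. dirichlet_norm (\<sigma> n) \<le> 1"
  obtains r :: "nat \<Rightarrow> nat" and g where "strict_mono r" "uniform_limit (cball 0 (1/2)) (\<sigma> \<circ> r) g sequentially"
proof -
  have bound: "\<exists>C. \<forall>h\<in>{f \<in> dirichlet_space. dirichlet_norm f \<le> 1}. \<forall>z\<in>X. cmod (h z) \<le> C"
    if X: "compact X" "X \<subseteq> unit_disk" for X
  proof (cases "X = {}")
    case False
    obtain y where y: "y \<in> X" "\<And>z. z \<in> X \<Longrightarrow> cmod z \<le> cmod y"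
      using continuous_attains_sup[OF X(1) False, of cmod] continuous_on_norm_id by auto
    have y1: "cmod y < 1" using y X by auto
    have "cmod (h z) \<le> 1 / (1 - cmod y)" if h: "h \<in> dirichlet_space" "dirichlet_norm h \<le> 1" and z: "z \<in> X" for h z
    proof -
      have zd: "z \<in> unit_disk" using z X by auto
      have "cmod (taylor h n * z ^ n) \<le> cmod y ^ n" for n
      proof -
        have "cmod (taylor h n) * cmod z ^ n \<le> 1 * cmod y ^ n"
          using order_trans[OF dirichlet_coeff_bound[OF h(1)] h(2)] y(2)[OF z] by (intro mult_mono power_mono) auto
        then show ?thesis by (simp add: norm_mult norm_power)
      qed
      moreover have "(\<lambda>n. cmod y ^ n) sums (1 / (1 - cmod y))" by (rule geometric_sums) (simp add: y1)
      moreover have "(\<lambda>n. taylor h n * z ^ n) sums h z" by (rule taylor_sums[OF dirichlet_hol[OF h(1)] zd])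
      ultimately show ?thesis using norm_suminf_le[of "\<lambda>n. taylor h n * z ^ n" "\<lambda>n. cmod y ^ n"] by (simp add: sums_iff)
    qed
    then show ?thesis by blast
  qed simp
  show ?thesis
  proof (rule Montel[of unit_disk "{f \<in> dirichlet_space. dirichlet_norm f \<le> 1}" \<sigma>])
    show "h holomorphic_on unit_disk" if "h \<in> {f \<in> dirichlet_space. dirichlet_norm f \<le> 1}" for h
      using that dirichlet_hol by simp
    show "range \<sigma> \<subseteq> {f \<in> dirichlet_space. dirichlet_norm f \<le> 1}" using \<sigma> by auto
    fix g and r :: "nat \<Rightarrow> nat"
    assume r: "strict_mono r" and lim: "\<And>X. compact X \<Longrightarrow> X \<subseteq> unit_disk \<Longrightarrow> uniform_limit X (\<sigma> \<circ> r) g sequentially"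
    have "cball 0 (1/2) \<subseteq> (unit_disk :: complex set)" by auto
    from that[OF r lim[OF compact_cball this]] show ?thesis .
  qed (use bound in auto)
qed

context mate_pair
begin

text \<open>
  A sequence in the unit ball has a subsequence that converges locally uniformly, hence in the
  Hardy norm by \<open>hardy_norm_tail\<close>; the estimate makes it a Cauchy sequence in the space.
\<close>

lemma compact_inclusion_of_interpolation:
  assumes sub: "dirichlet_space \<subseteq> H"
    and est: "\<And>e. 0 < e \<Longrightarrow> \<exists>C\<ge>0. \<forall>f\<in>dirichlet_space. ip_norm ip f \<le> C * hardy_norm f + e * dirichlet_norm f"
  shows "compact_inclusion dirichlet_space dirichlet_norm H ip"
proof -
  interpret M: Metric_space H "ip_dist H ip" by (rule metric)
  let ?S = "{f \<in> dirichlet_space. dirichlet_norm f \<le> 1}"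
  have "\<exists>r. strict_mono r \<and> M.MCauchy (\<sigma> \<circ> r)" if \<sigma>: "range \<sigma> \<subseteq> ?S" for \<sigma> :: "nat \<Rightarrow> complex \<Rightarrow> complex"
  proof -
    have D: "\<sigma> n \<in> dirichlet_space" "dirichlet_norm (\<sigma> n) \<le> 1" for n using \<sigma> by auto
    obtain r g where r: "strict_mono r" and lim: "uniform_limit (cball 0 (1/2)) (\<sigma> \<circ> r) g sequentially"
      by (rule dirichlet_ball_Montel[of \<sigma>, OF D])
    have "M.MCauchy (\<sigma> \<circ> r)"
    proof (rule MCauchyI)
      show "(\<sigma> \<circ> r) n \<in> H" for n using D(1) sub by auto
      fix e :: real assume e: "0 < e"
      obtain C where C: "0 \<le> C" "\<And>f. f \<in> dirichlet_space \<Longrightarrow> ip_norm ip f \<le> C * hardy_norm f + e / 8 * dirichlet_norm f"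
        using est[of "e / 8"] e by auto
      \<comment> \<open>Hardy distance \<open>\<eta>\<close> suffices; \<open>M\<close> and \<open>\<delta>\<close> make the two terms of \<open>hardy_norm_tail\<close> at most \<open>\<eta>\<^sup>2 / 2\<close> each.\<close>
      define \<eta> where "\<eta> = e / (2 * (C + 1))"
      have \<eta>: "0 < \<eta>" using e C by (simp add: \<eta>_def)
      obtain M :: nat where M: "8 / \<eta>\<^sup>2 < real M" using reals_Archimedean2 by blast
      have M2: "4 / real (M + 1) \<le> \<eta>\<^sup>2 / 2"
      proof -
        have "8 < real M * \<eta>\<^sup>2" using M \<eta> by (simp add: divide_less_eq)
        also have "\<dots> \<le> real (M + 1) * \<eta>\<^sup>2" by (intro mult_right_mono) auto
        finally show ?thesis by (simp add: field_simps)
      qed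
      define \<delta> where "\<delta> = \<eta> / (2 * 2 ^ M)"
      have \<delta>: "0 < \<delta>" using \<eta> by (simp add: \<delta>_def)
      have \<delta>2: "4 ^ M * \<delta>\<^sup>2 \<le> \<eta>\<^sup>2 / 2"
      proof -
        have "(4::real) ^ M = (2 ^ M)\<^sup>2" by (simp add: power2_eq_square power_mult_distrib[symmetric])
        then have "4 ^ M * \<delta>\<^sup>2 = \<eta>\<^sup>2 / 4" unfolding \<delta>_def by (simp add: power_divide power_mult_distrib)
        then show ?thesis using zero_le_power2[of \<eta>] by linarith
      qed
      have "0 < \<delta> / 2" using \<delta> by simp
      from uniform_limitD[OF lim this] obtain N where
        N0: "\<forall>n\<ge>N. \<forall>x\<in>cball 0 (1/2). dist ((\<sigma> \<circ> r) n x) (g x) < \<delta> / 2"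
        unfolding eventually_sequentially by blast
      have N: "dist ((\<sigma> \<circ> r) n z) (g z) < \<delta> / 2" if "N \<le> n" "cmod z \<le> 1/2" for n z
        by (rule N0[rule_format, OF that(1)]) (use that(2) in simp)
      have "ip_norm ip (\<lambda>z. (\<sigma> \<circ> r) m z - (\<sigma> \<circ> r) n z) < e" if mn: "N \<le> m" "N \<le> n" for m n
      proof -
        define h where "h = (\<lambda>z. (\<sigma> \<circ> r) m z - (\<sigma> \<circ> r) n z)"
        have h: "h \<in> dirichlet_space" "dirichlet_norm h \<le> 2"
          unfolding h_def o_def by (rule dirichlet_diff[OF D D])+
        have "cmod (h z) \<le> \<delta>" if z: "cmod z \<le> 1/2" for z
        proof -
          have "cmod (h z) = dist ((\<sigma> \<circ> r) m z) ((\<sigma> \<circ> r) n z)" by (simp add: h_def dist_norm)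
          also have "\<dots> \<le> dist ((\<sigma> \<circ> r) m z) (g z) + dist ((\<sigma> \<circ> r) n z) (g z)" by (rule dist_triangle2)
          finally show ?thesis using N[OF mn(1) z] N[OF mn(2) z] by simp
        qed
        then have "(hardy_norm h)\<^sup>2 \<le> 4 ^ M * \<delta>\<^sup>2 + 4 / real (M + 1)" by (rule hardy_norm_tail[OF h])
        also have "\<dots> \<le> \<eta>\<^sup>2" using \<delta>2 M2 by simp
        finally have hh: "hardy_norm h \<le> \<eta>" by (rule power2_le_imp_le) (use \<eta> in simp)
        have "ip_norm ip h \<le> C * hardy_norm h + e / 8 * dirichlet_norm h" by (rule C(2)[OF h(1)])
        also have "\<dots> \<le> C * \<eta> + e / 8 * 2" using hh h(2) C(1) e by (intro add_mono mult_left_mono) auto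
        also have "C * \<eta> \<le> (C + 1) * \<eta>" using \<eta> by simp
        also have "(C + 1) * \<eta> = e / 2"
        proof -
          have "x * (e / (2 * x)) = e / 2" if "x \<noteq> 0" for x :: real using that by simp
          from this[of "C + 1"] show ?thesis using C(1) unfolding \<eta>_def by linarith
        qed
        finally show ?thesis using e by (simp add: h_def)
      qed
      then show "\<exists>N. \<forall>m\<ge>N. \<forall>n\<ge>N. ip_norm ip (\<lambda>z. (\<sigma> \<circ> r) m z - (\<sigma> \<circ> r) n z) < e" by blast
    qed
    then show ?thesis using r by blast
  qed
  then have "M.mtotally_bounded ?S"
    unfolding M.mtotally_bounded_sequentially using sub by blast
  then show ?thesis
    unfolding compact_inclusion_def using M.mtotally_bounded_eq_compact_closure_of[OF complete] by blast
qed

text \<open>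
  A norm convergent subsequence would have to tend to the pointwise limit zero.
\<close>

lemma not_compact_inclusion:
  assumes sub: "dirichlet_space \<subseteq> H"
    and F: "\<And>n::nat. F n \<in> dirichlet_space" "\<And>n. dirichlet_norm (F n) \<le> 1"
    and \<kappa>: "0 < \<kappa>" "\<And>n. \<kappa> \<le> ip_norm ip (F n)"
    and null: "\<And>z. z \<in> unit_disk \<Longrightarrow> (\<lambda>n. F n z) \<longlonglongrightarrow> 0"
  shows "\<not> compact_inclusion dirichlet_space dirichlet_norm H ip"
proof
  interpret M: Metric_space H "ip_dist H ip" by (rule metric)
  let ?S = "{f \<in> dirichlet_space. dirichlet_norm f \<le> 1}"
  assume "compact_inclusion dirichlet_space dirichlet_norm H ip"
  then have "M.mtotally_bounded ?S"
    unfolding compact_inclusion_def using sub by (intro M.compact_closure_of_imp_mtotally_bounded) auto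
  moreover have "range F \<subseteq> ?S" using F by auto
  ultimately obtain r where r: "strict_mono r" and cau: "M.MCauchy (F \<circ> r)"
    unfolding M.mtotally_bounded_sequentially by blast
  obtain f where "limitin M.mtopology (F \<circ> r) f sequentially"
    using complete cau unfolding M.mcomplete_def by blast
  moreover have FH: "(F \<circ> r) n \<in> H" for n using F sub by auto
  ultimately have f: "f \<in> H" and lim: "(\<lambda>n. ip_norm ip (\<lambda>z. (F \<circ> r) n z - f z)) \<longlonglongrightarrow> 0"
    using limitin_iff[OF FH] by auto
  have "f z = 0" for z
  proof (cases "z \<in> unit_disk")
    case True
    have "(\<lambda>n. (F \<circ> r) n z) \<longlonglongrightarrow> f z" by (rule norm_limit_pointwise[OF FH f lim True])
    moreover have "(\<lambda>n. (F \<circ> r) n z) \<longlonglongrightarrow> 0"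
      using LIMSEQ_subseq_LIMSEQ[OF null[OF True] r] by (simp add: o_def)
    ultimately show ?thesis by (rule LIMSEQ_unique)
  next
    case False
    then show ?thesis using f analytic by (auto simp: disk_analytic_def)
  qed
  then have "(\<lambda>n. ip_norm ip ((F \<circ> r) n)) \<longlonglongrightarrow> 0" using lim by simp
  then have "\<kappa> \<le> 0" using \<kappa>(2) by (intro LIMSEQ_le_const[of "\<lambda>n. ip_norm ip ((F \<circ> r) n)"]) auto
  then show False using \<kappa>(1) by simp
qed

end

section \<open>Test functions on a horocycle\<close>

text \<open>
  These points run to \<open>1\<close> along the horocycle \<open>1 - |w|\<^sup>2 = |1 - w|\<^sup>2\<close>. They correspond to
  \<open>1 + 2 n \<i>\<close> under the map \<open>(1 + w) / (1 - w)\<close> to the right half plane, which is why \<open>|theta|\<close> is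
  constant on them.
\<close>

definition test_point :: "nat \<Rightarrow> complex" where
  "test_point n = (\<i> * of_nat n) / (1 + \<i> * of_nat n)"

text \<open>
  The common value of \<open>1 - |w|\<^sup>2\<close> and \<open>|1 - w|\<^sup>2\<close> at \<open>w = test_point n\<close>.
\<close>

definition test_gap :: "nat \<Rightarrow> real" where
  "test_gap n = 1 / (1 + (real n)\<^sup>2)"

lemma test_point_denominator: "(1 + \<i> * of_nat n :: complex) \<noteq> 0"
  by (simp add: complex_eq_iff)

lemma cmod_test_point_denominator: "(cmod (1 + \<i> * of_nat n))\<^sup>2 = 1 + (real n)\<^sup>2"
  by (simp add: cmod_power2)

lemma one_minus_test_point: "1 - test_point n = 1 / (1 + \<i> * of_nat n)"
  using test_point_denominator[of n] by (simp add: test_point_def field_simps)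

lemma cmod_one_minus_test_point: "(cmod (1 - test_point n))\<^sup>2 = test_gap n"
  unfolding one_minus_test_point norm_divide power_divide cmod_test_point_denominator by (simp add: test_gap_def)

lemma cmod_test_point: "(cmod (test_point n))\<^sup>2 = 1 - test_gap n"
proof -
  have "(cmod (test_point n))\<^sup>2 = (real n)\<^sup>2 / (1 + (real n)\<^sup>2)"
    unfolding test_point_def norm_divide power_divide cmod_test_point_denominator by (simp add: norm_mult)
  also have "\<dots> = 1 - test_gap n"
  proof -
    have "1 + (real n)\<^sup>2 \<noteq> 0" using zero_le_power2[of "real n"] by linarith
    then show ?thesis by (simp add: test_gap_def field_simps)
  qed
  finally show ?thesis .
qed

lemma test_gap_pos: "0 < test_gap n"
  by (simp add: test_gap_def add_pos_nonneg)

lemma test_gap_le: "test_gap n \<le> 1"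
  by (simp add: test_gap_def divide_le_eq_1_pos add_pos_nonneg)

lemma test_point_in: "test_point n \<in> unit_disk"
proof -
  have "(cmod (test_point n))\<^sup>2 < 1\<^sup>2" using cmod_test_point[of n] test_gap_pos[of n] by simp
  then have "cmod (test_point n) < 1" by (rule power2_less_imp_less) simp
  then show ?thesis by simp
qed

lemma test_gap_tendsto: "test_gap \<longlonglongrightarrow> 0"
proof (rule Lim_null_comparison[OF _ lim_1_over_n])
  have "norm (test_gap n) \<le> 1 / real n" if "1 \<le> n" for n
  proof -
    have "real n * 1 \<le> real n * real n" using that by (intro mult_left_mono) auto
    then have "real n \<le> 1 + (real n)\<^sup>2" by (simp add: power2_eq_square)
    then show ?thesis using that unfolding test_gap_def by (simp add: frac_le)
  qed
  then show "\<forall>\<^sub>F n in sequentially. norm (test_gap n) \<le> 1 / of_nat n"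
    unfolding eventually_sequentially by auto
qed

lemma theta_test_point: "cmod (theta (test_point n)) = exp (- (1/2))"
proof -
  have e: "1 + test_point n = (1 + 2 * (\<i> * of_nat n)) / (1 + \<i> * of_nat n)"
    using test_point_denominator[of n] by (simp add: test_point_def field_simps)
  have "(1 + test_point n) / (1 - test_point n) = 1 + 2 * (\<i> * of_nat n)"
    unfolding e one_minus_test_point using test_point_denominator[of n] by simp
  then show ?thesis by (simp add: theta_def)
qed

text \<open>
  The Szego kernel at \<open>test_point n\<close>, normalised to have Dirichlet norm one.
\<close>

definition test_fun :: "nat \<Rightarrow> complex \<Rightarrow> complex" where
  "test_fun n z = (if z \<in> unit_disk then of_real (test_gap n) * szego (test_point n) z else 0)"

lemma test_fun_sums: "z \<in> unit_disk \<Longrightarrow> (\<lambda>k. (of_real (test_gap n) * cnj (test_point n) ^ k) * z ^ k) sums test_fun n z"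
  using sums_mult[OF szego_sums[OF test_point_in[of n], of z], of "of_real (test_gap n)"] by (simp add: test_fun_def mult.assoc)

lemma test_fun_hol: "test_fun n holomorphic_on unit_disk"
  by (rule taylor_unique(1)[OF test_fun_sums])

lemma taylor_test_fun: "taylor (test_fun n) k = of_real (test_gap n) * cnj (test_point n) ^ k"
  by (rule taylor_unique(2)[OF test_fun_sums])

lemma taylor_test_fun_sq: "(cmod (taylor (test_fun n) k))\<^sup>2 = (test_gap n)\<^sup>2 * (1 - test_gap n) ^ k"
proof -
  have "(cmod (taylor (test_fun n) k))\<^sup>2 = (test_gap n)\<^sup>2 * ((cmod (test_point n))\<^sup>2) ^ k"
    unfolding taylor_test_fun norm_mult norm_power complex_mod_cnj norm_of_real power_mult_distrib
    by (simp add: power_mult[symmetric] mult.commute)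
  then show ?thesis by (simp add: cmod_test_point)
qed

lemma test_gap_contraction: "norm (1 - test_gap n) < 1" "0 \<le> 1 - test_gap n"
  using test_gap_pos[of n] test_gap_le[of n] by auto

lemma test_fun_dirichlet_sums: "(\<lambda>k. real (k + 1) * (cmod (taylor (test_fun n) k))\<^sup>2) sums 1"
proof -
  have "(\<lambda>k. (test_gap n)\<^sup>2 * (of_nat (Suc k) * (1 - test_gap n) ^ k)) sums ((test_gap n)\<^sup>2 * (1 / (1 - (1 - test_gap n))\<^sup>2))"
    by (intro sums_mult geometric_deriv_sums test_gap_contraction)
  moreover have "(test_gap n)\<^sup>2 * (1 / (1 - (1 - test_gap n))\<^sup>2) = 1" using test_gap_pos[of n] by simp
  moreover have "(\<lambda>k. (test_gap n)\<^sup>2 * (of_nat (Suc k) * (1 - test_gap n) ^ k)) = (\<lambda>k. real (k + 1) * (cmod (taylor (test_fun n) k))\<^sup>2)"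
    unfolding taylor_test_fun_sq by (auto simp: fun_eq_iff)
  ultimately show ?thesis by simp
qed

lemma test_fun_analytic: "test_fun n \<in> disk_analytic"
  using test_fun_hol by (auto simp: disk_analytic_def test_fun_def)

lemma test_fun_dirichlet: "test_fun n \<in> dirichlet_space" "dirichlet_norm (test_fun n) = 1"
  using dirichlet_spaceI[OF test_fun_analytic test_fun_dirichlet_sums] by auto

lemma test_fun_hardy_sums: "(\<lambda>k. (cmod (taylor (test_fun n) k))\<^sup>2) sums test_gap n"
proof -
  have "(\<lambda>k. (test_gap n)\<^sup>2 * (1 - test_gap n) ^ k) sums ((test_gap n)\<^sup>2 * (1 / (1 - (1 - test_gap n))))"
    by (intro sums_mult geometric_sums test_gap_contraction)
  moreover have "(test_gap n)\<^sup>2 * (1 / (1 - (1 - test_gap n))) = test_gap n" using test_gap_pos[of n] by (simp add: power2_eq_square)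
  ultimately show ?thesis unfolding taylor_test_fun_sq by simp
qed

lemma circle_sq_le_coeffs:
  assumes f: "f holomorphic_on unit_disk" and r: "0 \<le> r" "r < 1"
    and bd: "\<And>N. (\<Sum>n\<le>N. (cmod (taylor f n))\<^sup>2) \<le> A"
  shows "circle_sq r f \<le> A"
proof -
  note P = Parseval_sq[OF f r]
  have "(\<lambda>N. \<Sum>n\<le>N. (cmod (taylor f n))\<^sup>2 * r ^ (2 * n)) \<longlonglongrightarrow> circle_sq r f" using P by (simp add: sums_def_le)
  moreover have "(\<Sum>n\<le>N. (cmod (taylor f n))\<^sup>2 * r ^ (2 * n)) \<le> A" for N
  proof (rule order_trans[OF sum_mono bd])
    fix n
    show "(cmod (taylor f n))\<^sup>2 * r ^ (2 * n) \<le> (cmod (taylor f n))\<^sup>2"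
      using mult_left_mono[OF power_le_one[OF r(1) less_imp_le[OF r(2)]] zero_le_power2, of "cmod (taylor f n)" "2 * n"] by simp
  qed
  ultimately show ?thesis by (intro LIMSEQ_le_const2) auto
qed

lemma test_fun_null: "z \<in> unit_disk \<Longrightarrow> (\<lambda>n. test_fun n z) \<longlonglongrightarrow> 0"
proof -
  assume z: "z \<in> unit_disk"
  have b: "cmod (test_fun n z) \<le> test_gap n * (1 / (1 - cmod z))" for n
  proof -
    have "cmod (szego (test_point n) z) = cmod (szego z (test_point n))"
      unfolding szego_def norm_divide
      using complex_mod_cnj[of "1 - cnj z * test_point n"] by (simp add: mult.commute)
    also have "\<dots> \<le> 1 / (1 - cmod z)" by (rule szego_bound[OF z test_point_in])
    finally have "test_gap n * cmod (szego (test_point n) z) \<le> test_gap n * (1 / (1 - cmod z))"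
      by (rule mult_left_mono) (use test_gap_pos[of n] in simp)
    then show ?thesis using z test_gap_pos[of n] by (simp add: test_fun_def norm_mult)
  qed
  show ?thesis
    by (rule Lim_null_comparison[OF always_eventually[OF allI[OF b]]])
       (use tendsto_mult_left_zero[OF test_gap_tendsto] in blast)
qed

locale singular_quotient = mate_quotient B H ip a K "\<lambda>z. theta z * phi c z"
  for B :: "complex \<Rightarrow> complex" and H :: "(complex \<Rightarrow> complex) set"
    and ip :: "(complex \<Rightarrow> complex) \<Rightarrow> (complex \<Rightarrow> complex) \<Rightarrow> complex"
    and a :: "complex \<Rightarrow> complex" and K c :: real +
  assumes c_pos: "0 < c" and outer: "outer_function a"
begin

text \<open>
  Take the functional \<open>\<langle>f, B h\<rangle>\<close> with \<open>h = G * szego w * (1 - z) powr c * (1 - s z) powr (- c)\<close>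
  where \<open>G\<close> is one of the approximate reciprocals of \<open>a\<close> from \<open>outer_reciprocal\<close>, chosen such that
  \<open>|G a| > 1 / 2\<close> at \<open>w\<close>. The factor \<open>(1 - z) powr c\<close> cancels \<open>phi c\<close> in \<open>B h\<close>, and \<open>(1 - s z) powr (- c)\<close>
  is a bounded substitute for \<open>(1 - z) powr (- c)\<close> of the right size at \<open>w\<close>. Thus \<open>a h\<close> is bounded
  by a constant times \<open>szego w\<close>, while \<open>B h\<close> is large at \<open>w\<close>.
\<close>

lemma lower_functional:
  "\<exists>g\<in>H. ip_norm ip g \<le> 1 \<and>
     (\<exists>L\<ge>0. \<forall>f\<in>H. \<forall>M\<ge>0. (\<forall>j. circle_sq (radius j) f \<le> M\<^sup>2) \<longrightarrow> cmod (ip f g) \<le> L * M) \<and>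
     (test_fun n \<in> H \<longrightarrow> exp (- (1/2)) / 2 * 4 powr (- c) * test_gap n powr ((1 - c) / 2) \<le> cmod (ip (test_fun n) g))"
proof -
  define w where "w = test_point n"
  define d where "d = test_gap n"
  have w: "w \<in> unit_disk" and d: "0 < d" "d \<le> 1" unfolding w_def d_def by (rule test_point_in test_gap_pos test_gap_le)+
  \<comment> \<open>The dilation \<open>s\<close> is chosen such that \<open>|1 - s z|\<close> dominates \<open>|1 - z|\<close> on the disk and is comparable to it at \<open>w\<close>.\<close>
  define \<rho> where "\<rho> = cmod (1 - w)"
  have \<rho>2: "\<rho>\<^sup>2 = d" unfolding \<rho>_def w_def d_def by (rule cmod_one_minus_test_point)
  have \<rho>: "0 < \<rho>" using \<rho>2 d by (metis \<rho>_def norm_ge_zero order_le_less power_zero_numeral less_irrefl)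
  have \<rho>1: "\<rho> \<le> 1"
    by (rule power2_le_imp_le) (use \<rho>2 d in auto)
  have \<rho>s: "\<rho> = d powr (1/2)" using \<rho>2 \<rho> by (simp add: powr_half_sqrt d less_imp_le flip: \<rho>2)
  define s where "s = 1 - \<rho>"
  have s: "0 \<le> s" "s < 1" using \<rho> \<rho>1 by (auto simp: s_def)
  have den: "1 - s \<le> cmod (1 - of_real s * z)" if "z \<in> unit_disk" for z
  proof -
    have "cmod (of_real s * z) \<le> s" using that s by (simp add: norm_mult mult_left_le)
    then show ?thesis using norm_triangle_ineq2[of 1 "of_real s * z"] by simp
  qed
  define Y where "Y z = (1 - z) powr of_real c" for z :: complex
  define X where "X z = (1 - of_real s * z) powr of_real (- c)" for z :: complex
  have cX: "cmod (X z) = cmod (1 - of_real s * z) powr (- c)" for z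
    unfolding X_def by (subst norm_powr_real_powr') auto
  have cY: "cmod (Y z) = cmod (1 - z) powr c" for z
    unfolding Y_def by (subst norm_powr_real_powr') auto
  have XY: "cmod (Y z * X z) \<le> 2 powr c" if z: "z \<in> unit_disk" for z
  proof -
    have pos: "0 < cmod (1 - of_real s * z)" using den[OF z] s by linarith
    have "cmod (1 - z) \<le> 2 * cmod (1 - of_real s * z)"
    proof -
      have "cmod (1 - z) \<le> cmod (1 - of_real s * z) + cmod (of_real (1 - s) * z)"
        using norm_triangle_ineq4[of "1 - of_real s * z" "of_real (1 - s) * z"] by (simp add: algebra_simps)
      also have "cmod (of_real (1 - s) * z) \<le> 1 - s"
        using z s by (simp add: norm_mult mult_left_le del: of_real_diff)
      finally show ?thesis using den[OF z] by simp
    qed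
    then have "cmod (1 - z) powr c \<le> (2 * cmod (1 - of_real s * z)) powr c"
      using c_pos by (intro powr_mono2) auto
    also have "\<dots> = 2 powr c * cmod (1 - of_real s * z) powr c" by (rule powr_mult)
    finally have "cmod (1 - z) powr c * cmod (1 - of_real s * z) powr (- c) \<le>
        2 powr c * cmod (1 - of_real s * z) powr c * cmod (1 - of_real s * z) powr (- c)"
      by (intro mult_right_mono) auto
    also have "\<dots> = 2 powr c" using pos by (simp add: mult.assoc powr_add[symmetric])
    finally show ?thesis by (simp add: norm_mult cX cY)
  qed
  have X_hol: "X holomorphic_on unit_disk"
  proof -
    have "1 - of_real s * z \<notin> \<real>\<^sub>\<le>\<^sub>0" if "z \<in> unit_disk" for z
    proof (rule one_minus_nonpos)
      have "cmod (of_real s * z) \<le> cmod z" using s by (simp add: norm_mult mult_left_le_one_le)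
      then show "of_real s * z \<in> unit_disk" using that by simp
    qed
    then show ?thesis unfolding X_def[abs_def] by (intro holomorphic_intros) auto
  qed
  have Y_hol: "Y holomorphic_on unit_disk" unfolding Y_def[abs_def] by (rule powr_hol)
  obtain G :: "nat \<Rightarrow> complex \<Rightarrow> complex" where G_hol: "\<And>m. G m holomorphic_on unit_disk"
    and G_bd: "\<And>m. \<exists>L. \<forall>z\<in>unit_disk. cmod (G m z) \<le> L"
    and Ga: "\<And>m z. z \<in> unit_disk \<Longrightarrow> cmod (G m z * a z) \<le> 1"
    and Ga1: "\<And>z. z \<in> unit_disk \<Longrightarrow> (\<lambda>m. cmod (G m z * a z)) \<longlonglongrightarrow> 1"
    by (rule outer_reciprocal[OF outer]) (rule that, assumption+)
  obtain m where m: "1/2 < cmod (G m w * a w)"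
    using order_tendstoD(1)[OF Ga1[OF w], of "1/2"] unfolding eventually_sequentially by auto
  obtain L0 where L0: "\<And>z. z \<in> unit_disk \<Longrightarrow> cmod (G m z) \<le> L0" using G_bd[of m] by blast
  have L0p: "0 \<le> L0" using order_trans[OF norm_ge_zero L0[of 0]] by simp
  define h where "h z = G m z * (szego w z * (Y z * X z))" for z
  define L where "L = L0 * (1 / (1 - cmod w) * 2 powr c)"
  have h_hol: "h holomorphic_on unit_disk"
    unfolding h_def by (intro holomorphic_intros G_hol szego_holomorphic[OF w] Y_hol X_hol)
  have h_bd: "cmod (h z) \<le> L" if z: "z \<in> unit_disk" for z
  proof -
    have "cmod (h z) = cmod (G m z) * (cmod (szego w z) * cmod (Y z * X z))" by (simp only: h_def norm_mult)
    also have "\<dots> \<le> L" unfolding L_def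
      using w by (intro mult_mono L0 szego_bound XY z mult_nonneg_nonneg L0p) auto
    finally show ?thesis .
  qed
  have Lp: "0 \<le> L" using order_trans[OF norm_ge_zero h_bd[of 0]] by simp
  define M where "M = 2 powr c * d powr (- (1/2))"
  have M: "0 < M" using d by (simp add: M_def)
  have circle_sq_szego: "circle_sq (radius j) (szego w) \<le> 1 / d" for j
  proof (rule circle_sq_le_coeffs[OF szego_holomorphic[OF w] radius])
    fix N
    have "(\<lambda>k. (1 - d) ^ k) sums (1 / (1 - (1 - d)))"
      unfolding d_def by (rule geometric_sums[OF test_gap_contraction(1)])
    then have "(\<Sum>k\<le>N. (1 - d) ^ k) \<le> 1 / d"
      using sum_le_suminf[of "\<lambda>k. (1 - d) ^ k" "{..N}"] d by (simp add: sums_iff)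
    moreover have "(cmod (taylor (szego w) k))\<^sup>2 = (1 - d) ^ k" for k
    proof -
      have "(cmod (taylor (szego w) k))\<^sup>2 = ((cmod w)\<^sup>2) ^ k"
        unfolding taylor_szego[OF w] norm_power complex_mod_cnj by (simp add: power_mult[symmetric] mult.commute)
      then show ?thesis unfolding w_def d_def cmod_test_point .
    qed
    ultimately show "(\<Sum>k\<le>N. (cmod (taylor (szego w) k))\<^sup>2) \<le> 1 / d" by simp
  qed
  have ah: "circle_sq (radius j) (\<lambda>z. a z * h z) \<le> M\<^sup>2" for j
  proof -
    have "circle_sq (radius j) (\<lambda>z. a z * h z) \<le> (2 powr c)\<^sup>2 * circle_sq (radius j) (szego w)"
    proof -
      have pt: "(cmod (a z * h z))\<^sup>2 \<le> (2 powr c)\<^sup>2 * (cmod (szego w z))\<^sup>2" if z: "z \<in> unit_disk" for z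
      proof -
        have "cmod (a z * h z) = cmod (G m z * a z) * (cmod (szego w z) * cmod (Y z * X z))"
          by (simp add: h_def norm_mult)
        also have "\<dots> \<le> 1 * (cmod (szego w z) * 2 powr c)"
          by (intro mult_mono Ga XY z) auto
        finally have "(cmod (a z * h z))\<^sup>2 \<le> (cmod (szego w z) * 2 powr c)\<^sup>2" by (intro power_mono) auto
        then show ?thesis by (simp add: power_mult_distrib mult.commute)
      qed
      have int: "integrable angle (\<lambda>t. (cmod (f (of_real (radius j) * cis t)))\<^sup>2)" if f: "f holomorphic_on unit_disk" for f
      proof -
        obtain R where R: "\<And>t. cmod (f (of_real (radius j) * cis t)) \<le> R" using circle_bounded[OF f radius] by blast
        show ?thesis
        proof (rule angle_integrable[of _ "R\<^sup>2"])
          show "(\<lambda>t. (cmod (f (of_real (radius j) * cis t)))\<^sup>2) \<in> borel_measurable borel"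
            by (intro borel_measurable_continuous_onI continuous_intros circle_continuous f radius)
          show "norm ((cmod (f (of_real (radius j) * cis t)))\<^sup>2) \<le> R\<^sup>2" for t
            using R[of t] by (simp add: power_mono)
        qed
      qed
      have "circle_sq (radius j) (\<lambda>z. a z * h z) \<le> (\<integral>t. (2 powr c)\<^sup>2 * (cmod (szego w (of_real (radius j) * cis t)))\<^sup>2 \<partial>angle)"
        unfolding circle_sq_def
      proof (rule integral_mono)
        show "integrable angle (\<lambda>t. (cmod (a (of_real (radius j) * cis t) * h (of_real (radius j) * cis t)))\<^sup>2)"
          by (rule int) (intro holomorphic_intros a_hol h_hol)
        show "integrable angle (\<lambda>t. (2 powr c)\<^sup>2 * (cmod (szego w (of_real (radius j) * cis t)))\<^sup>2)"
          by (intro integrable_mult_right int szego_holomorphic w)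
      qed (rule pt[OF on_disk[OF radius]])
      then show ?thesis unfolding circle_sq_def by simp
    qed
    also have "\<dots> \<le> (2 powr c)\<^sup>2 * (1 / d)" by (intro mult_left_mono circle_sq_szego) simp
    also have "\<dots> = M\<^sup>2"
    proof -
      have "(d powr (- (1/2)))\<^sup>2 = 1 / d" using d by (simp add: power2_eq_square powr_add[symmetric] powr_minus_divide)
      then show ?thesis by (simp add: M_def power_mult_distrib)
    qed
    finally show ?thesis .
  qed
  obtain g0 where g0: "g0 \<in> H" "ip_norm ip g0 \<le> M"
    and g0_lim: "\<And>f. f \<in> H \<Longrightarrow> (\<lambda>j. circle_ip (radius j) f (\<lambda>z. B z * h z)) \<longlonglongrightarrow> ip f g0"
    using representer[OF h_hol h_bd less_imp_le[OF M] ah] by blast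
  have Bh_hol: "(\<lambda>z. B z * h z) holomorphic_on unit_disk" by (intro holomorphic_intros B_hol h_hol)
  have circle_sq_Bh: "circle_sq (radius j) (\<lambda>z. B z * h z) \<le> L\<^sup>2" for j
    by (rule circle_sq_bound[OF Bh_hol radius]) (rule bounded_times[of _ h], rule h_bd)
  define g where "g = (\<lambda>z. of_real (1 / M) * g0 z)"
  have g: "g \<in> H" unfolding g_def by (rule scale_mem[OF g0(1)])
  have nM: "cmod (of_real (1 / M)) = 1 / M" using M unfolding norm_of_real by simp
  have "ip_norm ip g = (1 / M) * ip_norm ip g0" unfolding g_def ip_norm_scale[OF g0(1)] nM ..
  also have "\<dots> \<le> 1" using g0(2) M by (simp add: divide_le_eq)
  finally have g1: "ip_norm ip g \<le> 1" .
  have ipg: "cmod (ip f g) = cmod (ip f g0) / M" if "f \<in> H" for f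
    unfolding g_def ip_scale_right[OF g0(1) that] norm_mult complex_mod_cnj nM by simp
  have bdd: "cmod (ip f g) \<le> L / M * R" if f: "f \<in> H" and R: "0 \<le> R" "\<And>j. circle_sq (radius j) f \<le> R\<^sup>2" for f R
  proof -
    have "cmod (circle_ip (radius j) f (\<lambda>z. B z * h z)) \<le> R * L" for j
      by (rule circle_ip_Cauchy_Schwarz[OF mem_hol[OF f] Bh_hol R(1) Lp R(2) circle_sq_Bh])
    then have "cmod (ip f g0) \<le> R * L" by (intro LIMSEQ_le_const2[OF tendsto_norm[OF g0_lim[OF f]]]) auto
    then show ?thesis unfolding ipg[OF f] using M by (simp add: field_simps)
  qed
  have low: "exp (- (1/2)) / 2 * 4 powr (- c) * test_gap n powr ((1 - c) / 2) \<le> cmod (ip (test_fun n) g)" if mem: "test_fun n \<in> H"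
  proof -
    have "circle_ip (radius j) (test_fun n) (\<lambda>z. B z * h z) = of_real d * cnj (circle_ip (radius j) (\<lambda>z. B z * h z) (szego w))" for j
    proof -
      have "circle_ip (radius j) (test_fun n) (\<lambda>z. B z * h z) = circle_ip (radius j) (\<lambda>z. of_real d * szego w z) (\<lambda>z. B z * h z)"
        by (rule circle_ip_cong[OF _ _ radius]) (simp_all add: test_fun_def d_def w_def)
      also have "\<dots> = of_real d * circle_ip (radius j) (szego w) (\<lambda>z. B z * h z)" by (rule circle_ip_scale)
      also have "circle_ip (radius j) (szego w) (\<lambda>z. B z * h z) = cnj (circle_ip (radius j) (\<lambda>z. B z * h z) (szego w))" by (rule circle_ip_cnj)
      finally show ?thesis .
    qed
    moreover have "(\<lambda>j. of_real d * cnj (circle_ip (radius j) (\<lambda>z. B z * h z) (szego w))) \<longlonglongrightarrow> of_real d * cnj (B w * h w)"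
      by (intro tendsto_intros circle_ip_szego_limit[OF Bh_hol w])
    ultimately have "ip (test_fun n) g0 = of_real d * cnj (B w * h w)"
      using g0_lim[OF mem] LIMSEQ_unique by simp
    then have val: "cmod (ip (test_fun n) g) = d * cmod (B w * h w) / M"
      unfolding ipg[OF mem] using d by (simp add: norm_mult)
    have "B w * h w = theta w * (G m w * a w) * szego w w * X w * (phi c w * Y w)"
      unfolding quotient[OF w] h_def by (simp add: mult_ac)
    also have "phi c w * Y w = 1"
      using one_minus_nz[OF w] by (simp add: phi_def Y_def)
    finally have Bh: "cmod (B w * h w) = exp (- (1/2)) * cmod (G m w * a w) * cmod (szego w w) * cmod (X w)"
      using theta_test_point[of n] by (simp add: norm_mult w_def)
    have ckw: "cmod (szego w w) = 1 / d"
    proof -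
      have "cnj w * w = of_real (1 - d)"
        using complex_norm_square[of w] cmod_test_point[of n] by (simp add: w_def d_def mult.commute)
      then have "szego w w = of_real (1 / d)" by (simp add: szego_def)
      then have "cmod (szego w w) = \<bar>1 / d\<bar>" by (simp only: norm_of_real)
      then show ?thesis using d by simp
    qed
    have Xw: "(2 * \<rho>) powr (- c) \<le> cmod (X w)"
    proof -
      have "cmod (1 - of_real s * w) \<le> cmod (1 - w) + cmod (of_real (1 - s) * w)"
        using norm_triangle_ineq[of "1 - w" "of_real (1 - s) * w"] by (simp add: algebra_simps)
      also have "cmod (of_real (1 - s) * w) \<le> 1 - s"
        using w s by (simp add: norm_mult mult_left_le del: of_real_diff)
      finally have "cmod (1 - of_real s * w) \<le> 2 * \<rho>" by (simp add: s_def \<rho>_def)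
      moreover have "0 < cmod (1 - of_real s * w)" using den[OF w] s by linarith
      ultimately show ?thesis unfolding cX using c_pos by (intro powr_mono2') auto
    qed
    have "exp (- (1/2)) * (1/2) * (1 / d) * (2 * \<rho>) powr (- c) \<le> cmod (B w * h w)"
      unfolding Bh ckw using m d Xw by (intro mult_mono) auto
    then have "d * (exp (- (1/2)) * (1/2) * (1 / d) * (2 * \<rho>) powr (- c)) / M \<le> cmod (ip (test_fun n) g)"
      unfolding val using d M by (intro divide_right_mono mult_left_mono) auto
    moreover have "d * (exp (- (1/2)) * (1/2) * (1 / d) * (2 * \<rho>) powr (- c)) / M =
        exp (- (1/2)) / 2 * 4 powr (- c) * test_gap n powr ((1 - c) / 2)"
    proof -
      have e1: "(2 * \<rho>) powr (- c) = 2 powr (- c) * d powr (- (c / 2))"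
        unfolding \<rho>s using d by (simp add: powr_mult powr_powr)
      have e2: "1 / M = 2 powr (- c) * d powr (1/2)"
        unfolding M_def using d by (simp add: powr_minus field_simps)
      have e3: "(2::real) powr (- c) * 2 powr (- c) = 4 powr (- c)"
        by (simp add: powr_mult[symmetric])
      have e4: "d powr (- (c / 2)) * d powr (1/2) = d powr ((1 - c) / 2)"
        by (simp add: powr_add[symmetric] diff_divide_distrib)
      have e5: "d * (exp (- (1/2)) * (1/2) * (1 / d) * x) / M = exp (- (1/2)) / 2 * x * (1 / M)" for x
        using d by simp
      have "d * (exp (- (1/2)) * (1/2) * (1 / d) * (2 * \<rho>) powr (- c)) / M =
          exp (- (1/2)) / 2 * (2 powr (- c) * 2 powr (- c)) * (d powr (- (c / 2)) * d powr (1/2))"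
        unfolding e5 unfolding e1 e2 by (simp only: mult_ac)
      then show ?thesis unfolding e3 e4 by (simp only: d_def)
    qed
    ultimately show ?thesis by (simp only:)
  qed
  show ?thesis
  proof (intro bexI[OF _ g] conjI g1 impI low exI[of _ "L / M"])
    show "0 \<le> L / M" using Lp M by simp
    show "\<forall>f\<in>H. \<forall>R\<ge>0. (\<forall>j. circle_sq (radius j) f \<le> R\<^sup>2) \<longrightarrow> cmod (ip f g) \<le> L / M * R" using bdd by blast
  qed
qed

lemma critical_not_compact:
  assumes c: "c = 1" and sub: "dirichlet_space \<subseteq> H"
  shows "\<not> compact_inclusion dirichlet_space dirichlet_norm H ip"
proof (rule not_compact_inclusion[OF sub test_fun_dirichlet(1)])
  show "dirichlet_norm (test_fun n) \<le> 1" for n by (simp add: test_fun_dirichlet)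
  show "0 < exp (- (1/2)) / 2 * 4 powr (- (1::real))" by simp
  show "exp (- (1/2)) / 2 * 4 powr (- 1) \<le> ip_norm ip (test_fun n)" for n
  proof -
    have mem: "test_fun n \<in> H" using sub test_fun_dirichlet by auto
    obtain g where g: "g \<in> H" "ip_norm ip g \<le> 1"
      and low: "exp (- (1/2)) / 2 * 4 powr (- c) * test_gap n powr ((1 - c) / 2) \<le> cmod (ip (test_fun n) g)"
      using lower_functional[of n] mem by blast
    have "cmod (ip (test_fun n) g) \<le> ip_norm ip (test_fun n) * 1"
      by (rule order_trans[OF Cauchy_Schwarz[OF mem g(1)]]) (intro mult_left_mono g ip_norm_nonneg mem)
    then show ?thesis using low test_gap_pos[of n] unfolding c by simp
  qed
qed (rule test_fun_null)

end

section \<open>The supercritical exponents\<close>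

lemma weighted_L2_combination:
  fixes x :: "nat \<Rightarrow> nat \<Rightarrow> complex"
  assumes p: "\<And>k. 0 \<le> p k" and \<omega>: "\<And>i. 0 \<le> \<omega> i"
    and bd: "\<And>k. L2_set (\<lambda>i. \<omega> i * cmod (x k i)) {..N} \<le> s"
  shows "L2_set (\<lambda>i. \<omega> i * cmod (\<Sum>k<K. of_real (p k) * x k i)) {..N} \<le> (\<Sum>k<K. p k) * s"
proof (induction K)
  case 0
  show ?case by (simp add: L2_set_def)
next
  case (Suc K)
  have "L2_set (\<lambda>i. \<omega> i * cmod (\<Sum>k<Suc K. of_real (p k) * x k i)) {..N} \<le>
      L2_set (\<lambda>i. \<omega> i * cmod (\<Sum>k<K. of_real (p k) * x k i) + p K * (\<omega> i * cmod (x K i))) {..N}"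
  proof (rule L2_set_mono)
    fix i
    have "cmod (\<Sum>k<Suc K. of_real (p k) * x k i) \<le> cmod (\<Sum>k<K. of_real (p k) * x k i) + p K * cmod (x K i)"
      using norm_triangle_ineq[of "\<Sum>k<K. of_real (p k) * x k i" "of_real (p K) * x K i"] p[of K]
      by (simp add: norm_mult)
    from mult_left_mono[OF this \<omega>[of i]]
    show "\<omega> i * cmod (\<Sum>k<Suc K. of_real (p k) * x k i) \<le>
        \<omega> i * cmod (\<Sum>k<K. of_real (p k) * x k i) + p K * (\<omega> i * cmod (x K i))"
      by (simp add: distrib_left mult.left_commute)
  qed (use \<omega> in auto)
  also have "\<dots> \<le> L2_set (\<lambda>i. \<omega> i * cmod (\<Sum>k<K. of_real (p k) * x k i)) {..N} +
      L2_set (\<lambda>i. p K * (\<omega> i * cmod (x K i))) {..N}"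
    by (rule L2_set_triangle_ineq)
  also have "L2_set (\<lambda>i. p K * (\<omega> i * cmod (x K i))) {..N} = p K * L2_set (\<lambda>i. \<omega> i * cmod (x K i)) {..N}"
    by (rule L2_set_right_distrib[symmetric, OF p])
  also have "\<dots> \<le> p K * s" by (intro mult_left_mono bd p)
  finally show ?case using Suc by (simp add: distrib_right)
qed

lemma weighted_L2_limit:
  fixes x :: "nat \<Rightarrow> nat \<Rightarrow> complex"
  assumes p: "\<And>k. 0 \<le> p k" "\<And>K. (\<Sum>k<K. p k) \<le> 1" and \<omega>: "\<And>i. 0 \<le> \<omega> i" and s: "0 \<le> s"
    and bd: "\<And>k. L2_set (\<lambda>i. \<omega> i * cmod (x k i)) {..N} \<le> s"
    and lim: "\<And>i. (\<lambda>K. \<Sum>k<K. of_real (p k) * x k i) \<longlonglongrightarrow> y i"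
  shows "(\<Sum>i\<le>N. (\<omega> i)\<^sup>2 * (cmod (y i))\<^sup>2) \<le> s\<^sup>2"
proof (rule LIMSEQ_le_const2)
  show "(\<lambda>K. \<Sum>i\<le>N. (\<omega> i)\<^sup>2 * (cmod (\<Sum>k<K. of_real (p k) * x k i))\<^sup>2) \<longlonglongrightarrow> (\<Sum>i\<le>N. (\<omega> i)\<^sup>2 * (cmod (y i))\<^sup>2)"
    by (intro tendsto_intros lim)
  have "(\<Sum>i\<le>N. (\<omega> i)\<^sup>2 * (cmod (\<Sum>k<K. of_real (p k) * x k i))\<^sup>2) \<le> s\<^sup>2" for K
  proof -
    have "L2_set (\<lambda>i. \<omega> i * cmod (\<Sum>k<K. of_real (p k) * x k i)) {..N} \<le> (\<Sum>k<K. p k) * s"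
      by (rule weighted_L2_combination[OF p(1) \<omega> bd])
    also have "\<dots> \<le> 1 * s" by (intro mult_right_mono p s)
    finally have "(L2_set (\<lambda>i. \<omega> i * cmod (\<Sum>k<K. of_real (p k) * x k i)) {..N})\<^sup>2 \<le> s\<^sup>2"
      by (intro power_mono) (auto simp: L2_set_nonneg)
    then show ?thesis unfolding L2_set_def by (simp add: sum_nonneg power_mult_distrib)
  qed
  then show "\<exists>M. \<forall>K\<ge>M. (\<Sum>i\<le>N. (\<omega> i)\<^sup>2 * (cmod (\<Sum>k<K. of_real (p k) * x k i))\<^sup>2) \<le> s\<^sup>2" by blast
qed

lemma half_sums: "(\<Sum>k<K. (1/2::real) ^ Suc k) \<le> 1"
proof -
  have "(\<Sum>k<K. (1/2::real) ^ Suc k) = 1 - (1/2) ^ K" by (induction K) auto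
  then show ?thesis by simp
qed

context singular_quotient
begin

text \<open>
  A gliding hump. Suppose the Dirichlet space is contained in the space. The functionals of
  \<open>lower_functional\<close> are bounded by one on the space, bounded in the Hardy norm, and unbounded
  on the test functions. Choose a sparse sequence of test functions, each almost annihilated
  by the earlier functionals and on which its own functional is much larger than what the
  earlier functions can contribute. Weighted by powers of one half, they add up to a function
  in the Dirichlet space on which the functionals are unbounded.
\<close>

lemma supercritical_not_subset:
  assumes c: "1 < c"
  shows "\<not> dirichlet_space \<subseteq> H"
proof
  assume sub: "dirichlet_space \<subseteq> H"
  have mem: "test_fun n \<in> H" for n using sub test_fun_dirichlet by auto
  have "\<forall>n. \<exists>q. fst q \<in> H \<and> ip_norm ip (fst q) \<le> 1 \<and> 0 \<le> snd q \<and>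
     (\<forall>f\<in>H. \<forall>M\<ge>0. (\<forall>j. circle_sq (radius j) f \<le> M\<^sup>2) \<longrightarrow> cmod (ip f (fst q)) \<le> snd q * M) \<and>
     exp (- (1/2)) / 2 * 4 powr (- c) * test_gap n powr ((1 - c) / 2) \<le> cmod (ip (test_fun n) (fst q))"
  proof
    fix n
    from lower_functional[of n] mem[of n] obtain g L where "g \<in> H" "ip_norm ip g \<le> 1" "0 \<le> L"
      "\<forall>f\<in>H. \<forall>M\<ge>0. (\<forall>j. circle_sq (radius j) f \<le> M\<^sup>2) \<longrightarrow> cmod (ip f g) \<le> L * M"
      "exp (- (1/2)) / 2 * 4 powr (- c) * test_gap n powr ((1 - c) / 2) \<le> cmod (ip (test_fun n) g)"
      by blast
    then show "\<exists>q. fst q \<in> H \<and> ip_norm ip (fst q) \<le> 1 \<and> 0 \<le> snd q \<and>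
     (\<forall>f\<in>H. \<forall>M\<ge>0. (\<forall>j. circle_sq (radius j) f \<le> M\<^sup>2) \<longrightarrow> cmod (ip f (fst q)) \<le> snd q * M) \<and>
     exp (- (1/2)) / 2 * 4 powr (- c) * test_gap n powr ((1 - c) / 2) \<le> cmod (ip (test_fun n) (fst q))"
      by (intro exI[of _ "(g, L)"]) simp
  qed
  from choice[OF this] obtain Q where Q: "\<forall>n. fst (Q n) \<in> H \<and> ip_norm ip (fst (Q n)) \<le> 1 \<and> 0 \<le> snd (Q n) \<and>
     (\<forall>f\<in>H. \<forall>M\<ge>0. (\<forall>j. circle_sq (radius j) f \<le> M\<^sup>2) \<longrightarrow> cmod (ip f (fst (Q n))) \<le> snd (Q n) * M) \<and>
     exp (- (1/2)) / 2 * 4 powr (- c) * test_gap n powr ((1 - c) / 2) \<le> cmod (ip (test_fun n) (fst (Q n)))" ..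
  define g where "g n = fst (Q n)" for n
  define L where "L n = snd (Q n)" for n
  have g: "g n \<in> H" "ip_norm ip (g n) \<le> 1" and L: "0 \<le> L n"
    and gL: "f \<in> H \<Longrightarrow> 0 \<le> M \<Longrightarrow> (\<And>j. circle_sq (radius j) f \<le> M\<^sup>2) \<Longrightarrow> cmod (ip f (g n)) \<le> L n * M"
    and low: "exp (- (1/2)) / 2 * 4 powr (- c) * test_gap n powr ((1 - c) / 2) \<le> cmod (ip (test_fun n) (g n))" for n f M
    using Q unfolding g_def L_def by blast+
  have ip_g: "cmod (ip f (g n)) \<le> ip_norm ip f" if f: "f \<in> H" for f n
    using order_trans[OF Cauchy_Schwarz[OF f g(1)] mult_left_mono[OF g(2) ip_norm_nonneg[OF f]]] by simp
  define T where "T n = cmod (ip (test_fun n) (g n))" for n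
  have T: "filterlim T at_top sequentially"
  proof (rule filterlim_at_top_mono)
    show "\<forall>\<^sub>F n in sequentially. exp (- (1/2)) / 2 * 4 powr (- c) * test_gap n powr ((1 - c) / 2) \<le> T n"
      using low by (simp add: T_def)
    have e: "test_gap n powr ((1 - c) / 2) = exp ((c - 1) / 2 * ln (1 + (real n)\<^sup>2))" for n
    proof -
      have p: "0 < 1 + (real n)\<^sup>2" by (simp add: add_pos_nonneg)
      then have "ln (test_gap n) = - ln (1 + (real n)\<^sup>2)" unfolding test_gap_def by (simp add: ln_div)
      then show ?thesis using test_gap_pos[of n] by (simp add: powr_def algebra_simps diff_divide_distrib)
    qed
    have "filterlim (\<lambda>n. 1 + (real n)\<^sup>2) at_top sequentially"
      by (intro filterlim_tendsto_add_at_top[OF tendsto_const] filterlim_pow_at_top filterlim_real_sequentially) simp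
    then have "filterlim (\<lambda>n. (c - 1) / 2 * ln (1 + (real n)\<^sup>2)) at_top sequentially"
      using c by (intro filterlim_tendsto_pos_mult_at_top[OF tendsto_const] filterlim_compose[OF ln_at_top]) auto
    then have "filterlim (\<lambda>n. test_gap n powr ((1 - c) / 2)) at_top sequentially"
      unfolding e by (rule filterlim_compose[OF exp_at_top])
    then show "filterlim (\<lambda>n. exp (- (1/2)) / 2 * 4 powr (- c) * test_gap n powr ((1 - c) / 2)) at_top sequentially"
      by (intro filterlim_tendsto_pos_mult_at_top[OF tendsto_const]) auto
  qed
  \<comment> \<open>\<open>S m\<close> bounds the contribution of all test functions up to index \<open>m\<close> to any of the functionals.\<close>
  define S where "S m = (\<Sum>i\<le>m. ip_norm ip (test_fun i))" for m
  have sq: "(\<lambda>n. sqrt (test_gap n)) \<longlonglongrightarrow> 0" using tendsto_real_sqrt[OF test_gap_tendsto] by simp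
  have "\<exists>r. \<forall>n. True \<and> (r n \<le> r (Suc n) \<and> (\<forall>i\<le>r n. (L i + 1) * sqrt (test_gap (r (Suc n))) \<le> 1) \<and>
      2 ^ (n + 2) * (real n + 1 + S (r n)) \<le> T (r (Suc n)))"
  proof (rule dependent_nat_choice)
    fix m n :: nat
    have "\<forall>\<^sub>F y in sequentially. (L i + 1) * sqrt (test_gap y) \<le> 1" for i
    proof -
      have "(\<lambda>y. (L i + 1) * sqrt (test_gap y)) \<longlonglongrightarrow> (L i + 1) * 0" by (intro tendsto_intros sq)
      then have "\<forall>\<^sub>F y in sequentially. (L i + 1) * sqrt (test_gap y) < 1" by (rule order_tendstoD) simp
      then show ?thesis by (rule eventually_mono) simp
    qed
    then have "\<forall>\<^sub>F y in sequentially. \<forall>i\<in>{..m}. (L i + 1) * sqrt (test_gap y) \<le> 1"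
      by (intro eventually_ball_finite) auto
    moreover have "\<forall>\<^sub>F y in sequentially. 2 ^ (n + 2) * (real n + 1 + S m) \<le> T y"
      using T unfolding filterlim_at_top by blast
    moreover have "\<forall>\<^sub>F y in sequentially. m \<le> y" by (rule eventually_ge_at_top)
    ultimately have "\<forall>\<^sub>F y in sequentially. m \<le> y \<and> (\<forall>i\<in>{..m}. (L i + 1) * sqrt (test_gap y) \<le> 1) \<and>
       2 ^ (n + 2) * (real n + 1 + S m) \<le> T y" by eventually_elim blast
    then obtain y where "m \<le> y \<and> (\<forall>i\<in>{..m}. (L i + 1) * sqrt (test_gap y) \<le> 1) \<and>
       2 ^ (n + 2) * (real n + 1 + S m) \<le> T y" unfolding eventually_sequentially by blast
    then show "\<exists>y. True \<and> (m \<le> y \<and> (\<forall>i\<le>m. (L i + 1) * sqrt (test_gap y) \<le> 1) \<and>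
      2 ^ (n + 2) * (real n + 1 + S m) \<le> T y)" by auto
  qed simp
  then obtain r :: "nat \<Rightarrow> nat" where r_Suc: "\<And>n. r n \<le> r (Suc n)"
    and r_gap: "\<And>n i. i \<le> r n \<Longrightarrow> (L i + 1) * sqrt (test_gap (r (Suc n))) \<le> 1"
    and r_T: "\<And>n. 2 ^ (n + 2) * (real n + 1 + S (r n)) \<le> T (r (Suc n))"
    by blast
  have r_mono: "m \<le> n \<Longrightarrow> r m \<le> r n" for m n by (rule lift_Suc_mono_le[of r, OF r_Suc])
  define p where "p k = (1/2::real) ^ Suc k" for k
  have p: "0 \<le> p k" "(\<Sum>k<K. p k) \<le> 1" for k K using half_sums by (simp_all add: p_def)
  define x where "x k = taylor (test_fun (r k))" for k
  have xb: "cmod (x k i) \<le> 1" for k i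
    using dirichlet_coeff_bound[OF test_fun_dirichlet(1), of "r k" i] test_fun_dirichlet(2) by (simp add: x_def)
  define y where "y i = (\<Sum>k. of_real (p k) * x k i)" for i
  have sp: "summable p" unfolding p_def by (simp add: summable_geometric)
  have sx: "summable (\<lambda>k. of_real (p k) * x k i)" for i
    by (rule summable_comparison_test'[OF sp, of 0]) (use xb p(1) in \<open>simp add: norm_mult mult_left_le\<close>)
  have y_lim: "(\<lambda>K. \<Sum>k<K. of_real (p k) * x k i) \<longlonglongrightarrow> y i" for i
    unfolding y_def using sx[of i] by (rule summable_LIMSEQ)
  have Dx: "L2_set (\<lambda>i. sqrt (real (i + 1)) * cmod (x k i)) {..N} \<le> 1" for k N
  proof -
    have "(\<Sum>i\<le>N. real (i + 1) * (cmod (x k i))\<^sup>2) \<le> 1"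
      using sum_le_suminf[OF sums_summable[OF test_fun_dirichlet_sums[of "r k"]], of "{..N}"]
        sums_unique[OF test_fun_dirichlet_sums[of "r k"]] by (simp add: x_def)
    then show ?thesis unfolding L2_set_def by (simp add: power_mult_distrib)
  qed
  have Dy: "(\<Sum>i\<le>N. real (i + 1) * (cmod (y i))\<^sup>2) \<le> 1" for N
    using weighted_L2_limit[of p "\<lambda>i. sqrt (real (i + 1))" 1 x N y, OF p _ _ Dx y_lim] by simp
  have yb: "cmod (y i) \<le> 1" for i
  proof -
    have "(cmod (y i))\<^sup>2 \<le> real (i + 1) * (cmod (y i))\<^sup>2" by (simp add: distrib_right)
    also have "\<dots> \<le> (\<Sum>i\<le>i. real (i + 1) * (cmod (y i))\<^sup>2)" by (rule member_le_sum) auto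
    also have "\<dots> \<le> 1\<^sup>2" using Dy by simp
    finally show ?thesis by (rule power2_le_imp_le) simp
  qed
  define f where "f z = (if z \<in> unit_disk then \<Sum>i. y i * z ^ i else 0)" for z
  have fs: "(\<lambda>i. y i * z ^ i) sums f z" if z: "z \<in> unit_disk" for z
  proof -
    have "summable (\<lambda>i. cmod z ^ i)" using z by (intro summable_geometric) simp
    then have "summable (\<lambda>i. y i * z ^ i)"
      by (rule summable_comparison_test'[of _ 0]) (use yb in \<open>simp add: norm_mult norm_power mult_left_le_one_le\<close>)
    then show ?thesis using z by (simp add: f_def summable_sums)
  qed
  have f_hol: "f holomorphic_on unit_disk" by (rule taylor_unique(1)[OF fs])
  have tcf: "taylor f i = y i" for i by (rule taylor_unique(2)[OF fs])
  have fa: "f \<in> disk_analytic" using f_hol by (auto simp: disk_analytic_def f_def)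
  have "summable (\<lambda>i. real (i + 1) * (cmod (taylor f i))\<^sup>2)"
    unfolding tcf by (rule bounded_imp_summable[OF _ Dy]) simp
  then have "f \<in> dirichlet_space" by (rule dirichlet_spaceI(1)[OF fa summable_sums])
  then have f: "f \<in> H" using sub by blast
  define P where "P n z = (\<Sum>k\<le>n. of_real (p k) * test_fun (r k) z)" for n z
  have P_Suc: "P (Suc n) = (\<lambda>z. P n z + of_real (p (Suc n)) * test_fun (r (Suc n)) z)" for n
    by (simp add: P_def fun_eq_iff)
  have P_0: "P 0 = (\<lambda>z. of_real (p 0) * test_fun (r 0) z)" by (simp add: P_def fun_eq_iff)
  have P: "P n \<in> H" for n by (induction n) (simp_all only: P_0 P_Suc add_mem scale_mem mem)
  have ipP: "ip (P n) h = (\<Sum>k\<le>n. of_real (p k) * ip (test_fun (r k)) h)" if h: "h \<in> H" for n h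
  proof (induction n)
    case 0
    show ?case unfolding P_0 by (simp add: ip_scale mem h)
  next
    case (Suc n)
    then show ?case unfolding P_Suc by (simp add: ip_add ip_scale scale_mem mem P h)
  qed
  have tcP: "taylor (P n) i = (\<Sum>k\<le>n. of_real (p k) * x k i)" for n i
  proof (rule taylor_unique(2))
    fix z :: complex assume z: "z \<in> unit_disk"
    have "(\<lambda>i. \<Sum>k\<le>n. of_real (p k) * (taylor (test_fun (r k)) i * z ^ i)) sums (\<Sum>k\<le>n. of_real (p k) * test_fun (r k) z)"
      by (intro sums_sum sums_mult taylor_sums test_fun_hol z)
    then show "(\<lambda>i. (\<Sum>k\<le>n. of_real (p k) * x k i) * z ^ i) sums P n z"
      by (simp add: P_def x_def sum_distrib_right mult.assoc)
  qed
  have big: "real n \<le> ip_norm ip f" for n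
  proof -
    define m where "m = Suc n"
    define \<eta> where "\<eta> = 1 / (L (r m) + 1)"
    have \<eta>: "0 \<le> \<eta>" "L (r m) * \<eta> \<le> 1" using L[of "r m"] by (auto simp: \<eta>_def divide_le_eq)
    define t where "t = (\<lambda>z. f z - P m z)"
    have t: "t \<in> H" unfolding t_def by (rule diff_mem[OF f P])
    have tct: "taylor t i = y i - (\<Sum>k\<le>m. of_real (p k) * x k i)" for i
      unfolding t_def taylor_diff[OF mem_hol[OF f] mem_hol[OF P]] tcf tcP ..
    \<comment> \<open>Split \<open>f\<close> into the terms before \<open>m\<close>, the term \<open>m\<close>, and the remainder \<open>t\<close>, which is small in the Hardy norm.\<close>
    define x' where "x' k i = (if k \<le> m then 0 else x k i)" for k i
    have lim': "(\<lambda>K. \<Sum>k<K. of_real (p k) * x' k i) \<longlonglongrightarrow> taylor t i" for i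
    proof -
      have ev: "\<forall>\<^sub>F K in sequentially. (\<Sum>k<K. of_real (p k) * x k i) - (\<Sum>k\<le>m. of_real (p k) * x k i) = (\<Sum>k<K. of_real (p k) * x' k i)"
        unfolding eventually_sequentially
      proof (intro exI[of _ "Suc m"] allI impI)
        fix K assume K: "Suc m \<le> K"
        have "(\<Sum>k\<le>m. of_real (p k) * x k i) = (\<Sum>k<K. of_real (p k) * (x k i - x' k i))"
          by (rule sum.mono_neutral_cong_left) (use K in \<open>auto simp: x'_def\<close>)
        then show "(\<Sum>k<K. of_real (p k) * x k i) - (\<Sum>k\<le>m. of_real (p k) * x k i) = (\<Sum>k<K. of_real (p k) * x' k i)"
          by (simp add: right_diff_distrib sum_subtractf)
      qed
      show ?thesis unfolding tct
        by (rule Lim_transform_eventually[OF tendsto_diff[OF y_lim tendsto_const] ev])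
    qed
    have bd': "L2_set (\<lambda>i. 1 * cmod (x' k i)) {..N} \<le> \<eta>" for k N
    proof (cases "k \<le> m")
      case True
      then show ?thesis using \<eta> by (simp add: x'_def L2_set_def)
    next
      case False
      then obtain l where l: "k = Suc l" "m \<le> l" by (cases k) auto
      have "(\<Sum>i\<le>N. (cmod (x k i))\<^sup>2) \<le> test_gap (r k)"
        using sum_le_suminf[OF sums_summable[OF test_fun_hardy_sums[of "r k"]], of "{..N}"]
          sums_unique[OF test_fun_hardy_sums[of "r k"]] by (simp add: x_def)
      then have "L2_set (\<lambda>i. 1 * cmod (x' k i)) {..N} \<le> sqrt (test_gap (r k))"
        using False unfolding L2_set_def by (simp add: x'_def)
      also have "\<dots> \<le> \<eta>"
        using r_gap[OF r_mono[OF l(2)]] L[of "r m"] unfolding l(1) \<eta>_def by (simp add: field_simps)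
      finally show ?thesis .
    qed
    have "(\<Sum>i\<le>N. (cmod (taylor t i))\<^sup>2) \<le> \<eta>\<^sup>2" for N
      using weighted_L2_limit[of p "\<lambda>_. 1" \<eta> x' N "taylor t", OF p _ \<eta>(1) bd' lim'] by simp
    then have "circle_sq (radius j) t \<le> \<eta>\<^sup>2" for j by (rule circle_sq_le_coeffs[OF mem_hol[OF t] radius])
    then have "cmod (ip t (g (r m))) \<le> L (r m) * \<eta>" by (rule gL[OF t \<eta>(1)])
    then have tail: "cmod (ip t (g (r m))) \<le> 1" using \<eta>(2) by simp
    have head: "cmod (ip (P n) (g (r m))) \<le> S (r n)"
    proof -
      have "cmod (ip (P n) (g (r m))) \<le> (\<Sum>k\<le>n. p k * ip_norm ip (test_fun (r k)))"
        unfolding ipP[OF g(1)]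
        by (rule order_trans[OF norm_sum sum_mono]) (use p(1) in \<open>simp add: norm_mult mult_left_mono ip_g mem\<close>)
      also have "\<dots> \<le> (\<Sum>k\<le>n. p k * S (r n))"
      proof (intro sum_mono mult_left_mono p)
        fix k assume "k \<in> {..n}"
        then show "ip_norm ip (test_fun (r k)) \<le> S (r n)"
          unfolding S_def by (intro member_le_sum) (auto intro: r_mono ip_norm_nonneg mem)
      qed
      also have "\<dots> = (\<Sum>k<Suc n. p k) * S (r n)" by (simp only: sum_distrib_right lessThan_Suc_atMost)
      also have "\<dots> \<le> 1 * S (r n)"
        by (intro mult_right_mono p) (auto simp: S_def intro!: sum_nonneg ip_norm_nonneg mem)
      finally show ?thesis by simp
    qed
    have mid: "real n + 1 + S (r n) \<le> p m * T (r m)"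
    proof -
      have "p m * (2 ^ (n + 2) * (real n + 1 + S (r n))) \<le> p m * T (r m)"
        unfolding m_def by (intro mult_left_mono r_T p)
      moreover have "p m * 2 ^ (n + 2) = 1" by (simp add: p_def m_def power_one_over)
      ultimately show ?thesis by (simp add: mult.assoc[symmetric])
    qed
    have "ip f (g (r m)) = ip (\<lambda>z. P m z + t z) (g (r m))" by (simp add: t_def)
    also have "\<dots> = ip (P m) (g (r m)) + ip t (g (r m))" by (rule ip_add[OF P t g(1)])
    also have "ip (P m) (g (r m)) = ip (P n) (g (r m)) + of_real (p m) * ip (test_fun (r m)) (g (r m))"
      unfolding ipP[OF g(1)] m_def by simp
    finally have "of_real (p m) * ip (test_fun (r m)) (g (r m)) = ip f (g (r m)) - ip (P n) (g (r m)) - ip t (g (r m))" by simp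
    then have "p m * T (r m) = cmod (ip f (g (r m)) - ip (P n) (g (r m)) - ip t (g (r m)))"
      unfolding T_def using p(1)[of m] by (metis abs_of_nonneg norm_mult norm_of_real)
    also have "\<dots> \<le> cmod (ip f (g (r m))) + cmod (ip (P n) (g (r m))) + cmod (ip t (g (r m)))"
      by (rule order_trans[OF norm_triangle_ineq4 add_right_mono[OF norm_triangle_ineq4]])
    finally show ?thesis using mid head tail ip_g[OF f, of "r m"] by linarith
  qed
  obtain n :: nat where "ip_norm ip f < real n" using reals_Archimedean2 by blast
  then show False using big[of n] by simp
qed

end

section \<open>The theorem\<close>

lemma theta_norm_le: "z \<in> unit_disk \<Longrightarrow> cmod (theta z) \<le> 1"
proof -
  assume z: "z \<in> unit_disk"
  then have "0 \<le> Re ((1 + z) / (1 - z))" using herglotz_kernel_Re[of 1 z] by simp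
  moreover have "Re (- (1 / 2) * w) = - (Re w / 2)" for w by simp
  ultimately show ?thesis unfolding theta_def norm_exp_eq_Re by (simp only:) simp
qed

text \<open>
  On the unit circle, away from \<open>1\<close>, the quotient \<open>(1 + z) / (1 - z)\<close> is imaginary.
\<close>

lemma theta_radial:
  assumes "cis t \<noteq> 1"
  shows "((\<lambda>r. cmod (theta (of_real r * cis t))) \<longlongrightarrow> 1) (at_left 1)"
proof -
  have ne: "1 - cis t \<noteq> 0" using assms by simp
  have "((\<lambda>r :: real. of_real r * cis t) \<longlongrightarrow> of_real 1 * cis t) (at_left 1)"
    by (intro tendsto_intros)
  then have lim: "((\<lambda>r :: real. of_real r * cis t) \<longlongrightarrow> cis t) (at_left 1)" by simp
  have "((\<lambda>r. cmod (theta (of_real r * cis t))) \<longlongrightarrow> cmod (theta (cis t))) (at_left 1)"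
    unfolding theta_def by (intro tendsto_intros lim ne)
  moreover have "cmod (theta (cis t)) = 1"
  proof -
    have "Re ((1 + cis t) / (1 - cis t)) = Re ((1 + cis t) * cnj (1 - cis t)) / (cmod (1 - cis t))\<^sup>2"
      by (subst complex_div_cnj) (simp only: of_real_power[symmetric] Re_divide_of_real)
    also have "Re ((1 + cis t) * cnj (1 - cis t)) = 1 - ((cos t)\<^sup>2 + (sin t)\<^sup>2)"
      by (simp add: algebra_simps power2_eq_square)
    finally have "Re ((1 + cis t) / (1 - cis t)) = 0" by simp
    moreover have "Re (- (1 / 2) * w) = - (Re w / 2)" for w by simp
    ultimately show ?thesis unfolding theta_def norm_exp_eq_Re by (simp only:) simp
  qed
  ultimately show ?thesis by simp
qed

lemma AE_cis_ne_1: "AE t in angle. cis t \<noteq> 1"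
proof -
  have "countable {t. cis t = 1}"
  proof (rule countable_subset)
    show "{t. cis t = 1} \<subseteq> range (\<lambda>n. 2 * real_of_int n * pi)"
    proof
      fix t assume "t \<in> {t. cis t = 1}"
      then have "cos t = 1" by (simp add: complex_eq_iff)
      then show "t \<in> range (\<lambda>n. 2 * real_of_int n * pi)" using cos_one_2pi_int[of t] by (auto simp: mult_ac)
    qed
  qed simp
  then have "{t. cis t = 1} \<in> null_sets lborel" by (rule countable_imp_null_set_lborel)
  then have "AE t in lborel. cis t \<noteq> 1" by (rule AE_I') auto
  then show ?thesis unfolding angle_def by (intro AE_uniform_measureI) auto
qed

theorem proposition5p1:
  fixes c :: real and a b :: "complex \<Rightarrow> complex"
    and H :: "(complex \<Rightarrow> complex) set"
    and ip :: "(complex \<Rightarrow> complex) \<Rightarrow> (complex \<Rightarrow> complex) \<Rightarrow> complex"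
  assumes "c > 0"
    and "b holomorphic_on unit_disk" and "b ` unit_disk \<subseteq> unit_disk"
    and "hinf_nonextreme b"
    and "pythagorean_mate b a"
    and "\<forall>z\<in>unit_disk. phi c z = b z / a z"
    and "de_branges_rovnyak (\<lambda>z. theta z * b z) H ip"
  shows "(c < 1 \<longrightarrow> dirichlet_space \<subseteq> H \<and>
            compact_inclusion dirichlet_space dirichlet_norm H ip) \<and>
         (c = 1 \<longrightarrow> dirichlet_space \<subseteq> H \<and>
            \<not> compact_inclusion dirichlet_space dirichlet_norm H ip) \<and>
         (c > 1 \<longrightarrow> \<not> dirichlet_space \<subseteq> H)"
proof -
  have phi_nz: "phi c z \<noteq> 0" if "z \<in> unit_disk" for z
    using one_minus_nz[OF that] by (simp add: phi_def)
  have a_nz: "a z \<noteq> 0" if z: "z \<in> unit_disk" for z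
    using phi_nz[OF z] assms(6) z by (metis div_by_0)
  have b_eq: "b z = phi c z * a z" if z: "z \<in> unit_disk" for z
    using assms(6) z a_nz[OF z] by simp
  have a_eq: "a z = b z * (1 - z) powr of_real c" if z: "z \<in> unit_disk" for z
    unfolding b_eq[OF z] phi_def using one_minus_nz[OF z] by simp
  have b_le: "cmod (b z) \<le> 1" if z: "z \<in> unit_disk" for z
    using assms(3) z by (auto simp: image_subset_iff less_imp_le)
  have outer: "outer_function a" using assms(5) by (simp add: pythagorean_mate_def)
  have a_hol: "a holomorphic_on unit_disk"
    by (rule holomorphic_transform[of "\<lambda>z. b z * (1 - z) powr of_real c"])
       (use a_eq in \<open>auto intro!: holomorphic_on_mult assms powr_hol\<close>)
  have a_bd: "cmod (a z) \<le> 2 powr c" if z: "z \<in> unit_disk" for z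
  proof -
    have "cmod (1 - z) \<le> 2" using norm_triangle_ineq4[of 1 z] z by simp
    then have "cmod ((1 - z) powr of_real c) \<le> 2 powr c"
      using assms(1) by (subst norm_powr_real_powr') (auto intro: powr_mono2)
    then have "cmod (b z) * cmod ((1 - z) powr of_real c) \<le> 1 * 2 powr c"
      by (intro mult_mono b_le z) auto
    then show ?thesis unfolding a_eq[OF z] norm_mult by simp
  qed
  have B_bd: "cmod (theta z * b z) \<le> 1" if z: "z \<in> unit_disk" for z
    unfolding norm_mult by (intro mult_le_one theta_norm_le b_le z norm_ge_zero)
  have mate: "AE t in angle. ((\<lambda>r. (cmod (a (of_real r * cis t)))\<^sup>2 +
      (cmod (theta (of_real r * cis t) * b (of_real r * cis t)))\<^sup>2) \<longlongrightarrow> 1) (at_left 1)"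
  proof -
    have "AE \<zeta> in distr angle borel cis. \<exists>u v. has_radial_limit a u \<zeta> \<and> has_radial_limit b v \<zeta> \<and> (cmod u)\<^sup>2 + (cmod v)\<^sup>2 = 1"
      using assms(5) unfolding pythagorean_mate_def circle_measure_angle by blast
    from AE_distrD[OF cis_measurable_angle this] AE_cis_ne_1
    show ?thesis
    proof eventually_elim
      case (elim t)
      then obtain u v where u: "((\<lambda>r::real. a (of_real r * cis t)) \<longlongrightarrow> u) (at_left 1)"
        and v: "((\<lambda>r::real. b (of_real r * cis t)) \<longlongrightarrow> v) (at_left 1)" and uv: "(cmod u)\<^sup>2 + (cmod v)\<^sup>2 = 1"
        unfolding has_radial_limit_def by blast
      have "((\<lambda>r. (cmod (a (of_real r * cis t)))\<^sup>2 + (cmod (theta (of_real r * cis t)) * cmod (b (of_real r * cis t)))\<^sup>2)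
          \<longlongrightarrow> (cmod u)\<^sup>2 + (1 * cmod v)\<^sup>2) (at_left 1)"
        by (intro tendsto_intros u v theta_radial elim)
      then show ?case by (simp add: norm_mult uv)
    qed
  qed
  \<comment> \<open>The factor \<open>2 powr c\<close> bounds \<open>|a| = |b| |1 - z| powr c\<close>.\<close>
  interpret S: singular_quotient "\<lambda>z. theta z * b z" H ip a "2 powr c" c
  proof (intro singular_quotient.intro mate_quotient.intro mate_pair.intro assms(7)
      mate_pair_axioms.intro mate_quotient_axioms.intro singular_quotient_axioms.intro)
    show "(\<lambda>z. theta z * b z) holomorphic_on unit_disk" by (intro holomorphic_intros theta_hol assms)
    show "(\<lambda>z. theta z * phi c z) holomorphic_on unit_disk" by (intro holomorphic_intros theta_hol phi_hol)
    show "theta z * b z = theta z * phi c z * a z" if "z \<in> unit_disk" for z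
      by (simp add: b_eq[OF that])
    show "cnj (taylor (\<lambda>z. theta z * phi c z) n) = taylor (\<lambda>z. theta z * phi c z) n" for n
      by (rule Phi_coeff_real)
  qed (use a_hol a_bd B_bd mate outer assms(1) in blast)+
  have "dirichlet_space \<subseteq> H \<and> compact_inclusion dirichlet_space dirichlet_norm H ip" if c: "c < 1"
  proof -
    have est: "\<exists>C\<ge>0. \<forall>f\<in>dirichlet_space. f \<in> H \<and> ip_norm ip f \<le> C * hardy_norm f + e * dirichlet_norm f"
      if e: "0 < e" for e
    proof -
      obtain C where C: "0 \<le> C" and bd: "\<And>N q. tnorm N (fps_expansion (\<lambda>z. theta z * phi c z) 0 * q) \<le> C * tnorm N q + e * sqrt (tdirichlet_sq N q)"
        using Phi_bound_subcritical[OF assms(1) c e] by blast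
      show ?thesis
        using S.dirichlet_embeds[OF bd C less_imp_le[OF e]] C by (intro exI[of _ "1 + C"]) auto
    qed
    have sub: "dirichlet_space \<subseteq> H" using est[of 1] by auto
    show ?thesis
      using sub by (intro conjI S.compact_inclusion_of_interpolation) (use est in blast)+
  qed
  moreover have "dirichlet_space \<subseteq> H \<and> \<not> compact_inclusion dirichlet_space dirichlet_norm H ip" if c: "c = 1"
  proof -
    have "tnorm N (fps_expansion (\<lambda>z. theta z * phi c z) 0 * q) \<le> 0 * tnorm N q + 1 * sqrt (tdirichlet_sq N q)" for N q
      using Phi_bound_critical[of N q] by (simp add: c)
    then have "dirichlet_space \<subseteq> H" using S.dirichlet_embeds(1)[of 0 1] by auto
    then show ?thesis using S.critical_not_compact[OF c] by simp
  qed
  moreover have "\<not> dirichlet_space \<subseteq> H" if "1 < c" by (rule S.supercritical_not_subset[OF that])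
  ultimately show ?thesis by blast
qed

end
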